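(* Consider the simplified aircraft model (with states $x,y,z,V,\gamma,\chi,\alpha,\beta,\mu,p,q,r$ and controls $F,\delta_l,\delta_m,\delta_n$), and let $\Delta$ be the $3\times4$ Jacobian matrix $$\Delta=\left(\frac{\partial Q}{\partial\xi}\ \Big|\ Q\in\{X,\ \sin(\mu)Y+\cos(\mu)Z,\ -\cos(\mu)Y+\sin(\mu)Z\},\ \xi\in\Xi_2\right),\qquad \Xi_2=\{\alpha,\beta,\mu,F\}.$$ The model is flat at every point where the matrix $\Delta$ has full rank. For $\xi\in\Xi_2$ let $\Delta_\xi$ be the matrix $\Delta$ in which the column corresponding to $\xi$ has been suppressed. If $|\Delta_\xi|\neq0$ at some point, then $x,y,z,\xi$ is a regular flat output at that point.
   Context: Simplified aircraft model. Parameters: mass $m>0$, gravity $g>0$, wing area $S>0$, wing span $a>0$, mean aerodynamic chord $b>0$, constants $\epsilon$, $y_p$, air density $\rho>0$ (a constant, or an analytic function of $z$), an invertible inertia matrix $$\mathcal J=\begin{pmatrix}I_{xx}&0&-I_{xz}\\0&I_{yy}&0\\-I_{xz}&0&I_{zz}\end{pmatrix}.$$ Forces (gravity included) and torques: $X=F\cos(\alpha+\epsilon)\cos\beta-\frac\rho2SV^2C_x-gm\sin\gamma$, $Y=F\cos(\alpha+\epsilon)\sin\beta+\frac\rho2SV^2C_y+gm\cos\gamma\sin\mu$, $Z=-F\sin(\alpha+\epsilon)-\frac\rho2SV^2C_z+gm\cos\gamma\cos\mu$, $L=-y_p\sin(\epsilon)(F_1-F_2)+\frac\rho2SV^2aC_l$,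 $M=\frac\rho2SV^2bC_m$, $N=y_p\cos(\epsilon)(F_1-F_2)+\frac\rho2SV^2aC_n$, where $F_1,F_2$ are the thrusts of the right and left engines, $F=F_1+F_2$, and $F_1-F_2$ is a known constant multiple of $F$. In the simplified model, $p,q,r,\delta_l,\delta_m,\delta_n$ are replaced by $0$ (or known constants) in the expressions of $C_x,C_y,C_z$, so that these are analytic functions of $\alpha,\beta$ only; $C_l,C_m,C_n$ are analytic functions of $\alpha,\beta,p,q,r,\delta_l,\delta_m,\delta_n$. Equations: $x'=V\cos\chi\cos\gamma$, $y'=V\sin\chi\cos\gamma$, $z'=-V\sin\gamma$, $V'=X/m$, $\gamma'=-\frac{Y\sin\mu+Z\cos\mu}{mV}$, $\chi'=\frac{Y\cos\mu-Z\sin\mu}{mV\cos\gamma}$, $\alpha'=\frac1{\cos\beta}\left(-p\cos\alpha\sin\beta+q\cos\beta-r\sin\alpha\sin\beta+\frac{Z}{mV}\right)$, $\beta'=p\sin\alpha-r\cos\alpha+\frac{Y}{mV}$, $\mu'=\frac1{\cos\beta}\left(p\cos\alpha+r\sin\alpha+\frac1{mV}\left(Y\cos\mu\tan\gamma\cos\beta-Z(\sin\mu\tan\gamma\cos\beta+\sin\beta)\right)\right)$, $(p',q',r')^{\rm t}=\mathcal J^{-1}\left((I_{yy}-I_{zz})qr+I_{xz}pq+L,\ (I_{zz}-I_{xx})pr+I_{xz}(r^2-p^2)+M,\ (I_{xx}-I_{yy})pq-I_{xz}rq+N\right)^{\rm t}$. Only points with $V\cos\gamma\cos\beta\neq0$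 and $\det\left(\partial C_i/\partial\delta_j\right)_{i,j\in\{l,m,n\}}\neq0$ are considered. Flatness. The model defines a diffiety with coordinates $t$, the $12$ states and all derivatives of the $4$ controls, with the derivation given by $t'=1$, $x'=V\cos\chi\cos\gamma$, $y'=V\sin\chi\cos\gamma$, $z'=-V\sin\gamma$, $V'=X/m$, $\gamma'=-\frac{Y\sin\mu+Z\cos\mu}{mV}$, $\chi'=\frac{Y\cos\mu-Z\sin\mu}{mV\cos\gamma}$, $\alpha'=\frac1{\cos\beta}\left(-p\cos\alpha\sin\beta+q\cos\beta-r\sin\alpha\sin\beta+\frac{Z}{mV}\right)$, $\beta'=p\sin\alpha-r\cos\alpha+\frac{Y}{mV}$, $\mu'=\frac1{\cos\beta}\left(p\cos\alpha+r\sin\alpha+\frac1{mV}\left(Y\cos\mu\tan\gamma\cos\beta-Z(\sin\mu\tan\gamma\cos\beta+\sin\beta)\right)\right)$, $(p',q',r')^{\rm t}=\mathcal J^{-1}\left((I_{yy}-I_{zz})qr+I_{xz}pq+L,\ (I_{zz}-I_{xx})pr+I_{xz}(r^2-p^2)+M,\ (I_{xx}-I_{yy})pq-I_{xz}rq+N\right)^{\rm t}$, and $(u^{(k)})'=u^{(k+1)}$ for each control $u$. The jet space $\mathbf J(\mathbb R,\mathbb R^4)$ has coordinates $t,\zeta_i^{(k)}$ ($1\le i\le4$, $k\in\mathbb N$) and derivation $\partial_t+\sum\zeta_i^{(k+1)}\partial/\partial\zeta_i^{(k)}$; in both cases open sets are those defined by open conditions on finitely many coordinates. The model is flat at a point if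 this point has a neighborhood isomorphic to an open subset of $\mathbf J(\mathbb R,\mathbb R^4)$ by a smooth bijection with smooth inverse, depending coordinatewise on finitely many coordinates and compatible with the derivations. Functions $z_1,\dots,z_4$ are a regular flat output at a point if there is such an isomorphism near this point for which $z_i$ is the pull-back of $\zeta_i$. *)

theory Defs
  imports "HOL-Analysis.Analysis"
begin

section \<open>Real analytic functions of several variables\<close>

text \<open>
  Around every point of \<open>S\<close>, \<open>f\<close> is the sum of an (unconditionally, hence absolutely) convergent
  power series in the coordinates; the multi-indices are the functions \<open>Basis \<rightarrow> nat\<close>.
\<close>
definition real_analytic_on :: "('a::euclidean_space \<Rightarrow> real) \<Rightarrow> 'a set \<Rightarrow> bool" where
  "real_analytic_on f S \<longleftrightarrow>
     (\<forall>a\<in>S. \<exists>r>0. \<exists>c. \<forall>x\<in>ball a r.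
        ((\<lambda>k. c k * (\<Prod>b\<in>Basis. ((x - a) \<bullet> b) ^ k b)) has_sum f x) (Basis \<rightarrow>\<^sub>E (UNIV :: nat set)))"

section \<open>Diffieties given by coordinates\<close>

text \<open>
  A point is the family \<open>'c \<Rightarrow> real\<close> of its coordinates, and a diffiety is a set of points with the
  vector field \<open>v\<close> whose value \<open>v p c\<close> is the derivative of the coordinate \<open>c\<close> at \<open>p\<close>.
  The type \<open>'c \<Rightarrow> real\<close> carries the product topology.
\<close>

definition cylinder_open :: "('c \<Rightarrow> real) set \<Rightarrow> bool" where
  "cylinder_open U \<longleftrightarrow>
     open U \<and> (\<exists>A. finite A \<and> (\<forall>p q. (\<forall>c\<in>A. p c = q c) \<longrightarrow> (p \<in> U \<longleftrightarrow> q \<in> U)))"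

definition partial :: "'c \<Rightarrow> (('c \<Rightarrow> real) \<Rightarrow> real) \<Rightarrow> ('c \<Rightarrow> real) \<Rightarrow> real" where
  "partial c f p = deriv (\<lambda>s. f (p(c := s))) (p c)"

text \<open>
  Smooth functions: they depend on finitely many coordinates only, and all their iterated partial
  derivatives exist and are continuous.
\<close>
definition smooth_fun_on :: "('c \<Rightarrow> real) set \<Rightarrow> (('c \<Rightarrow> real) \<Rightarrow> real) \<Rightarrow> bool" where
  "smooth_fun_on U f \<longleftrightarrow>
     (\<exists>A. finite A \<and> (\<forall>p\<in>U. \<forall>q\<in>U. (\<forall>c\<in>A. p c = q c) \<longrightarrow> f p = f q)) \<and>
     (\<forall>cs. continuous_on U (fold partial cs f) \<and>
           (\<forall>c. \<forall>p\<in>U. (\<lambda>s. fold partial cs f (p(c := s))) field_differentiable at (p c)))"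

definition smooth_map_on ::
    "('c \<Rightarrow> real) set \<Rightarrow> (('c \<Rightarrow> real) \<Rightarrow> 'd \<Rightarrow> real) \<Rightarrow> bool" where
  "smooth_map_on U \<phi> \<longleftrightarrow> (\<forall>d. smooth_fun_on U (\<lambda>p. \<phi> p d))"

text \<open>
  The derivation \<open>\<Sum>c. v\<^sub>c \<partial>/\<partial>c\<close>; for a function of finitely many coordinates the sum is finite.
\<close>
definition derivation ::
    "(('c \<Rightarrow> real) \<Rightarrow> 'c \<Rightarrow> real) \<Rightarrow> (('c \<Rightarrow> real) \<Rightarrow> real) \<Rightarrow> ('c \<Rightarrow> real) \<Rightarrow> real" where
  "derivation v f p = (\<Sum>c | partial c f p \<noteq> 0. v p c * partial c f p)"

definition diffiety_iso ::
    "(('c \<Rightarrow> real) \<Rightarrow> 'c \<Rightarrow> real) \<Rightarrow> ('c \<Rightarrow> real) set \<Rightarrow>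
     (('d \<Rightarrow> real) \<Rightarrow> 'd \<Rightarrow> real) \<Rightarrow> ('d \<Rightarrow> real) set \<Rightarrow>
     (('c \<Rightarrow> real) \<Rightarrow> 'd \<Rightarrow> real) \<Rightarrow> bool" where
  "diffiety_iso v U w W \<phi> \<longleftrightarrow>
     bij_betw \<phi> U W \<and> smooth_map_on U \<phi> \<and> smooth_map_on W (inv_into U \<phi>) \<and>
     (\<forall>g. smooth_fun_on W g \<longrightarrow>
        (\<forall>p\<in>U. derivation v (\<lambda>q. g (\<phi> q)) p = derivation w g (\<phi> p)))"

datatype 'n jet_coord = Jet_time | Zeta 'n nat

primrec jet_field :: "('n jet_coord \<Rightarrow> real) \<Rightarrow> 'n jet_coord \<Rightarrow> real" where
  "jet_field \<zeta> Jet_time = 1"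
| "jet_field \<zeta> (Zeta i k) = \<zeta> (Zeta i (Suc k))"

definition flat_chart ::
    "('c \<Rightarrow> real) set \<Rightarrow> (('c \<Rightarrow> real) \<Rightarrow> 'c \<Rightarrow> real) \<Rightarrow> ('c \<Rightarrow> real) \<Rightarrow>
     ('c \<Rightarrow> real) set \<Rightarrow> ('n jet_coord \<Rightarrow> real) set \<Rightarrow>
     (('c \<Rightarrow> real) \<Rightarrow> 'n jet_coord \<Rightarrow> real) \<Rightarrow> bool" where
  "flat_chart D v p U W \<phi> \<longleftrightarrow>
     cylinder_open U \<and> U \<subseteq> D \<and> p \<in> U \<and> cylinder_open W \<and> diffiety_iso v U jet_field W \<phi>"

section \<open>The simplified aircraft model\<close>

text \<open>
  \<open>thrust_ratio\<close> is the known constant \<open>(F\<^sub>1 - F\<^sub>2) / F\<close>.  The aerodynamic coefficients and the air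
  density are given together with the open sets on which they are defined.  The arguments of
  \<open>C_x\<close>, \<open>C_y\<close>, \<open>C_z\<close> are \<open>(\<alpha>, \<beta>)\<close>; those of \<open>C_l\<close>, \<open>C_m\<close>, \<open>C_n\<close> are
  \<open>(\<alpha>, \<beta>, p, q, r, \<delta>\<^sub>l, \<delta>\<^sub>m, \<delta>\<^sub>n)\<close>; the argument of \<open>air_density\<close> is the coordinate \<open>z\<close>.
\<close>

type_synonym real8 = "real \<times> real \<times> real \<times> real \<times> real \<times> real \<times> real \<times> real"

record aircraft =
  mass :: real
  gravity :: real
  wing_area :: real
  wing_span :: real
  chord :: real
  eps :: real
  y_p :: real
  thrust_ratio :: real
  I_xx :: real
  I_yy :: real
  I_zz :: real
  I_xz :: real
  density_dom :: "real set"
  air_density :: "real \<Rightarrow> real"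
  force_dom :: "(real \<times> real) set"
  C_x :: "real \<times> real \<Rightarrow> real"
  C_y :: "real \<times> real \<Rightarrow> real"
  C_z :: "real \<times> real \<Rightarrow> real"
  torque_dom :: "real8 set"
  C_l :: "real8 \<Rightarrow> real"
  C_m :: "real8 \<Rightarrow> real"
  C_n :: "real8 \<Rightarrow> real"

definition inertia :: "aircraft \<Rightarrow> real^3^3" where
  "inertia A = vector [vector [I_xx A, 0, - I_xz A],
                       vector [0, I_yy A, 0],
                       vector [- I_xz A, 0, I_zz A]]"

definition aircraft_model :: "aircraft \<Rightarrow> bool" where
  "aircraft_model A \<longleftrightarrow>
     mass A > 0 \<and> gravity A > 0 \<and> wing_area A > 0 \<and> wing_span A > 0 \<and> chord A > 0 \<and>
     invertible (inertia A) \<and>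
     open (density_dom A) \<and> real_analytic_on (air_density A) (density_dom A) \<and>
     (\<forall>z\<in>density_dom A. air_density A z > 0) \<and>
     open (force_dom A) \<and> real_analytic_on (C_x A) (force_dom A) \<and>
     real_analytic_on (C_y A) (force_dom A) \<and> real_analytic_on (C_z A) (force_dom A) \<and>
     open (torque_dom A) \<and> real_analytic_on (C_l A) (torque_dom A) \<and>
     real_analytic_on (C_m A) (torque_dom A) \<and> real_analytic_on (C_n A) (torque_dom A)"

datatype state =
  St_x | St_y | St_z | St_V | St_gamma | St_chi | St_alpha | St_beta | St_mu | St_p | St_q | St_r

datatype control = Ct_F | Ct_l | Ct_m | Ct_n

text \<open>\<open>Control u k\<close> is the \<open>k\<close>-th derivative of the control \<open>u\<close>.\<close>
datatype coord = Time | State state | Control control nat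

type_synonym point = "coord \<Rightarrow> real"

definition dyn_pressure_area :: "aircraft \<Rightarrow> point \<Rightarrow> real" where
  "dyn_pressure_area A P =
     air_density A (P (State St_z)) / 2 * wing_area A * (P (State St_V))\<^sup>2"

definition force_args :: "point \<Rightarrow> real \<times> real" where
  "force_args P = (P (State St_alpha), P (State St_beta))"

definition torque_args :: "point \<Rightarrow> real8" where
  "torque_args P =
     (P (State St_alpha), P (State St_beta), P (State St_p), P (State St_q), P (State St_r),
      P (Control Ct_l 0), P (Control Ct_m 0), P (Control Ct_n 0))"

definition force_X :: "aircraft \<Rightarrow> point \<Rightarrow> real" where
  "force_X A P =
     (let F = P (Control Ct_F 0); \<alpha> = P (State St_alpha); \<beta> = P (State St_beta);
          \<gamma> = P (State St_gamma)
      in F * cos (\<alpha> + eps A) * cos \<beta> - dyn_pressure_area A P * C_x A (force_args P)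
         - gravity A * mass A * sin \<gamma>)"

definition force_Y :: "aircraft \<Rightarrow> point \<Rightarrow> real" where
  "force_Y A P =
     (let F = P (Control Ct_F 0); \<alpha> = P (State St_alpha); \<beta> = P (State St_beta);
          \<gamma> = P (State St_gamma); \<mu> = P (State St_mu)
      in F * cos (\<alpha> + eps A) * sin \<beta> + dyn_pressure_area A P * C_y A (force_args P)
         + gravity A * mass A * cos \<gamma> * sin \<mu>)"

definition force_Z :: "aircraft \<Rightarrow> point \<Rightarrow> real" where
  "force_Z A P =
     (let F = P (Control Ct_F 0); \<alpha> = P (State St_alpha);
          \<gamma> = P (State St_gamma); \<mu> = P (State St_mu)
      in - F * sin (\<alpha> + eps A) - dyn_pressure_area A P * C_z A (force_args P)
         + gravity A * mass A * cos \<gamma> * cos \<mu>)"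

definition torque_L :: "aircraft \<Rightarrow> point \<Rightarrow> real" where
  "torque_L A P =
     - y_p A * sin (eps A) * (thrust_ratio A * P (Control Ct_F 0))
     + dyn_pressure_area A P * wing_span A * C_l A (torque_args P)"

definition torque_M :: "aircraft \<Rightarrow> point \<Rightarrow> real" where
  "torque_M A P = dyn_pressure_area A P * chord A * C_m A (torque_args P)"

definition torque_N :: "aircraft \<Rightarrow> point \<Rightarrow> real" where
  "torque_N A P =
     y_p A * cos (eps A) * (thrust_ratio A * P (Control Ct_F 0))
     + dyn_pressure_area A P * wing_span A * C_n A (torque_args P)"

definition angular_acceleration :: "aircraft \<Rightarrow> point \<Rightarrow> real^3" where
  "angular_acceleration A P =
     (let p = P (State St_p); q = P (State St_q); r = P (State St_r)
      in matrix_inv (inertia A) *v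
           vector [(I_yy A - I_zz A) * q * r + I_xz A * p * q + torque_L A P,
                   (I_zz A - I_xx A) * p * r + I_xz A * (r\<^sup>2 - p\<^sup>2) + torque_M A P,
                   (I_xx A - I_yy A) * p * q - I_xz A * r * q + torque_N A P])"

definition state_derivative :: "aircraft \<Rightarrow> point \<Rightarrow> state \<Rightarrow> real" where
  "state_derivative A P s =
     (let X = force_X A P; Y = force_Y A P; Z = force_Z A P; m = mass A;
          V = P (State St_V); \<gamma> = P (State St_gamma); chi = P (State St_chi);
          \<alpha> = P (State St_alpha); \<beta> = P (State St_beta); \<mu> = P (State St_mu);
          p = P (State St_p); q = P (State St_q); r = P (State St_r)
      in case s of
           St_x \<Rightarrow> V * cos chi * cos \<gamma>
         | St_y \<Rightarrow> V * sin chi * cos \<gamma>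
         | St_z \<Rightarrow> - V * sin \<gamma>
         | St_V \<Rightarrow> X / m
         | St_gamma \<Rightarrow> - (Y * sin \<mu> + Z * cos \<mu>) / (m * V)
         | St_chi \<Rightarrow> (Y * cos \<mu> - Z * sin \<mu>) / (m * V * cos \<gamma>)
         | St_alpha \<Rightarrow> 1 / cos \<beta> *
             (- p * cos \<alpha> * sin \<beta> + q * cos \<beta> - r * sin \<alpha> * sin \<beta> + Z / (m * V))
         | St_beta \<Rightarrow> p * sin \<alpha> - r * cos \<alpha> + Y / (m * V)
         | St_mu \<Rightarrow> 1 / cos \<beta> *
             (p * cos \<alpha> + r * sin \<alpha>
              + 1 / (m * V) * (Y * cos \<mu> * tan \<gamma> * cos \<beta>
                               - Z * (sin \<mu> * tan \<gamma> * cos \<beta> + sin \<beta>)))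
         | St_p \<Rightarrow> angular_acceleration A P $ 1
         | St_q \<Rightarrow> angular_acceleration A P $ 2
         | St_r \<Rightarrow> angular_acceleration A P $ 3)"

primrec aircraft_field :: "aircraft \<Rightarrow> point \<Rightarrow> coord \<Rightarrow> real" where
  "aircraft_field A P Time = 1"
| "aircraft_field A P (State s) = state_derivative A P s"
| "aircraft_field A P (Control u k) = P (Control u (Suc k))"

definition torque_jacobian :: "aircraft \<Rightarrow> point \<Rightarrow> real^3^3" where
  "torque_jacobian A P =
     (\<chi> i j. partial (if j = 1 then Control Ct_l 0 else if j = 2 then Control Ct_m 0
                        else Control Ct_n 0)
              (\<lambda>Q. (vector [C_l A (torque_args Q), C_m A (torque_args Q), C_n A (torque_args Q)]
                     :: real^3) $ i) P)"

definition aircraft_dom :: "aircraft \<Rightarrow> point set" where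
  "aircraft_dom A =
     {P. P (State St_z) \<in> density_dom A \<and> force_args P \<in> force_dom A \<and>
         torque_args P \<in> torque_dom A \<and>
         P (State St_V) * cos (P (State St_gamma)) * cos (P (State St_beta)) \<noteq> 0 \<and>
         det (torque_jacobian A P) \<noteq> 0}"

definition aircraft_flat_at :: "aircraft \<Rightarrow> point \<Rightarrow> bool" where
  "aircraft_flat_at A P \<longleftrightarrow>
     (\<exists>U W (\<phi> :: point \<Rightarrow> 4 jet_coord \<Rightarrow> real).
        flat_chart (aircraft_dom A) (aircraft_field A) P U W \<phi>)"

definition aircraft_regular_flat_output :: "aircraft \<Rightarrow> point \<Rightarrow> (point \<Rightarrow> real^4) \<Rightarrow> bool" where
  "aircraft_regular_flat_output A P out \<longleftrightarrow>
     (\<exists>U W (\<phi> :: point \<Rightarrow> 4 jet_coord \<Rightarrow> real).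
        flat_chart (aircraft_dom A) (aircraft_field A) P U W \<phi> \<and>
        (\<forall>Q\<in>U. \<forall>i. out Q $ i = \<phi> Q (Zeta i 0)))"

definition Xi2 :: "4 \<Rightarrow> coord" where
  "Xi2 j = (if j = 1 then State St_alpha else if j = 2 then State St_beta
            else if j = 3 then State St_mu else Control Ct_F 0)"

definition Delta_rows :: "aircraft \<Rightarrow> point \<Rightarrow> real^3" where
  "Delta_rows A P =
     (let X = force_X A P; Y = force_Y A P; Z = force_Z A P; \<mu> = P (State St_mu)
      in vector [X, sin \<mu> * Y + cos \<mu> * Z, - cos \<mu> * Y + sin \<mu> * Z])"

definition Delta :: "aircraft \<Rightarrow> point \<Rightarrow> real^4^3" where
  "Delta A P = (\<chi> i j. partial (Xi2 j) (\<lambda>Q. Delta_rows A Q $ i) P)"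

text \<open>Suppression of the column \<open>k\<close>; the remaining columns keep their order.\<close>
definition drop_column :: "real^4^3 \<Rightarrow> 4 \<Rightarrow> real^3^3" where
  "drop_column M k = (\<chi> i j. M $ i $ ((vector (filter (\<lambda>l. l \<noteq> k) [1, 2, 3, 4]) :: 4^3) $ j))"

end

theory Submission
  imports Defs
begin

text \<open>
  Let \<open>\<phi>\<close> be the map from the aircraft diffiety to the jet space given by \<open>t\<close> and by all derivatives
  of the candidate output \<open>(x, y, z, \<xi>)\<close> along the aircraft field. It respects the derivations, and
  what has to be found is a smooth local inverse \<open>\<psi>\<close>. The model has a triangular structure which
  yields the components of \<open>\<psi>\<close> in four steps, each of which solves three equations for three new
  unknowns:

  \<^item> \<open>x', y', z'\<close> determine \<open>V, \<gamma>, \<chi>\<close>, as \<open>V cos \<gamma> \<noteq> 0\<close>;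
  \<^item> \<open>V', \<gamma>', \<chi>'\<close> determine the three variables of \<open>\<Xi>\<^sub>2 = {\<alpha>, \<beta>, \<mu>, F}\<close> other than \<open>\<xi>\<close>, as \<open>|\<Delta>\<^sub>\<xi>| \<noteq> 0\<close>;
  \<^item> \<open>\<alpha>', \<beta>', \<mu>'\<close> determine \<open>p, q, r\<close>, as \<open>cos \<beta> \<noteq> 0\<close>;
  \<^item> \<open>p', q', r'\<close> determine \<open>\<delta>\<^sub>l, \<delta>\<^sub>m, \<delta>\<^sub>n\<close>, as \<open>det (\<partial>C\<^sub>i/\<partial>\<delta>\<^sub>j) \<noteq> 0\<close>.

  In each step the left-hand sides are derivatives, in the jet space, of components of \<open>\<psi>\<close> that are
  already known, and the equations say exactly that \<open>\<psi>\<close> respects the derivation on these components.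
  The derivatives of the controls are obtained by differentiating the components for the controls.
  In the end \<open>\<psi>\<close> respects the derivations altogether, \<open>\<psi> \<circ> \<phi>\<close> is the identity near the given point by
  local uniqueness of the solutions, and \<open>\<phi> \<circ> \<psi>\<close> is the identity because it is so on \<open>t\<close> and on the four
  jet coordinates of order zero. The common form of the four steps is \<open>partial_inverse_step\<close>.

  If \<open>\<Delta>\<close> has rank \<open>3\<close>, some minor \<open>|\<Delta>\<^sub>\<xi>|\<close> does not vanish (\<open>rank_3_imp_minor\<close>), so that the first claim follows
  from the second.

  The analytic tools are developed for functions of finitely many out of infinitely many
  coordinates: the chain rule (\<open>has_partial_compose\<close>, \<open>derivation_compose\<close>), the smoothness of compositions,
  the smoothness of real analytic coefficients (\<open>smooth_analytic\<close>), and an implicit function theorem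
  (\<open>local_diffeo_family\<close>), which is reduced to the case of one unknown by Gaussian elimination.
\<close>

section \<open>Open sets and coordinate lines in spaces of coordinate families\<close>

lemma continuous_fun_upd: "continuous_on UNIV (\<lambda>s::real. p(c := s))"
proof (rule continuous_on_coordinatewise_then_product)
  show "continuous_on UNIV (\<lambda>s::real. (p(c := s)) i)" for i
    by (cases "i = c") auto
qed

lemma eventually_fun_upd_in_open:
  fixes p :: "'c \<Rightarrow> real"
  assumes "open U" "p \<in> U"
  shows "eventually (\<lambda>s. p(c := s) \<in> U) (nhds (p c))"
proof -
  have "open ((\<lambda>s. p(c := s)) -` U)"
    using assms(1) continuous_fun_upd by (intro open_vimage) auto
  then show ?thesis
    using assms(2) eventually_nhds_in_open[of "(\<lambda>s. p(c := s)) -` U" "p c"] by simp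
qed

lemma open_contains_box:
  fixes U :: "('c \<Rightarrow> real) set"
  assumes "open U" "q \<in> U"
  obtains B d where "finite B" "d > 0" "\<And>p. (\<And>b. b \<in> B \<Longrightarrow> \<bar>p b - q b\<bar> < d) \<Longrightarrow> p \<in> U"
proof -
  have "openin (product_topology (\<lambda>_. euclidean) UNIV) U"
    using assms(1) by (simp add: open_fun_def)
  from product_topology_open_contains_basis[OF this assms(2)]
  obtain X where X: "q \<in> Pi\<^sub>E UNIV X" "\<And>i. open (X i)" "finite {i. X i \<noteq> UNIV}" "Pi\<^sub>E UNIV X \<subseteq> U"
    by auto
  define B where "B = {i. X i \<noteq> UNIV}"
  have "\<forall>i. \<exists>e>0. \<forall>y. \<bar>y - q i\<bar> < e \<longrightarrow> y \<in> X i"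
    using X(1,2) by (auto simp: open_dist dist_real_def PiE_iff)
  then obtain e where e: "\<And>i. e i > 0" "\<And>i y. \<bar>y - q i\<bar> < e i \<Longrightarrow> y \<in> X i"
    by metis
  define d where "d = Min (insert 1 (e ` B))"
  have "d > 0"
    using X(3) e(1) by (auto simp: d_def B_def)
  moreover have "d \<le> e i" if "i \<in> B" for i
    using X(3) that by (auto simp: d_def B_def)
  moreover have "p \<in> U" if "\<And>b. b \<in> B \<Longrightarrow> \<bar>p b - q b\<bar> < d" for p
  proof -
    have "p i \<in> X i" for i
      by (cases "i \<in> B") (use that calculation(2) e(2) in \<open>force simp: B_def\<close>)+
    then show ?thesis using X(4) by (auto simp: PiE_iff)
  qed
  ultimately show thesis
    using that X(3) B_def by blast
qed

lemma open_box:
  fixes q :: "'c \<Rightarrow> real"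
  assumes "finite B"
  shows "open {p. \<forall>b\<in>B. \<bar>p b - q b\<bar> < d}"
proof -
  have "{p. \<forall>b\<in>B. \<bar>p b - q b\<bar> < d} = (\<Inter>b\<in>B. {p. \<bar>p b - q b\<bar> < d})" by auto
  also have "open \<dots>"
    using assms by (intro open_INT) (auto intro!: open_Collect_less continuous_intros)
  finally show ?thesis .
qed

lemma cylinder_openI:
  assumes "open U" "finite A"
    "\<And>p q. p \<in> U \<Longrightarrow> (\<And>c. c \<in> A \<Longrightarrow> p c = q c) \<Longrightarrow> q \<in> U"
  shows "cylinder_open U"
  unfolding cylinder_open_def
proof (intro conjI assms(1) exI[of _ A] assms(2) allI impI)
  fix p q :: "'a \<Rightarrow> real" assume "\<forall>c\<in>A. p c = q c"
  then show "p \<in> U \<longleftrightarrow> q \<in> U"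
    using assms(3)[of p q] assms(3)[of q p] by auto
qed

lemma cylinder_openE:
  assumes "cylinder_open U"
  obtains A where "finite A" "\<And>p q. (\<And>c. c \<in> A \<Longrightarrow> p c = q c) \<Longrightarrow> p \<in> U \<longleftrightarrow> q \<in> U"
proof -
  obtain A where A: "finite A \<and> (\<forall>p q. (\<forall>c\<in>A. p c = q c) \<longrightarrow> (p \<in> U \<longleftrightarrow> q \<in> U))"
    using conjunct2[OF assms[unfolded cylinder_open_def]] by (rule exE)
  show thesis
  proof (rule that[OF conjunct1[OF A]])
    fix p q :: "'a \<Rightarrow> real" assume "\<And>c. c \<in> A \<Longrightarrow> p c = q c"
    then show "p \<in> U \<longleftrightarrow> q \<in> U"
      using conjunct2[OF A, rule_format, of p q] by simp
  qed
qed

lemma cylinder_openD: "cylinder_open U \<Longrightarrow> open U"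
  by (simp add: cylinder_open_def)

lemma cylinder_open_box: "finite B \<Longrightarrow> cylinder_open {p. \<forall>b\<in>B. \<bar>p b - q b\<bar> < d}"
  by (rule cylinder_openI[OF open_box]) auto

lemma open_contains_cylinder_open:
  assumes "open U" "q \<in> U"
  obtains N where "cylinder_open N" "q \<in> N" "N \<subseteq> U"
proof -
  obtain B d where "finite B" "d > 0" "\<And>p. (\<And>b. b \<in> B \<Longrightarrow> \<bar>p b - q b\<bar> < d) \<Longrightarrow> p \<in> U"
    by (rule open_contains_box[OF assms]) blast
  then have "{p. \<forall>b\<in>B. \<bar>p b - q b\<bar> < d} \<subseteq> U" "q \<in> {p. \<forall>b\<in>B. \<bar>p b - q b\<bar> < d}" by auto
  then show thesis
    using that cylinder_open_box[OF \<open>finite B\<close>] by blast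
qed

section \<open>Functions of finitely many coordinates, of class \<open>C\<^sup>n\<close>\<close>

definition finitary_on :: "('c \<Rightarrow> real) set \<Rightarrow> (('c \<Rightarrow> real) \<Rightarrow> real) \<Rightarrow> bool" where
  "finitary_on U f \<longleftrightarrow> (\<exists>A. finite A \<and> (\<forall>p\<in>U. \<forall>q\<in>U. (\<forall>c\<in>A. p c = q c) \<longrightarrow> f p = f q))"

definition has_partial ::
    "'c \<Rightarrow> (('c \<Rightarrow> real) \<Rightarrow> real) \<Rightarrow> real \<Rightarrow> ('c \<Rightarrow> real) \<Rightarrow> bool" where
  "has_partial c f D p \<longleftrightarrow> ((\<lambda>s. f (p(c := s))) has_field_derivative D) (at (p c))"

text \<open>
  \<open>smooth_fun_on\<close> speaks of all iterated partial derivatives at once. Cutting off at order \<open>n\<close> makes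
  induction possible; asking only for some function \<open>g\<close> that is the derivative on \<open>U\<close> keeps the values
  of \<open>f\<close> outside \<open>U\<close> out of sight.
\<close>
primrec Ck :: "nat \<Rightarrow> ('c \<Rightarrow> real) set \<Rightarrow> (('c \<Rightarrow> real) \<Rightarrow> real) \<Rightarrow> bool" where
  "Ck 0 U f \<longleftrightarrow> continuous_on U f"
| "Ck (Suc n) U f \<longleftrightarrow>
     continuous_on U f \<and> (\<forall>c. \<exists>g. Ck n U g \<and> (\<forall>p\<in>U. has_partial c f (g p) p))"

lemma has_partial_imp_partial: "has_partial c f D p \<Longrightarrow> partial c f p = D"
  unfolding has_partial_def partial_def by (rule DERIV_imp_deriv)

lemma has_partial_cong:
  assumes "open U" "p \<in> U" "\<And>q. q \<in> U \<Longrightarrow> f q = g q"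
  shows "has_partial c f D p \<longleftrightarrow> has_partial c g D p"
  unfolding has_partial_def
  by (rule DERIV_cong_ev) (auto intro: eventually_mono[OF eventually_fun_upd_in_open[OF assms(1,2)]] assms(3))

lemma partial_cong:
  assumes "open U" "p \<in> U" "\<And>q. q \<in> U \<Longrightarrow> f q = g q"
  shows "partial c f p = partial c g p"
  unfolding partial_def
  by (rule deriv_cong_ev) (auto intro: eventually_mono[OF eventually_fun_upd_in_open[OF assms(1,2)]] assms(3))

lemma Ck_cong:
  assumes "open U" "\<And>q. q \<in> U \<Longrightarrow> f q = g q"
  shows "Ck n U f \<longleftrightarrow> Ck n U g"
proof (cases n)
  case 0
  then show ?thesis using assms by (simp cong: continuous_on_cong)
next
  case (Suc m)
  have "continuous_on U f \<longleftrightarrow> continuous_on U g"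
    using assms by (simp cong: continuous_on_cong)
  moreover have "has_partial c f D p \<longleftrightarrow> has_partial c g D p" if "p \<in> U" for c D p
    by (rule has_partial_cong[OF assms(1) that assms(2)])
  ultimately show ?thesis using Suc by (simp cong: conj_cong)
qed

lemma Ck_imp_continuous: "Ck n U f \<Longrightarrow> continuous_on U f"
  by (cases n) auto

lemma Ck_Suc_imp_Ck: "Ck (Suc n) U f \<Longrightarrow> Ck n U f"
proof (induction n arbitrary: f)
  case (Suc n)
  have "\<exists>g. Ck n U g \<and> (\<forall>p\<in>U. has_partial c f (g p) p)" for c
  proof -
    obtain g where "Ck (Suc n) U g" "\<forall>p\<in>U. has_partial c f (g p) p"
      using Suc.prems by (subst (asm) Ck.simps(2)) blast
    then show ?thesis using Suc.IH by blast
  qed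
  then show ?case using Ck_imp_continuous[OF Suc.prems] by simp
qed auto

lemma Ck_subset: "Ck n U f \<Longrightarrow> V \<subseteq> U \<Longrightarrow> Ck n V f"
proof (induction n arbitrary: f)
  case (Suc n)
  have "continuous_on V f"
    using Suc.prems continuous_on_subset by auto
  moreover have "\<exists>g. Ck n V g \<and> (\<forall>p\<in>V. has_partial c f (g p) p)" for c
  proof -
    obtain g where "Ck n U g" "\<forall>p\<in>U. has_partial c f (g p) p"
      using Suc.prems(1) by auto
    then show ?thesis using Suc.IH Suc.prems(2) by blast
  qed
  ultimately show ?case by simp
qed (auto intro: continuous_on_subset)

lemma finitary_onE:
  assumes "finitary_on U f"
  obtains A where "finite A"
    "\<And>p q. p \<in> U \<Longrightarrow> q \<in> U \<Longrightarrow> (\<And>c. c \<in> A \<Longrightarrow> p c = q c) \<Longrightarrow> f p = f q"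
proof -
  obtain A where A: "finite A \<and> (\<forall>p\<in>U. \<forall>q\<in>U. (\<forall>c\<in>A. p c = q c) \<longrightarrow> f p = f q)"
    using assms unfolding finitary_on_def by (rule exE)
  show thesis
  proof (rule that[OF conjunct1[OF A]])
    fix p q assume "p \<in> U" "q \<in> U" and pq: "\<And>c. c \<in> A \<Longrightarrow> p c = q c"
    then show "f p = f q"
      using conjunct2[OF A, rule_format, of p q] by simp
  qed
qed

lemma finitary_onI:
  assumes "finite A"
    "\<And>p q. p \<in> U \<Longrightarrow> q \<in> U \<Longrightarrow> (\<And>c. c \<in> A \<Longrightarrow> p c = q c) \<Longrightarrow> f p = f q"
  shows "finitary_on U f"
  unfolding finitary_on_def using assms(1) by (intro exI[of _ A] conjI ballI impI assms(2)) (assumption | erule bspec)+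

lemma finitary_on_cong_imp:
  assumes "finitary_on U f" "\<And>q. q \<in> U \<Longrightarrow> f q = g q"
  shows "finitary_on U g"
proof -
  obtain A where A: "finite A"
    "\<And>p q. p \<in> U \<Longrightarrow> q \<in> U \<Longrightarrow> (\<And>c. c \<in> A \<Longrightarrow> p c = q c) \<Longrightarrow> f p = f q"
    using finitary_onE[OF assms(1)] by blast
  show ?thesis
  proof (rule finitary_onI[OF A(1)])
    fix p q assume pq: "p \<in> U" "q \<in> U" "\<And>c. c \<in> A \<Longrightarrow> p c = q c"
    show "g p = g q"
      unfolding assms(2)[OF pq(1), symmetric] assms(2)[OF pq(2), symmetric] by (rule A(2)[OF pq])
  qed
qed

lemma finitary_on_cong:
  assumes "\<And>q. q \<in> U \<Longrightarrow> f q = g q"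
  shows "finitary_on U f \<longleftrightarrow> finitary_on U g"
  using finitary_on_cong_imp[of U f g] finitary_on_cong_imp[of U g f] assms by auto

lemma finitary_on_subset: "finitary_on U f \<Longrightarrow> V \<subseteq> U \<Longrightarrow> finitary_on V f"
  by (erule finitary_onE, rule finitary_onI, assumption) (simp add: subset_iff)

text \<open>
  Whether two points agree on \<open>A\<close> is not affected by moving one coordinate of both to the same value, and moving a
  coordinate outside \<open>A\<close> does not change the value of \<open>f\<close>; so partial derivatives inherit the
  dependency on \<open>A\<close> and vanish in the other directions.
\<close>
lemma partial_transfer:
  assumes "open U" "p \<in> U" "q \<in> U" "\<And>c. c \<in> A \<Longrightarrow> p c = q c"
    and "\<And>p q. p \<in> U \<Longrightarrow> q \<in> U \<Longrightarrow> (\<And>c. c \<in> A \<Longrightarrow> p c = q c) \<Longrightarrow> f p = f q"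
  shows "partial c f p = partial c f q" and "c \<notin> A \<Longrightarrow> has_partial c f 0 p"
proof -
  have *: "has_partial c f 0 p" if "c \<notin> A" "p \<in> U" for p
  proof -
    have "eventually (\<lambda>s. f (p(c := s)) = f p) (nhds (p c))"
      by (rule eventually_mono[OF eventually_fun_upd_in_open[OF assms(1) that(2)]])
         (rule assms(5), use that in auto)
    then show ?thesis
      unfolding has_partial_def by (subst DERIV_cong_ev[OF refl _ refl, where g = "\<lambda>_. f p"]) auto
  qed
  show "c \<notin> A \<Longrightarrow> has_partial c f 0 p" by (rule *[OF _ assms(2)])
  show "partial c f p = partial c f q"
  proof (cases "c \<in> A")
    case True
    then have pq: "p c = q c" using assms by auto
    have "eventually (\<lambda>s. p(c := s) \<in> U \<and> q(c := s) \<in> U) (nhds (p c))"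
      using eventually_fun_upd_in_open[OF assms(1,2), of c] eventually_fun_upd_in_open[OF assms(1,3), of c]
      unfolding pq by (rule eventually_conj)
    then have "eventually (\<lambda>s. f (p(c := s)) = f (q(c := s))) (nhds (p c))"
    proof (rule eventually_mono)
      fix s assume s: "p(c := s) \<in> U \<and> q(c := s) \<in> U"
      show "f (p(c := s)) = f (q(c := s))"
        by (rule assms(5)) (use s assms(4) in auto)
    qed
    then show ?thesis
      unfolding partial_def using pq by (intro deriv_cong_ev) auto
  next
    case False
    then have "has_partial c f 0 p" "has_partial c f 0 q" using * assms(2,3) by blast+
    then show ?thesis by (simp add: has_partial_imp_partial)
  qed
qed

lemma finitary_on_partial:
  assumes "open U" "finitary_on U f"
  shows "finitary_on U (partial c f)"
proof -
  obtain A where A: "finite A"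
    "\<And>p q. p \<in> U \<Longrightarrow> q \<in> U \<Longrightarrow> (\<And>c. c \<in> A \<Longrightarrow> p c = q c) \<Longrightarrow> f p = f q"
    using finitary_onE[OF assms(2)] by blast
  show ?thesis
    by (rule finitary_onI[OF A(1)]) (rule partial_transfer(1)[OF assms(1) _ _ _ A(2)])
qed

text \<open>
  On an open set every \<open>g\<close> allowed in the recursion of \<open>Ck\<close> agrees with \<open>partial c f\<close>, so that \<open>C\<^sup>n\<close> for
  all \<open>n\<close> together with finite dependency is smoothness.
\<close>
lemma smooth_fun_on_iff_Ck:
  assumes "open U"
  shows "smooth_fun_on U f \<longleftrightarrow> finitary_on U f \<and> (\<forall>n. Ck n U f)"
proof
  assume s: "smooth_fun_on U f"
  have "Ck n U f" if "\<And>cs. continuous_on U (fold partial cs f)"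
    "\<And>cs c p. p \<in> U \<Longrightarrow> (\<lambda>s. fold partial cs f (p(c := s))) field_differentiable at (p c)" for n f
    using that
  proof (induction n arbitrary: f)
    case 0
    show ?case using "0"(1)[of "[]"] by simp
  next
    case (Suc n)
    have "continuous_on U f" using Suc.prems(1)[of "[]"] by simp
    moreover have "Ck n U (partial c f)" for c
      using Suc.prems(1)[of "c # cs" for cs] Suc.prems(2)[of _ "c # cs" for cs]
      by (intro Suc.IH) auto
    moreover have "has_partial c f (partial c f p) p" if "p \<in> U" for c p
      using field_differentiable_derivI[OF Suc.prems(2)[OF that, of "[]" c, unfolded fold_simps(1)]]
      unfolding has_partial_def partial_def .
    ultimately show ?case by auto
  qed
  note * = this
  have "Ck n U f" for n
    by (rule *) (use s in \<open>auto simp: smooth_fun_on_def\<close>)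
  moreover have "finitary_on U f"
    using s unfolding smooth_fun_on_def finitary_on_def by (rule conjunct1)
  ultimately show "finitary_on U f \<and> (\<forall>n. Ck n U f)" by blast
next
  assume f: "finitary_on U f \<and> (\<forall>n. Ck n U f)"
  have partial: "Ck n U (partial c f)" "\<And>p. p \<in> U \<Longrightarrow> has_partial c f (partial c f p) p"
    if "\<forall>n. Ck n U f" for f c n
  proof -
    have "Ck (Suc n) U f" using that by blast
    then obtain g where g: "Ck n U g" "\<forall>p\<in>U. has_partial c f (g p) p" by auto
    have pg: "partial c f p = g p" if "p \<in> U" for p
      using that g(2) by (intro has_partial_imp_partial) auto
    show "Ck n U (partial c f)"
      using g(1) Ck_cong[OF assms, of "partial c f" g] pg by blast
    show "has_partial c f (partial c f p) p" if "p \<in> U" for p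
      using g(2) pg that by simp
  qed
  have "\<forall>n. Ck n U (fold partial cs f)" if "\<forall>n. Ck n U f" for cs f
    using that
  proof (induction cs arbitrary: f)
    case (Cons c cs)
    have "\<forall>n. Ck n U (partial c f)" using partial(1)[OF Cons.prems] by blast
    from Cons.IH[OF this] show ?case by simp
  qed simp
  from this[OF conjunct2[OF f]] have *: "\<forall>n. Ck n U (fold partial cs f)" for cs .
  have "continuous_on U (fold partial cs f)" for cs
    using spec[where x = 0, OF *] by simp
  moreover have "(\<lambda>s. fold partial cs f (p(c := s))) field_differentiable at (p c)" if "p \<in> U" for cs c p
    using partial(2)[OF * that] unfolding has_partial_def field_differentiable_def by (rule exI)
  ultimately show "smooth_fun_on U f"
    using f unfolding smooth_fun_on_def finitary_on_def by simp
qed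

lemma smooth_fun_on_cong:
  assumes "open U" "\<And>q. q \<in> U \<Longrightarrow> f q = g q"
  shows "smooth_fun_on U f \<longleftrightarrow> smooth_fun_on U g"
  unfolding smooth_fun_on_iff_Ck[OF assms(1)]
  by (intro arg_cong2[where f = conj] arg_cong[where f = All] ext Ck_cong finitary_on_cong assms)

lemma smooth_fun_on_subset:
  assumes "smooth_fun_on U f" "open U" "open V" "V \<subseteq> U"
  shows "smooth_fun_on V f"
  using assms(1,4) Ck_subset finitary_on_subset
  unfolding smooth_fun_on_iff_Ck[OF assms(2)] smooth_fun_on_iff_Ck[OF assms(3)] by blast

lemma smooth_map_on_subset:
  assumes "smooth_map_on U f" "open U" "open V" "V \<subseteq> U"
  shows "smooth_map_on V f"
  using assms(1) smooth_fun_on_subset[OF _ assms(2-4)] unfolding smooth_map_on_def by blast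

lemma smooth_fun_on_has_partial:
  assumes "smooth_fun_on U f" "p \<in> U"
  shows "has_partial c f (partial c f p) p"
proof -
  have "\<forall>cs c. \<forall>p\<in>U. (\<lambda>s. fold partial cs f (p(c := s))) field_differentiable at (p c)"
    using assms(1) unfolding smooth_fun_on_def by simp
  from this[rule_format, of p "[]" c] assms(2)
  have "(\<lambda>s. f (p(c := s))) field_differentiable at (p c)" by (simp only: fold_simps)
  then show ?thesis
    unfolding has_partial_def partial_def by (rule field_differentiable_derivI)
qed

lemma smooth_fun_on_partial:
  assumes "smooth_fun_on U f" "open U"
  shows "smooth_fun_on U (partial c f)"
proof -
  have "continuous_on U (fold partial (c # cs) f) \<and>
    (\<forall>d. \<forall>p\<in>U. (\<lambda>s. fold partial (c # cs) f (p(d := s))) field_differentiable at (p d))" for cs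
    using assms(1) unfolding smooth_fun_on_def by (drule_tac conjunct2) (rule spec)
  moreover have "finitary_on U (partial c f)"
    using assms(1) unfolding smooth_fun_on_iff_Ck[OF assms(2)]
    by (intro finitary_on_partial[OF assms(2)]) (rule conjunct1)
  ultimately show ?thesis
    unfolding smooth_fun_on_def finitary_on_def by simp
qed

lemma smooth_fun_on_continuous: "smooth_fun_on U f \<Longrightarrow> continuous_on U f"
  unfolding smooth_fun_on_def by (drule conjunct2, drule spec[of _ "[]"]) simp

lemma smooth_map_on_continuous: "smooth_map_on U f \<Longrightarrow> continuous_on U f"
  unfolding smooth_map_on_def
  by (intro continuous_on_coordinatewise_then_product smooth_fun_on_continuous) auto

lemma smooth_fun_on_finitary: "smooth_fun_on U f \<Longrightarrow> finitary_on U f"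
  unfolding smooth_fun_on_def finitary_on_def by (rule conjunct1)

section \<open>The chain rule\<close>

text \<open>
  Continuous partial derivatives give strict differentiability in any finite set of coordinates:
  the coordinates are changed one at a time and the mean value theorem is applied to each change.
\<close>
lemma strict_derivative:
  fixes f :: "('c \<Rightarrow> real) \<Rightarrow> real"
  assumes "open W" "q \<in> W" "finite A" "e > 0"
    and deriv: "\<And>p c. p \<in> W \<Longrightarrow> c \<in> A \<Longrightarrow> has_partial c f (g c p) p"
    and cont: "\<And>c. c \<in> A \<Longrightarrow> continuous_on W (g c)"
  obtains B d where "finite B" "d > 0" "\<And>p. (\<And>b. b \<in> B \<Longrightarrow> \<bar>p b - q b\<bar> < d) \<Longrightarrow> p \<in> W"
    "\<And>p p'. (\<And>b. b \<in> B \<Longrightarrow> \<bar>p b - q b\<bar> < d) \<Longrightarrow> (\<And>b. b \<in> B \<Longrightarrow> \<bar>p' b - q b\<bar> < d) \<Longrightarrow>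
       (\<And>c. c \<notin> A \<Longrightarrow> p' c = p c) \<Longrightarrow>
       \<bar>f p' - f p - (\<Sum>c\<in>A. g c q * (p' c - p c))\<bar> \<le> e * (\<Sum>c\<in>A. \<bar>p' c - p c\<bar>)"
proof -
  define W' where "W' = W \<inter> (\<Inter>c\<in>A. {p\<in>W. \<bar>g c p - g c q\<bar> < e})"
  have "open {p\<in>W. \<bar>g c p - g c q\<bar> < e}" if "c \<in> A" for c
  proof -
    have "continuous_on W (\<lambda>p. \<bar>g c p - g c q\<bar>)"
      by (intro continuous_intros cont that)
    from continuous_on_open_vimage[OF assms(1)] this
    have "open ((\<lambda>p. \<bar>g c p - g c q\<bar>) -` {..<e} \<inter> W)" by (metis open_lessThan)
    moreover have "(\<lambda>p. \<bar>g c p - g c q\<bar>) -` {..<e} \<inter> W = {p\<in>W. \<bar>g c p - g c q\<bar> < e}" by auto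
    ultimately show ?thesis by simp
  qed
  then have "open W'" "q \<in> W'"
    unfolding W'_def using assms by (auto intro!: open_Int open_INT)
  then obtain B d where B: "finite B" "d > 0"
    "\<And>p. (\<And>b. b \<in> B \<Longrightarrow> \<bar>p b - q b\<bar> < d) \<Longrightarrow> p \<in> W'"
    using open_contains_box by blast
  have main: "\<bar>f p' - f p - (\<Sum>c\<in>A'. g c q * (p' c - p c))\<bar> \<le> e * (\<Sum>c\<in>A'. \<bar>p' c - p c\<bar>)"
    if "finite A'" "A' \<subseteq> A" "\<And>b. b \<in> B \<Longrightarrow> \<bar>p b - q b\<bar> < d" "\<And>b. b \<in> B \<Longrightarrow> \<bar>p' b - q b\<bar> < d"
      "\<And>c. c \<notin> A' \<Longrightarrow> p' c = p c" for A' p p'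
    using that
  proof (induction A' arbitrary: p' rule: finite_induct)
    case empty
    then have "p' = p" by auto
    then show ?case by simp
  next
    case (insert a A')
    define p'' where "p'' = p'(a := p a)"
    have in_box: "p'(a := s) \<in> W'" if "s \<in> closed_segment (p a) (p' a)" for s
    proof (rule B(3))
      fix b assume b: "b \<in> B"
      have "\<bar>p a - q a\<bar> < d" "\<bar>p' a - q a\<bar> < d" if "b = a" using b insert.prems that by auto
      then show "\<bar>(p'(a := s)) b - q b\<bar> < d"
        using b insert.prems(3)[OF b] that by (auto simp: closed_segment_eq_real_ivl split: if_splits)
    qed
    have IH: "\<bar>f p'' - f p - (\<Sum>c\<in>A'. g c q * (p'' c - p c))\<bar> \<le> e * (\<Sum>c\<in>A'. \<bar>p'' c - p c\<bar>)"
      by (rule insert.IH) (use insert.prems in \<open>auto simp: p''_def\<close>)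
    have p''_A': "p'' c = p' c" if "c \<in> A'" for c
      using that insert.hyps by (auto simp: p''_def)
    have "\<exists>s\<in>closed_segment (p a) (p' a). f p' - f p'' = (p' a - p a) * g a (p'(a := s))"
    proof -
      define h where "h = (\<lambda>s. f (p'(a := s)))"
      have "(h has_field_derivative g a (p'(a := s))) (at s)"
        if "s \<in> closed_segment (p a) (p' a)" for s
        using deriv[of "p'(a := s)" a] in_box[OF that] insert.prems(1)
        by (auto simp: W'_def h_def has_partial_def)
      note h = this
      have "\<exists>s\<in>closed_segment (p a) (p' a). h (p' a) - h (p a) = (p' a - p a) * g a (p'(a := s))"
      proof (cases "p a" "p' a" rule: linorder_cases)
        case less
        with MVT2[OF less, of h "\<lambda>s. g a (p'(a := s))"] h
        obtain z where "z > p a" "z < p' a" "h (p' a) - h (p a) = (p' a - p a) * g a (p'(a := z))"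
          by (auto simp: closed_segment_eq_real_ivl)
        then show ?thesis using less by (intro bexI[of _ z]) (auto simp: closed_segment_eq_real_ivl)
      next
        case greater
        with MVT2[OF greater, of h "\<lambda>s. g a (p'(a := s))"] h
        obtain z where z: "z > p' a" "z < p a" "h (p a) - h (p' a) = (p a - p' a) * g a (p'(a := z))"
          by (auto simp: closed_segment_eq_real_ivl)
        then have "h (p' a) - h (p a) = (p' a - p a) * g a (p'(a := z))" by (simp add: algebra_simps)
        then show ?thesis using z greater by (intro bexI[of _ z]) (auto simp: closed_segment_eq_real_ivl)
      qed auto
      then show ?thesis by (simp add: h_def p''_def)
    qed
    then obtain s where s: "s \<in> closed_segment (p a) (p' a)"
      "f p' - f p'' = (p' a - p a) * g a (p'(a := s))" by blast
    have "\<bar>g a (p'(a := s)) - g a q\<bar> \<le> e"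
      using in_box[OF s(1)] insert.prems(1) by (auto simp: W'_def)
    then have "\<bar>p' a - p a\<bar> * \<bar>g a (p'(a := s)) - g a q\<bar> \<le> e * \<bar>p' a - p a\<bar>"
      by (metis abs_ge_zero mult.commute mult_left_mono)
    then have "\<bar>f p' - f p'' - g a q * (p' a - p a)\<bar> \<le> e * \<bar>p' a - p a\<bar>"
      by (simp add: s(2) abs_mult[symmetric] algebra_simps)
    moreover have "\<bar>f p'' - f p - (\<Sum>c\<in>A'. g c q * (p' c - p c))\<bar> \<le> e * (\<Sum>c\<in>A'. \<bar>p' c - p c\<bar>)"
      using IH p''_A' by (simp cong: sum.cong)
    ultimately show ?case
      using insert.hyps by (simp add: algebra_simps)
  qed
  show thesis
  proof (rule that[OF B(1,2)])
    show "\<And>p. (\<And>b. b \<in> B \<Longrightarrow> \<bar>p b - q b\<bar> < d) \<Longrightarrow> p \<in> W"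
      using B(3) unfolding W'_def by auto
  qed (use main[OF assms(3)] in blast)
qed

text \<open>Strict differentiability in the coordinates of \<open>A\<close> suffices for the chain rule, since the other
  coordinates of the curve do not influence \<open>f\<close>.\<close>
lemma chain_rule_along_curve:
  fixes f :: "('d \<Rightarrow> real) \<Rightarrow> real" and \<gamma> :: "real \<Rightarrow> 'd \<Rightarrow> real"
  assumes "open W" "\<gamma> s0 \<in> W" "finite A"
    and dep: "\<And>p q. p \<in> W \<Longrightarrow> q \<in> W \<Longrightarrow> (\<And>c. c \<in> A \<Longrightarrow> p c = q c) \<Longrightarrow> f p = f q"
    and deriv: "\<And>p c. p \<in> W \<Longrightarrow> c \<in> A \<Longrightarrow> has_partial c f (g c p) p"
    and cont: "\<And>c. c \<in> A \<Longrightarrow> continuous_on W (g c)"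
    and in_W: "eventually (\<lambda>s. \<gamma> s \<in> W) (at s0)"
    and curve: "\<And>c. c \<in> A \<Longrightarrow> ((\<lambda>s. \<gamma> s c) has_field_derivative \<gamma>' c) (at s0)"
  shows "((\<lambda>s. f (\<gamma> s)) has_field_derivative (\<Sum>c\<in>A. g c (\<gamma> s0) * \<gamma>' c)) (at s0)"
proof -
  define q where "q = \<gamma> s0"
  define quot where "quot = (\<lambda>c s. (\<gamma> s c - q c) / (s - s0))"
  have quot: "(quot c \<longlongrightarrow> \<gamma>' c) (at s0)" if "c \<in> A" for c
    using curve[OF that] unfolding has_field_derivative_iff quot_def q_def .
  define C where "C = (\<Sum>c\<in>A. \<bar>\<gamma>' c\<bar>)"
  have C: "C \<ge> 0" by (auto simp: C_def sum_nonneg)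
  have sum_quot: "((\<lambda>s. \<Sum>c\<in>A. \<bar>quot c s\<bar>) \<longlongrightarrow> C) (at s0)"
    unfolding C_def by (intro tendsto_intros quot)
  have rem: "((\<lambda>s. (f (\<gamma> s) - f q) / (s - s0) - (\<Sum>c\<in>A. g c q * quot c s)) \<longlongrightarrow> 0) (at s0)"
  proof (rule tendstoI)
    fix e :: real assume e: "e > 0"
    define e' where "e' = e / (2 * (C + 1))"
    have e': "e' > 0" "e' * (C + 1) < e" using e C by (auto simp: e'_def field_simps intro: add_pos_nonneg)
    obtain B d where B: "finite B" "d > 0"
      "\<And>p. (\<And>b. b \<in> B \<Longrightarrow> \<bar>p b - q b\<bar> < d) \<Longrightarrow> p \<in> W"
      "\<And>p p'. (\<And>b. b \<in> B \<Longrightarrow> \<bar>p b - q b\<bar> < d) \<Longrightarrow> (\<And>b. b \<in> B \<Longrightarrow> \<bar>p' b - q b\<bar> < d) \<Longrightarrow>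
       (\<And>c. c \<notin> A \<Longrightarrow> p' c = p c) \<Longrightarrow>
       \<bar>f p' - f p - (\<Sum>c\<in>A. g c q * (p' c - p c))\<bar> \<le> e' * (\<Sum>c\<in>A. \<bar>p' c - p c\<bar>)"
      by (rule strict_derivative[OF assms(1) _ assms(3) e'(1) deriv cont, of q])
         (use assms(2) in \<open>auto simp: q_def\<close>)
    have "eventually (\<lambda>s. \<bar>\<gamma> s b - q b\<bar> < d) (at s0)" if "b \<in> A" for b
      using DERIV_isCont[OF curve[OF that]] B(2) unfolding isCont_def q_def tendsto_iff dist_real_def
      by auto
    then have "eventually (\<lambda>s. \<forall>b\<in>A. \<bar>\<gamma> s b - q b\<bar> < d) (at s0)"
      using assms(3) by (simp add: eventually_ball_finite)
    moreover have "eventually (\<lambda>s. (\<Sum>c\<in>A. \<bar>quot c s\<bar>) < C + 1) (at s0)"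
      using sum_quot by (rule order_tendstoD) simp
    moreover have "eventually (\<lambda>s. s \<noteq> s0) (at s0)"
      by (simp add: eventually_at_filter)
    ultimately show "eventually
        (\<lambda>s. dist ((f (\<gamma> s) - f q) / (s - s0) - (\<Sum>c\<in>A. g c q * quot c s)) 0 < e) (at s0)"
      using in_W
    proof eventually_elim
      case (elim s)
      \<comment> \<open>Only the coordinates in \<open>A\<close> are moved; the others might leave every box around \<open>q\<close>.\<close>
      define p where "p = (\<lambda>c. if c \<in> A then \<gamma> s c else q c)"
      have p_box: "\<And>b. b \<in> B \<Longrightarrow> \<bar>p b - q b\<bar> < d" using elim(1) B(2) by (auto simp: p_def)
      have "p \<in> W" using B(3) p_box by blast
      then have fp: "f (\<gamma> s) = f p" by (intro dep) (use elim(4) in \<open>auto simp: p_def\<close>)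
      have "\<bar>f p - f q - (\<Sum>c\<in>A. g c q * (p c - q c))\<bar> \<le> e' * (\<Sum>c\<in>A. \<bar>p c - q c\<bar>)"
        by (rule B(4)) (use p_box B(2) in \<open>auto simp: p_def\<close>)
      then have "\<bar>f p - f q - (\<Sum>c\<in>A. g c q * (\<gamma> s c - q c))\<bar> \<le> e' * (\<Sum>c\<in>A. \<bar>\<gamma> s c - q c\<bar>)"
        by (simp add: p_def cong: sum.cong)
      then have "\<bar>f p - f q - (\<Sum>c\<in>A. g c q * (\<gamma> s c - q c))\<bar> / \<bar>s - s0\<bar>
          \<le> e' * (\<Sum>c\<in>A. \<bar>\<gamma> s c - q c\<bar>) / \<bar>s - s0\<bar>"
        by (simp add: divide_right_mono)
      also have "e' * (\<Sum>c\<in>A. \<bar>\<gamma> s c - q c\<bar>) / \<bar>s - s0\<bar> = e' * (\<Sum>c\<in>A. \<bar>quot c s\<bar>)"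
        by (simp add: quot_def sum_divide_distrib flip: times_divide_eq_right)
      also have "\<bar>f p - f q - (\<Sum>c\<in>A. g c q * (\<gamma> s c - q c))\<bar> / \<bar>s - s0\<bar>
          = \<bar>(f p - f q) / (s - s0) - (\<Sum>c\<in>A. g c q * quot c s)\<bar>"
        by (simp add: quot_def sum_divide_distrib diff_divide_distrib right_diff_distrib flip: abs_divide)
      also have "e' * (\<Sum>c\<in>A. \<bar>quot c s\<bar>) \<le> e' * (C + 1)"
        using elim(2) e' by (intro mult_left_mono) auto
      finally show ?case using fp e' by (simp add: dist_real_def)
    qed
  qed
  have "((\<lambda>s. ((f (\<gamma> s) - f q) / (s - s0) - (\<Sum>c\<in>A. g c q * quot c s)) + (\<Sum>c\<in>A. g c q * quot c s))
      \<longlongrightarrow> 0 + (\<Sum>c\<in>A. g c q * \<gamma>' c)) (at s0)"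
    by (intro tendsto_intros rem quot)
  then show ?thesis
    unfolding has_field_derivative_iff by (simp add: q_def)
qed

section \<open>Sums, products and compositions\<close>

lemma has_partial_const: "has_partial c (\<lambda>p. k) 0 p"
  by (simp add: has_partial_def)

lemma has_partial_coord: "has_partial c (\<lambda>p. p d) (if d = c then 1 else 0) p"
  by (cases "d = c") (auto simp: has_partial_def)

lemma has_partial_add:
  "has_partial c f a p \<Longrightarrow> has_partial c g b p \<Longrightarrow> has_partial c (\<lambda>p. f p + g p) (a + b) p"
  unfolding has_partial_def by (rule DERIV_add)

lemma has_partial_mult:
  "has_partial c f a p \<Longrightarrow> has_partial c g b p \<Longrightarrow> has_partial c (\<lambda>p. f p * g p) (a * g p + b * f p) p"
  unfolding has_partial_def by (drule (1) DERIV_mult) (simp add: fun_upd_triv)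

lemma Ck_const: "Ck n U (\<lambda>p. k)"
proof (induction n arbitrary: k)
  case (Suc n)
  show ?case using Suc has_partial_const by (auto intro!: exI[of _ "\<lambda>p. 0"])
qed auto

lemma continuous_coord: "continuous_on U (\<lambda>p. p c)"
  by (rule continuous_on_subset[OF continuous_on_product_coordinates]) simp

lemma Ck_coord: "Ck n U (\<lambda>p. p c)"
proof (induction n)
  case (Suc n)
  have "\<exists>g. Ck n U g \<and> (\<forall>p\<in>U. has_partial d (\<lambda>p. p c) (g p) p)" for d
    by (intro exI[of _ "\<lambda>p. if c = d then 1 else 0"] conjI Ck_const ballI has_partial_coord)
  then show ?case by (simp add: continuous_coord)
qed (simp add: continuous_coord)

lemma Ck_add: "Ck n U f \<Longrightarrow> Ck n U g \<Longrightarrow> Ck n U (\<lambda>p. f p + g p)"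
proof (induction n arbitrary: f g)
  case (Suc n)
  have "\<exists>h. Ck n U h \<and> (\<forall>p\<in>U. has_partial d (\<lambda>p. f p + g p) (h p) p)" for d
  proof -
    obtain f' g' where "Ck n U f'" "\<forall>p\<in>U. has_partial d f (f' p) p"
      "Ck n U g'" "\<forall>p\<in>U. has_partial d g (g' p) p"
      using Suc.prems by auto blast
    then show ?thesis
      by (intro exI[of _ "\<lambda>p. f' p + g' p"] conjI Suc.IH ballI has_partial_add) auto
  qed
  then show ?case using Suc.prems by (auto intro!: continuous_intros)
qed (auto intro!: continuous_intros)

lemma Ck_mult: "Ck n U f \<Longrightarrow> Ck n U g \<Longrightarrow> Ck n U (\<lambda>p. f p * g p)"
proof (induction n arbitrary: f g)
  case (Suc n)
  have "\<exists>h. Ck n U h \<and> (\<forall>p\<in>U. has_partial d (\<lambda>p. f p * g p) (h p) p)" for d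
  proof -
    obtain f' g' where "Ck n U f'" "\<forall>p\<in>U. has_partial d f (f' p) p"
      "Ck n U g'" "\<forall>p\<in>U. has_partial d g (g' p) p"
      using Suc.prems by auto blast
    then show ?thesis
      by (intro exI[of _ "\<lambda>p. f' p * g p + g' p * f p"] conjI Suc.IH Ck_add ballI has_partial_mult
          Ck_Suc_imp_Ck[OF Suc.prems(1)] Ck_Suc_imp_Ck[OF Suc.prems(2)]) auto
  qed
  then show ?case using Suc.prems by (auto intro!: continuous_intros)
qed (auto intro!: continuous_intros)

lemma Ck_sum: "(\<And>i. i \<in> I \<Longrightarrow> Ck n U (f i)) \<Longrightarrow> Ck n U (\<lambda>p. \<Sum>i\<in>I. f i p)"
  by (induction I rule: infinite_finite_induct) (auto intro: Ck_const Ck_add)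

lemma has_partial_compose:
  assumes "open U" "open W" "p \<in> U" "continuous_on U \<phi>" "\<phi> ` U \<subseteq> W" "finite A"
    and dep: "\<And>p q. p \<in> W \<Longrightarrow> q \<in> W \<Longrightarrow> (\<And>c. c \<in> A \<Longrightarrow> p c = q c) \<Longrightarrow> f p = f q"
    and deriv: "\<And>p d. p \<in> W \<Longrightarrow> d \<in> A \<Longrightarrow> has_partial d f (g d p) p"
    and cont: "\<And>d. d \<in> A \<Longrightarrow> continuous_on W (g d)"
    and inner: "\<And>d. d \<in> A \<Longrightarrow> has_partial c (\<lambda>p. \<phi> p d) (h d) p"
  shows "has_partial c (\<lambda>p. f (\<phi> p)) (\<Sum>d\<in>A. g d (\<phi> p) * h d) p"
proof -
  have "eventually (\<lambda>s. p(c := s) \<in> U) (at (p c))"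
    unfolding eventually_at_filter by (rule eventually_mono[OF eventually_fun_upd_in_open[OF assms(1,3)]]) simp
  then have "eventually (\<lambda>s. \<phi> (p(c := s)) \<in> W) (at (p c))"
    by (rule eventually_mono) (use assms(5) in auto)
  note ev = this
  have "((\<lambda>s. f (\<phi> (p(c := s)))) has_field_derivative (\<Sum>d\<in>A. g d (\<phi> (p(c := p c))) * h d)) (at (p c))"
  proof (rule chain_rule_along_curve[OF assms(2) _ assms(6) _ _ cont ev])
    show "\<phi> (p(c := p c)) \<in> W" using assms(3,5) by auto
    show "((\<lambda>s. \<phi> (p(c := s)) d) has_field_derivative h d) (at (p c))" if "d \<in> A" for d
      using inner[OF that] unfolding has_partial_def .
  qed (rule dep deriv; assumption)+
  then show ?thesis unfolding has_partial_def fun_upd_triv .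
qed

lemma Ck_imp_smooth_partials:
  assumes "open W" "finitary_on W f" "Ck (Suc n) W f"
  shows "finitary_on W (partial d f)" "Ck n W (partial d f)"
    "\<And>p. p \<in> W \<Longrightarrow> has_partial d f (partial d f p) p"
proof -
  obtain g where g: "Ck n W g" "\<forall>p\<in>W. has_partial d f (g p) p"
    using assms(3) by auto
  have pg: "partial d f p = g p" if "p \<in> W" for p
    using that g(2) by (intro has_partial_imp_partial) auto
  show "Ck n W (partial d f)"
    using g(1) Ck_cong[OF assms(1), of "partial d f" g] pg by blast
  show "has_partial d f (partial d f p) p" if "p \<in> W" for p
    using g(2) pg that by simp
  show "finitary_on W (partial d f)" by (rule finitary_on_partial[OF assms(1,2)])
qed

lemma Ck_continuous_map: "(\<And>d. Ck n U (\<lambda>p. \<phi> p d)) \<Longrightarrow> continuous_on U \<phi>"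
  by (intro continuous_on_coordinatewise_then_product Ck_imp_continuous)

text \<open>
  By the chain rule the partial derivatives of \<open>f \<circ> \<phi>\<close> are finite sums of products of \<open>(\<partial>\<^sub>d f) \<circ> \<phi>\<close> and
  \<open>\<partial>\<^sub>c \<phi>\<^sub>d\<close>, which are covered by the statement for the preceding order.
\<close>
lemma Ck_compose:
  assumes "open U" "open W" "\<phi> ` U \<subseteq> W"
  shows "finitary_on W f \<Longrightarrow> Ck n W f \<Longrightarrow> (\<And>d. Ck n U (\<lambda>p. \<phi> p d)) \<Longrightarrow> Ck n U (\<lambda>p. f (\<phi> p))"
proof (induction n arbitrary: f)
  case 0
  then show ?case
    using continuous_on_compose2[OF _ Ck_continuous_map[OF 0(3)] assms(3), of f] by simp
next
  case (Suc n)
  obtain A where A: "finite A"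
    "\<And>p q. p \<in> W \<Longrightarrow> q \<in> W \<Longrightarrow> (\<And>c. c \<in> A \<Longrightarrow> p c = q c) \<Longrightarrow> f p = f q"
    using finitary_onE[OF Suc.prems(1)] by blast
  note f = Ck_imp_smooth_partials[OF assms(2) Suc.prems(1,2)]
  have cont: "continuous_on U \<phi>" by (rule Ck_continuous_map[OF Suc.prems(3)])
  have "\<exists>h. Ck n U h \<and> (\<forall>p\<in>U. has_partial c (\<lambda>p. f (\<phi> p)) (h p) p)" for c
  proof -
    have "\<exists>h. Ck n U h \<and> (\<forall>p\<in>U. has_partial c (\<lambda>p. \<phi> p d) (h p) p)" for d
      using Suc.prems(3)[of d] by simp
    then have "\<forall>d. \<exists>h. Ck n U h \<and> (\<forall>p\<in>U. has_partial c (\<lambda>p. \<phi> p d) (h p) p)" by (rule allI)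
    from choice[OF this] obtain h where
      *: "\<forall>d. Ck n U (h d) \<and> (\<forall>p\<in>U. has_partial c (\<lambda>p. \<phi> p d) (h d p) p)" by (rule exE)
    have h: "Ck n U (h d)" "p \<in> U \<Longrightarrow> has_partial c (\<lambda>p. \<phi> p d) (h d p) p" for d p
      using spec[OF *, of d] by simp_all
    have "Ck n U (\<lambda>p. \<Sum>d\<in>A. partial d f (\<phi> p) * h d p)"
      by (rule Ck_sum, rule Ck_mult[OF Suc.IH[OF f(1,2) Ck_Suc_imp_Ck[OF Suc.prems(3)]] h(1)])
    moreover have "has_partial c (\<lambda>p. f (\<phi> p)) (\<Sum>d\<in>A. partial d f (\<phi> p) * h d p) p" if "p \<in> U" for p
      by (rule has_partial_compose[OF assms(1,2) that cont assms(3) A(1)])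
         (rule A(2) f(3) h(2)[OF that] Ck_imp_continuous[OF f(2)]; assumption)+
    ultimately show ?thesis by (intro exI conjI ballI)
  qed
  moreover have "continuous_on U (\<lambda>p. f (\<phi> p))"
    using continuous_on_compose2[OF Ck_imp_continuous[OF Suc.prems(2)] cont assms(3)] .
  ultimately show ?case by simp
qed

lemma finitary_on_compose:
  assumes "finitary_on W f" "\<phi> ` U \<subseteq> W" "\<And>d. finitary_on U (\<lambda>p. \<phi> p d)"
  shows "finitary_on U (\<lambda>p. f (\<phi> p))"
proof -
  obtain A where A: "finite A"
    "\<And>p q. p \<in> W \<Longrightarrow> q \<in> W \<Longrightarrow> (\<And>c. c \<in> A \<Longrightarrow> p c = q c) \<Longrightarrow> f p = f q"
    using finitary_onE[OF assms(1)] by blast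
  have "\<exists>B. finite B \<and> (\<forall>p\<in>U. \<forall>q\<in>U. (\<forall>c\<in>B. p c = q c) \<longrightarrow> \<phi> p d = \<phi> q d)" for d
    using assms(3)[of d] unfolding finitary_on_def .
  then have "\<forall>d. \<exists>B. finite B \<and> (\<forall>p\<in>U. \<forall>q\<in>U. (\<forall>c\<in>B. p c = q c) \<longrightarrow> \<phi> p d = \<phi> q d)" by (rule allI)
  from choice[OF this] obtain B where
    B: "\<forall>d. finite (B d) \<and> (\<forall>p\<in>U. \<forall>q\<in>U. (\<forall>c\<in>B d. p c = q c) \<longrightarrow> \<phi> p d = \<phi> q d)" by (rule exE)
  show ?thesis
  proof (rule finitary_onI[of "\<Union>d\<in>A. B d"])
    show "finite (\<Union>d\<in>A. B d)" using A(1) B by simp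
  next
    fix p q assume pq: "p \<in> U" "q \<in> U" "\<And>c. c \<in> (\<Union>d\<in>A. B d) \<Longrightarrow> p c = q c"
    show "f (\<phi> p) = f (\<phi> q)"
    proof (rule A(2))
      show "\<phi> p \<in> W" "\<phi> q \<in> W" using pq assms(2) by auto
      fix d assume "d \<in> A"
      then show "\<phi> p d = \<phi> q d"
        by (intro conjunct2[OF spec[OF B, of d], rule_format] pq) auto
    qed
  qed
qed

lemma finitary_on_const: "finitary_on U (\<lambda>p. k)"
  by (rule finitary_onI[of "{}"]) (rule finite.emptyI, rule refl)

lemma finitary_on_coord: "finitary_on U (\<lambda>p. p c)"
proof (rule finitary_onI[of "{c}"])
  fix p q :: "'a \<Rightarrow> real" assume pq: "\<And>d. d \<in> {c} \<Longrightarrow> p d = q d"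
  show "p c = q c" by (rule pq) simp
qed simp

lemma finitary_on_binary:
  assumes "finitary_on U f" "finitary_on U g"
  shows "finitary_on U (\<lambda>p. h (f p) (g p))"
proof -
  obtain A where A: "finite A"
    "\<And>p q. p \<in> U \<Longrightarrow> q \<in> U \<Longrightarrow> (\<And>c. c \<in> A \<Longrightarrow> p c = q c) \<Longrightarrow> f p = f q"
    using finitary_onE[OF assms(1)] by blast
  obtain B where B: "finite B"
    "\<And>p q. p \<in> U \<Longrightarrow> q \<in> U \<Longrightarrow> (\<And>c. c \<in> B \<Longrightarrow> p c = q c) \<Longrightarrow> g p = g q"
    using finitary_onE[OF assms(2)] by blast
  show ?thesis
  proof (rule finitary_onI[of "A \<union> B"])
    fix p q assume pq: "p \<in> U" "q \<in> U" "\<And>c. c \<in> A \<union> B \<Longrightarrow> p c = q c"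
    show "h (f p) (g p) = h (f q) (g q)"
    proof (rule arg_cong2[where f = h])
      show "f p = f q" by (rule A(2)[OF pq(1,2)], rule pq(3), rule UnI1)
      show "g p = g q" by (rule B(2)[OF pq(1,2)], rule pq(3), rule UnI2)
    qed
  qed (intro finite_UnI A(1) B(1))
qed

lemma finitary_on_unary: "finitary_on U f \<Longrightarrow> finitary_on U (\<lambda>p. h (f p))"
  by (rule finitary_on_binary[of U f f "\<lambda>x _. h x"])

lemma smooth_funI:
  assumes "open U" "finitary_on U f" "\<And>n. Ck n U f"
  shows "smooth_fun_on U f"
  unfolding smooth_fun_on_iff_Ck[OF assms(1)] by (intro conjI allI assms)

lemma smooth_fun_on_Ck:
  assumes "open U" "smooth_fun_on U f"
  shows "Ck n U f"
  using assms(2) unfolding smooth_fun_on_iff_Ck[OF assms(1)] by simp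

lemma smooth_const: "open U \<Longrightarrow> smooth_fun_on U (\<lambda>p. k)"
  by (rule smooth_funI[OF _ finitary_on_const Ck_const])

lemma smooth_coord: "open U \<Longrightarrow> smooth_fun_on U (\<lambda>p. p c)"
  by (rule smooth_funI[OF _ finitary_on_coord Ck_coord])

lemma smooth_add:
  "open U \<Longrightarrow> smooth_fun_on U f \<Longrightarrow> smooth_fun_on U g \<Longrightarrow> smooth_fun_on U (\<lambda>p. f p + g p)"
  by (rule smooth_funI) (assumption | rule finitary_on_binary[where h = "(+)"] Ck_add
      smooth_fun_on_finitary smooth_fun_on_Ck)+

lemma smooth_mult:
  "open U \<Longrightarrow> smooth_fun_on U f \<Longrightarrow> smooth_fun_on U g \<Longrightarrow> smooth_fun_on U (\<lambda>p. f p * g p)"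
  by (rule smooth_funI) (assumption | rule finitary_on_binary[where h = "(*)"] Ck_mult
      smooth_fun_on_finitary smooth_fun_on_Ck)+

lemma smooth_minus: "open U \<Longrightarrow> smooth_fun_on U f \<Longrightarrow> smooth_fun_on U (\<lambda>p. - f p)"
  using smooth_mult[of U "\<lambda>p. -1" f] smooth_const[of U "-1"] by simp

lemma smooth_diff:
  "open U \<Longrightarrow> smooth_fun_on U f \<Longrightarrow> smooth_fun_on U g \<Longrightarrow> smooth_fun_on U (\<lambda>p. f p - g p)"
  using smooth_add[of U f "\<lambda>p. - g p"] smooth_minus[of U g] by simp

lemma smooth_sum:
  "open U \<Longrightarrow> (\<And>i. i \<in> I \<Longrightarrow> smooth_fun_on U (f i)) \<Longrightarrow> smooth_fun_on U (\<lambda>p. \<Sum>i\<in>I. f i p)"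
  by (induction I rule: infinite_finite_induct) (simp_all add: smooth_const smooth_add)

lemma smooth_power: "open U \<Longrightarrow> smooth_fun_on U f \<Longrightarrow> smooth_fun_on U (\<lambda>p. f p ^ k)"
  by (induction k) (simp_all add: smooth_const smooth_mult)

lemma smooth_compose:
  assumes "open U" "open W" "\<phi> ` U \<subseteq> W" "smooth_fun_on W f" "smooth_map_on U \<phi>"
  shows "smooth_fun_on U (\<lambda>p. f (\<phi> p))"
proof -
  have \<phi>: "smooth_fun_on U (\<lambda>p. \<phi> p d)" for d using assms(5) by (simp add: smooth_map_on_def)
  show ?thesis
  proof (rule smooth_funI[OF assms(1)])
    show "finitary_on U (\<lambda>p. f (\<phi> p))"
      by (rule finitary_on_compose[OF smooth_fun_on_finitary[OF assms(4)] assms(3)])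
        (rule smooth_fun_on_finitary[OF \<phi>])
    show "Ck n U (\<lambda>p. f (\<phi> p))" for n
      by (rule Ck_compose[OF assms(1-3) smooth_fun_on_finitary[OF assms(4)] smooth_fun_on_Ck[OF assms(2,4)]])
        (rule smooth_fun_on_Ck[OF assms(1) \<phi>])
  qed
qed

lemma Ck_inverse:
  assumes "\<And>p. p \<in> U \<Longrightarrow> f p \<noteq> 0"
  shows "Ck n U f \<Longrightarrow> Ck n U (\<lambda>p. inverse (f p))"
proof (induction n)
  case (Suc n)
  have "\<exists>g. Ck n U g \<and> (\<forall>p\<in>U. has_partial c (\<lambda>p. inverse (f p)) (g p) p)" for c
  proof -
    obtain f' where f': "Ck n U f'" "\<forall>p\<in>U. has_partial c f (f' p) p" using Suc.prems by auto
    have inv: "Ck n U (\<lambda>p. inverse (f p))" by (rule Suc.IH[OF Ck_Suc_imp_Ck[OF Suc.prems]])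
    have "has_partial c (\<lambda>p. inverse (f p)) ((- 1) * (inverse (f p) * f' p * inverse (f p))) p" if "p \<in> U" for p
      using DERIV_inverse'[of "\<lambda>s. f (p(c := s))" "f' p" "p c" UNIV] f'(2) assms that
      unfolding has_partial_def by (simp add: fun_upd_triv)
    then show ?thesis
      by (intro exI[of _ "\<lambda>p. (- 1) * (inverse (f p) * f' p * inverse (f p))"] conjI ballI
          Ck_mult Ck_const inv f'(1))
  qed
  then show ?case using Suc.prems assms by (auto intro!: continuous_on_inverse)
qed (auto intro!: continuous_on_inverse assms)

lemma continuous_sin_cos:
  fixes f :: "'a::topological_space \<Rightarrow> real"
  assumes "continuous_on U f"
  shows "continuous_on U (\<lambda>p. sin (f p))" "continuous_on U (\<lambda>p. cos (f p))"
proof -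
  have "continuous_on UNIV (sin :: real \<Rightarrow> real)" "continuous_on UNIV (cos :: real \<Rightarrow> real)"
    by (intro continuous_intros)+
  then show "continuous_on U (\<lambda>p. sin (f p))" "continuous_on U (\<lambda>p. cos (f p))"
    using continuous_on_compose2[OF _ assms] by auto
qed

lemma Ck_sin_cos: "Ck n U f \<Longrightarrow> Ck n U (\<lambda>p. sin (f p)) \<and> Ck n U (\<lambda>p. cos (f p))"
proof (induction n)
  case (Suc n)
  have "\<exists>g. Ck n U g \<and> (\<forall>p\<in>U. has_partial c (\<lambda>p. sin (f p)) (g p) p)"
       "\<exists>g. Ck n U g \<and> (\<forall>p\<in>U. has_partial c (\<lambda>p. cos (f p)) (g p) p)" for c
  proof -
    obtain f' where f': "Ck n U f'" "\<forall>p\<in>U. has_partial c f (f' p) p" using Suc.prems by auto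
    note IH = Suc.IH[OF Ck_Suc_imp_Ck[OF Suc.prems]]
    have "has_partial c (\<lambda>p. sin (f p)) (cos (f p) * f' p) p"
         "has_partial c (\<lambda>p. cos (f p)) ((- 1) * (sin (f p) * f' p)) p" if "p \<in> U" for p
      using DERIV_fun_sin[of "\<lambda>s. f (p(c := s))" "f' p" "p c"]
        DERIV_fun_cos[of "\<lambda>s. f (p(c := s))" "f' p" "p c"] f'(2) that
      unfolding has_partial_def by (simp_all add: fun_upd_triv)
    note d = this
    show "\<exists>g. Ck n U g \<and> (\<forall>p\<in>U. has_partial c (\<lambda>p. sin (f p)) (g p) p)"
      by (rule exI[of _ "\<lambda>p. cos (f p) * f' p"])
        (intro conjI ballI Ck_mult f'(1) conjunct2[OF IH] d(1))
    show "\<exists>g. Ck n U g \<and> (\<forall>p\<in>U. has_partial c (\<lambda>p. cos (f p)) (g p) p)"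
      by (rule exI[of _ "\<lambda>p. (- 1) * (sin (f p) * f' p)"])
        (intro conjI ballI Ck_mult Ck_const f'(1) conjunct1[OF IH] d(2))
  qed
  then show ?case using continuous_sin_cos[OF Ck_imp_continuous[OF Suc.prems]] by simp
next
  case 0
  then show ?case using continuous_sin_cos[of U f] by simp
qed

lemma smooth_inverse:
  "open U \<Longrightarrow> smooth_fun_on U f \<Longrightarrow> (\<And>p. p \<in> U \<Longrightarrow> f p \<noteq> 0) \<Longrightarrow> smooth_fun_on U (\<lambda>p. inverse (f p))"
  by (rule smooth_funI) (assumption | rule finitary_on_unary[where h = inverse] Ck_inverse
      smooth_fun_on_finitary smooth_fun_on_Ck)+

lemma smooth_divide:
  "open U \<Longrightarrow> smooth_fun_on U f \<Longrightarrow> smooth_fun_on U g \<Longrightarrow> (\<And>p. p \<in> U \<Longrightarrow> g p \<noteq> 0) \<Longrightarrow>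
   smooth_fun_on U (\<lambda>p. f p / g p)"
  using smooth_mult[of U f "\<lambda>p. inverse (g p)"] smooth_inverse[of U g] by (simp add: divide_inverse)

lemma smooth_sin: "open U \<Longrightarrow> smooth_fun_on U f \<Longrightarrow> smooth_fun_on U (\<lambda>p. sin (f p))"
  by (rule smooth_funI) (assumption | rule finitary_on_unary[where h = sin] conjunct1[OF Ck_sin_cos]
      smooth_fun_on_finitary smooth_fun_on_Ck)+

lemma smooth_cos: "open U \<Longrightarrow> smooth_fun_on U f \<Longrightarrow> smooth_fun_on U (\<lambda>p. cos (f p))"
  by (rule smooth_funI) (assumption | rule finitary_on_unary[where h = cos] conjunct2[OF Ck_sin_cos]
      smooth_fun_on_finitary smooth_fun_on_Ck)+

section \<open>The derivation of a diffiety\<close>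

text \<open>The index set in the definition of \<open>derivation\<close> varies with the point; a set \<open>A\<close> on which \<open>f\<close>
  depends serves all points at once.\<close>
lemma derivation_eq_sum:
  assumes "open U" "p \<in> U" "finite A"
    and dep: "\<And>p q. p \<in> U \<Longrightarrow> q \<in> U \<Longrightarrow> (\<And>c. c \<in> A \<Longrightarrow> p c = q c) \<Longrightarrow> f p = f q"
  shows "derivation v f p = (\<Sum>c\<in>A. v p c * partial c f p)"
proof -
  have "partial c f p = 0" if "c \<notin> A" for c
    by (rule has_partial_imp_partial[OF partial_transfer(2)[OF assms(1,2,2) refl dep that]])
  then show ?thesis
    unfolding derivation_def using assms(3) by (intro sum.mono_neutral_left) auto
qed

lemma derivation_cong:
  assumes "open U" "p \<in> U" "\<And>q. q \<in> U \<Longrightarrow> f q = g q"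
  shows "derivation v f p = derivation v g p"
  unfolding derivation_def using partial_cong[OF assms] by simp

lemma derivation_coord: "derivation v (\<lambda>p. p c) p = v p c"
proof -
  have "partial d (\<lambda>p. p c) p = (if c = d then 1 else 0)" for d
    by (rule has_partial_imp_partial[OF has_partial_coord])
  then show ?thesis unfolding derivation_def by simp
qed

lemma smooth_derivation:
  assumes "open U" "smooth_map_on U v" "smooth_fun_on U f"
  shows "smooth_fun_on U (derivation v f)"
proof -
  obtain A where A: "finite A"
    "\<And>p q. p \<in> U \<Longrightarrow> q \<in> U \<Longrightarrow> (\<And>c. c \<in> A \<Longrightarrow> p c = q c) \<Longrightarrow> f p = f q"
    using finitary_onE[OF smooth_fun_on_finitary[OF assms(3)]] by blast
  have "smooth_fun_on U (\<lambda>p. \<Sum>c\<in>A. v p c * partial c f p)"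
    using assms(2) unfolding smooth_map_on_def
    by (intro smooth_sum smooth_mult smooth_fun_on_partial assms(1,3)) blast
  moreover have "derivation v f p = (\<Sum>c\<in>A. v p c * partial c f p)" if "p \<in> U" for p
    by (rule derivation_eq_sum[OF assms(1) that A(1)]) (rule A(2))
  ultimately show ?thesis
    by (subst smooth_fun_on_cong[OF assms(1)])
qed

text \<open>
  By the chain rule, both sides of \<open>D (g \<circ> \<phi>) = (D g) \<circ> \<phi>\<close> are linear combinations of the partial
  derivatives of \<open>g\<close>; the coefficients agree if this holds for the coordinate functions \<open>g\<close>.
\<close>
lemma derivation_compose:
  assumes "open U" "open W" "\<phi> ` U \<subseteq> W" "smooth_map_on U \<phi>" "smooth_fun_on W g" "p \<in> U"
    and compat: "\<And>d. derivation v (\<lambda>q. \<phi> q d) p = w (\<phi> p) d"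
  shows "derivation v (\<lambda>q. g (\<phi> q)) p = derivation w g (\<phi> p)"
proof -
  obtain A where A: "finite A"
    "\<And>p q. p \<in> W \<Longrightarrow> q \<in> W \<Longrightarrow> (\<And>c. c \<in> A \<Longrightarrow> p c = q c) \<Longrightarrow> g p = g q"
    using finitary_onE[OF smooth_fun_on_finitary[OF assms(5)]] by blast
  have \<phi>d: "smooth_fun_on U (\<lambda>p. \<phi> p d)" for d using assms(4) by (simp add: smooth_map_on_def)
  have "\<exists>B. finite B \<and> (\<forall>v. derivation v (\<lambda>q. \<phi> q d) p = (\<Sum>c\<in>B. v p c * partial c (\<lambda>q. \<phi> q d) p))
      \<and> (\<forall>c. c \<notin> B \<longrightarrow> partial c (\<lambda>q. \<phi> q d) p = 0)" for d
  proof -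
    obtain B where B: "finite B"
      "\<And>p q. p \<in> U \<Longrightarrow> q \<in> U \<Longrightarrow> (\<And>c. c \<in> B \<Longrightarrow> p c = q c) \<Longrightarrow> \<phi> p d = \<phi> q d"
      using finitary_onE[OF smooth_fun_on_finitary[OF \<phi>d[of d]]] by blast
    have "partial c (\<lambda>q. \<phi> q d) p = 0" if "c \<notin> B" for c
      by (rule has_partial_imp_partial[OF partial_transfer(2)[OF assms(1,6,6) refl B(2) that]])
    moreover have "derivation v (\<lambda>q. \<phi> q d) p = (\<Sum>c\<in>B. v p c * partial c (\<lambda>q. \<phi> q d) p)" for v
      by (rule derivation_eq_sum[OF assms(1,6) B(1)]) (rule B(2))
    ultimately show ?thesis
      by (intro exI[of _ B] conjI allI impI B(1))
  qed
  then have "\<forall>d. \<exists>B. finite B \<and> (\<forall>v. derivation v (\<lambda>q. \<phi> q d) p = (\<Sum>c\<in>B. v p c * partial c (\<lambda>q. \<phi> q d) p))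
      \<and> (\<forall>c. c \<notin> B \<longrightarrow> partial c (\<lambda>q. \<phi> q d) p = 0)" by (rule allI)
  from choice[OF this] obtain B where *: "\<forall>d. finite (B d) \<and>
      (\<forall>v. derivation v (\<lambda>q. \<phi> q d) p = (\<Sum>c\<in>B d. v p c * partial c (\<lambda>q. \<phi> q d) p))
      \<and> (\<forall>c. c \<notin> B d \<longrightarrow> partial c (\<lambda>q. \<phi> q d) p = 0)" by (rule exE)
  have B: "finite (B d)"
    "derivation v (\<lambda>q. \<phi> q d) p = (\<Sum>c\<in>B d. v p c * partial c (\<lambda>q. \<phi> q d) p)"
    "c \<notin> B d \<Longrightarrow> partial c (\<lambda>q. \<phi> q d) p = 0" for c d v
    using spec[OF *, of d] by auto
  have chain: "has_partial c (\<lambda>q. g (\<phi> q)) (\<Sum>d\<in>A. partial d g (\<phi> p) * partial c (\<lambda>q. \<phi> q d) p) p" for c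
    by (rule has_partial_compose[OF assms(1,2,6) smooth_map_on_continuous[OF assms(4)] assms(3) A(1)])
       (rule A(2) smooth_fun_on_has_partial[OF assms(5)] smooth_fun_on_has_partial[OF \<phi>d assms(6)]
         smooth_fun_on_continuous[OF smooth_fun_on_partial[OF assms(5,2)]]; assumption)+
  define C where "C = (\<Union>d\<in>A. B d)"
  have "finite C" using A(1) B(1) by (simp add: C_def)
  have "partial c (\<lambda>q. g (\<phi> q)) p = 0" if "c \<notin> C" for c
    unfolding has_partial_imp_partial[OF chain]
    by (rule sum.neutral) (use that B(3) in \<open>auto simp: C_def\<close>)
  then have "derivation v (\<lambda>q. g (\<phi> q)) p = (\<Sum>c\<in>C. v p c * partial c (\<lambda>q. g (\<phi> q)) p)"
    unfolding derivation_def using \<open>finite C\<close> by (intro sum.mono_neutral_left) auto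
  also have "\<dots> = (\<Sum>c\<in>C. \<Sum>d\<in>A. partial d g (\<phi> p) * (v p c * partial c (\<lambda>q. \<phi> q d) p))"
    unfolding has_partial_imp_partial[OF chain] sum_distrib_left by (simp add: ac_simps)
  also have "\<dots> = (\<Sum>d\<in>A. partial d g (\<phi> p) * (\<Sum>c\<in>C. v p c * partial c (\<lambda>q. \<phi> q d) p))"
    by (subst sum.swap) (simp add: sum_distrib_left)
  also have "\<dots> = (\<Sum>d\<in>A. w (\<phi> p) d * partial d g (\<phi> p))"
  proof (rule sum.cong[OF refl])
    fix d assume d: "d \<in> A"
    have "(\<Sum>c\<in>C. v p c * partial c (\<lambda>q. \<phi> q d) p) = (\<Sum>c\<in>B d. v p c * partial c (\<lambda>q. \<phi> q d) p)"
      using d \<open>finite C\<close> B(3) by (intro sum.mono_neutral_right) (auto simp: C_def)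
    then show "partial d g (\<phi> p) * (\<Sum>c\<in>C. v p c * partial c (\<lambda>q. \<phi> q d) p) = w (\<phi> p) d * partial d g (\<phi> p)"
      using B(2)[of v d] compat[of d] by simp
  qed
  also have "\<dots> = derivation w g (\<phi> p)"
  proof (rule derivation_eq_sum[OF assms(2) _ A(1), symmetric])
    show "\<phi> p \<in> W" using assms(3,6) by auto
  qed (rule A(2))
  finally show ?thesis .
qed

lemma cylinder_open_preimage:
  assumes "cylinder_open U" "cylinder_open W" "smooth_map_on U \<phi>"
  shows "cylinder_open {p \<in> U. \<phi> p \<in> W}"
proof -
  obtain A where A: "finite A" "\<And>p q. (\<And>c. c \<in> A \<Longrightarrow> p c = q c) \<Longrightarrow> p \<in> U \<longleftrightarrow> q \<in> U"
    using cylinder_openE[OF assms(1)] by blast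
  obtain B where B: "finite B" "\<And>p q. (\<And>c. c \<in> B \<Longrightarrow> p c = q c) \<Longrightarrow> p \<in> W \<longleftrightarrow> q \<in> W"
    using cylinder_openE[OF assms(2)] by blast
  have "\<exists>C. finite C \<and> (\<forall>p\<in>U. \<forall>q\<in>U. (\<forall>c\<in>C. p c = q c) \<longrightarrow> \<phi> p d = \<phi> q d)" for d
    using spec[OF assms(3)[unfolded smooth_map_on_def], of d] 
    unfolding finitary_on_def[symmetric] by (rule smooth_fun_on_finitary)
  then have "\<forall>d. \<exists>C. finite C \<and> (\<forall>p\<in>U. \<forall>q\<in>U. (\<forall>c\<in>C. p c = q c) \<longrightarrow> \<phi> p d = \<phi> q d)" by (rule allI)
  from choice[OF this] obtain C where
    C: "\<forall>d. finite (C d) \<and> (\<forall>p\<in>U. \<forall>q\<in>U. (\<forall>c\<in>C d. p c = q c) \<longrightarrow> \<phi> p d = \<phi> q d)" by (rule exE)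
  show ?thesis
  proof (rule cylinder_openI[of _ "A \<union> (\<Union>d\<in>B. C d)"])
    have "{p \<in> U. \<phi> p \<in> W} = \<phi> -` W \<inter> U" by auto
    then show "open {p \<in> U. \<phi> p \<in> W}"
      using continuous_on_open_vimage[OF cylinder_openD[OF assms(1)]] smooth_map_on_continuous[OF assms(3)]
        cylinder_openD[OF assms(2)] by metis
    show "finite (A \<union> (\<Union>d\<in>B. C d))" using A(1) B(1) C by simp
  next
    fix p q assume p: "p \<in> {p \<in> U. \<phi> p \<in> W}" and pq: "\<And>c. c \<in> A \<union> (\<Union>d\<in>B. C d) \<Longrightarrow> p c = q c"
    have q: "q \<in> U" using p A(2)[of p q] pq by auto
    have "\<phi> p \<in> W \<longleftrightarrow> \<phi> q \<in> W"
    proof (rule B(2))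
      fix d assume "d \<in> B"
      then show "\<phi> p d = \<phi> q d"
        using p by (intro conjunct2[OF spec[OF C, of d], rule_format] q pq) auto
    qed
    then show "q \<in> {p \<in> U. \<phi> p \<in> W}" using p q by simp
  qed
qed

section \<open>Real analytic functions are smooth\<close>

abbreviation multi_index :: "'a::euclidean_space itself \<Rightarrow> ('a \<Rightarrow> nat) set" where
  "multi_index _ \<equiv> (Basis :: 'a set) \<rightarrow>\<^sub>E (UNIV :: nat set)"

definition monomial :: "'a::euclidean_space \<Rightarrow> ('a \<Rightarrow> nat) \<Rightarrow> real" where
  "monomial y k = (\<Prod>b\<in>Basis. (y \<bullet> b) ^ k b)"

text \<open>The derivative of \<open>monomial y k\<close> with respect to \<open>y \<bullet> b\<close>.\<close>
definition monomial_deriv :: "'a::euclidean_space \<Rightarrow> 'a \<Rightarrow> ('a \<Rightarrow> nat) \<Rightarrow> real" where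
  "monomial_deriv b y k =
     real (k b) * (y \<bullet> b) ^ (k b - 1) * (\<Prod>b'\<in>Basis - {b}. (y \<bullet> b') ^ k b')"

lemma monomial_split:
  "b \<in> Basis \<Longrightarrow> monomial y k = (y \<bullet> b) ^ k b * (\<Prod>b'\<in>Basis - {b}. (y \<bullet> b') ^ k b')"
  unfolding monomial_def by (rule prod.remove) auto

lemma monomial_has_derivative:
  assumes "b \<in> Basis"
  shows "((\<lambda>s. monomial (y + s *\<^sub>R b) k) has_field_derivative monomial_deriv b (y + s *\<^sub>R b) k) (at s)"
proof -
  have other: "(\<Prod>b'\<in>Basis - {b}. ((y + s *\<^sub>R b) \<bullet> b') ^ k b') = (\<Prod>b'\<in>Basis - {b}. (y \<bullet> b') ^ k b')" for s
    by (rule prod.cong) (use assms in \<open>auto simp: inner_left_distrib inner_not_same_Basis\<close>)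
  have b: "(y + s *\<^sub>R b) \<bullet> b = y \<bullet> b + s" for s
    using assms by (simp add: inner_left_distrib)
  have "monomial (y + s *\<^sub>R b) k = (y \<bullet> b + s) ^ k b * (\<Prod>b'\<in>Basis - {b}. (y \<bullet> b') ^ k b')" for s
    unfolding monomial_split[OF assms] other b ..
  moreover have "((\<lambda>s. (y \<bullet> b + s) ^ k b * (\<Prod>b'\<in>Basis - {b}. (y \<bullet> b') ^ k b')) has_field_derivative
      (real (k b) * (y \<bullet> b + s) ^ (k b - 1)) * (\<Prod>b'\<in>Basis - {b}. (y \<bullet> b') ^ k b')) (at s)"
    by (auto intro!: derivative_eq_intros)
  moreover have "monomial_deriv b (y + s *\<^sub>R b) k =
      (real (k b) * (y \<bullet> b + s) ^ (k b - 1)) * (\<Prod>b'\<in>Basis - {b}. (y \<bullet> b') ^ k b')"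
    unfolding monomial_deriv_def other b ..
  ultimately show ?thesis by simp
qed

lemma countable_multi_index_bij:
  obtains h :: "nat \<Rightarrow> 'a::euclidean_space \<Rightarrow> nat" where "bij_betw h UNIV (multi_index TYPE('a))"
proof -
  obtain b :: 'a where b: "b \<in> Basis" using nonempty_Basis by blast
  have "inj (\<lambda>n. \<lambda>b'\<in>(Basis :: 'a set). n :: nat)"
  proof (rule injI)
    fix m n :: nat assume "(\<lambda>b'\<in>(Basis :: 'a set). m) = (\<lambda>b'\<in>Basis. n)"
    from fun_cong[OF this, of b] b show "m = n" by simp
  qed
  then have "infinite (range (\<lambda>n. \<lambda>b'\<in>(Basis :: 'a set). n :: nat))"
    using finite_imageD by blast
  moreover have "range (\<lambda>n. \<lambda>b'\<in>(Basis :: 'a set). n :: nat) \<subseteq> multi_index TYPE('a)" by auto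
  ultimately have "infinite (multi_index TYPE('a))" using finite_subset by blast
  moreover have "countable (multi_index TYPE('a))" by (intro countable_PiE) auto
  ultimately show thesis using that bij_betw_from_nat_into by blast
qed

lemma power_abs_le:
  assumes "\<bar>t\<bar> \<le> \<rho> / 2" "\<rho> > 0"
  shows "real n * \<bar>t\<bar> ^ (n - 1) \<le> \<rho> ^ n / \<rho>"
proof (cases n)
  case (Suc m)
  have "real (Suc m) \<le> 2 ^ m"
    by (induction m) auto
  then have "real n * \<bar>t\<bar> ^ (n - 1) \<le> 2 ^ m * (\<rho> / 2) ^ m"
    unfolding Suc using power_mono[of "\<bar>t\<bar>" "\<rho> / 2" m] assms(1)
    by (intro mult_mono) simp_all
  also have "\<dots> = \<rho> ^ n / \<rho>"
    using assms(2) Suc by (simp flip: power_mult_distrib)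
  finally show ?thesis .
qed (use assms in auto)

lemma monomial_bounds:
  fixes y :: "'a::euclidean_space"
  assumes "norm y \<le> \<rho> / 2" "\<rho> > 0" "b \<in> Basis"
  shows "\<bar>monomial y k\<bar> \<le> (\<Prod>b\<in>Basis. \<rho> ^ k b)"
    and "\<bar>monomial_deriv b y k\<bar> \<le> (\<Prod>b\<in>Basis. \<rho> ^ k b) / \<rho>"
proof -
  have y: "\<bar>y \<bullet> b'\<bar> \<le> \<rho> / 2" if "b' \<in> Basis" for b'
    using Basis_le_norm[OF that, of y] assms by linarith
  then have y': "\<bar>y \<bullet> b'\<bar> \<le> \<rho>" if "b' \<in> Basis" for b' using that assms(2) by fastforce
  show "\<bar>monomial y k\<bar> \<le> (\<Prod>b\<in>Basis. \<rho> ^ k b)"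
    unfolding monomial_def abs_prod power_abs using y' by (intro prod_mono) (auto intro: power_mono)
  have "\<bar>monomial_deriv b y k\<bar> =
      (real (k b) * \<bar>y \<bullet> b\<bar> ^ (k b - 1)) * (\<Prod>b'\<in>Basis - {b}. \<bar>y \<bullet> b'\<bar> ^ k b')"
    by (simp add: monomial_deriv_def abs_mult abs_prod power_abs)
  also have "\<dots> \<le> (\<rho> ^ k b / \<rho>) * (\<Prod>b'\<in>Basis - {b}. \<rho> ^ k b')"
    using y y' assms(2,3)
    by (intro mult_mono power_abs_le prod_mono) (auto intro: power_mono prod_nonneg)
  also have "\<dots> = (\<Prod>b\<in>Basis. \<rho> ^ k b) / \<rho>"
    using prod.remove[OF finite_Basis assms(3), of "\<lambda>b. \<rho> ^ k b"] by simp
  finally show "\<bar>monomial_deriv b y k\<bar> \<le> (\<Prod>b\<in>Basis. \<rho> ^ k b) / \<rho>" .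
qed

lemma termwise_derivative_at_0:
  fixes g g' :: "nat \<Rightarrow> real \<Rightarrow> real"
  assumes "e > 0" and deriv: "\<And>n s. (g n has_field_derivative g' n s) (at s)"
    and bound: "\<And>n s. s \<in> ball 0 e \<Longrightarrow> norm (g' n s) \<le> M n" and "summable M"
    and "summable (\<lambda>n. g n 0)"
  shows "((\<lambda>s. \<Sum>n. g n s) has_field_derivative (\<Sum>n. g' n 0)) (at 0)"
proof -
  have "uniform_limit (ball 0 e) (\<lambda>n s. \<Sum>i<n. g' i s) (\<lambda>s. \<Sum>i. g' i s) sequentially"
    using bound \<open>summable M\<close> by (intro Weierstrass_m_test) auto
  note lim = this
  have conv: "uniformly_convergent_on (ball 0 e) (\<lambda>n s. \<Sum>i<n. g' i s)"
    unfolding uniformly_convergent_on_def by (rule exI, rule lim)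
  have int: "0 \<in> interior (ball (0::real) e)" "0 \<in> ball (0::real) e" using \<open>e > 0\<close> by simp_all
  show ?thesis
    using has_field_derivative_series'(2)[OF convex_ball[of 0 e] has_field_derivative_at_within[OF deriv] conv int(2) \<open>summable (\<lambda>n. g n 0)\<close> int(1)]
    .
qed
text \<open>
  A power series converging near \<open>0\<close> converges absolutely at a point all of whose coordinates are
  equal to some \<open>\<rho> > 0\<close>. This dominates, on the ball of radius \<open>\<rho> / 2\<close>, the series and the series of
  the derivatives of its terms; both converge uniformly there.
\<close>
lemma power_series_differentiable:
  fixes f :: "'a::euclidean_space \<Rightarrow> real"
  assumes "r > 0"
    and f: "\<And>x. x \<in> ball a r \<Longrightarrow> ((\<lambda>k. c k * monomial (x - a) k) has_sum f x) (multi_index TYPE('a))"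
  obtains \<rho> where "\<rho> > 0" "continuous_on (ball a \<rho>) f"
    "\<And>x b. b \<in> Basis \<Longrightarrow> x \<in> ball a \<rho> \<Longrightarrow> \<exists>D.
       ((\<lambda>s. f (x + s *\<^sub>R b)) has_field_derivative D) (at 0) \<and>
       ((\<lambda>k. c k * monomial_deriv b (x - a) k) has_sum D) (multi_index TYPE('a))"
proof -
  define R where "R = r / (2 * real DIM('a))"
  have R: "R > 0" using assms(1) by (simp add: R_def)
  \<comment> \<open>\<open>R\<close> is so small that the point with all coordinates equal to \<open>R\<close> has norm below \<open>r\<close>.\<close>
  define w where "w = (\<Sum>b\<in>Basis. R *\<^sub>R (b :: 'a))"
  have w: "w \<bullet> b = R" if "b \<in> Basis" for b using that by (simp add: w_def)
  have "norm w \<le> (\<Sum>b\<in>(Basis :: 'a set). norm (R *\<^sub>R b))" unfolding w_def by (rule norm_sum)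
  also have "\<dots> = real DIM('a) * R" using R by simp
  also have DR: "\<dots> < r" using assms(1) by (simp add: R_def)
  finally have "a + w \<in> ball a r" by (simp add: dist_norm)
  from f[OF this] have "(\<lambda>k. c k * (\<Prod>b\<in>Basis. R ^ k b)) summable_on multi_index TYPE('a)"
    by (auto simp: monomial_def w dest: has_sum_imp_summable)
  then have abs: "(\<lambda>k. \<bar>c k\<bar> * (\<Prod>b\<in>Basis. R ^ k b)) summable_on multi_index TYPE('a)"
    using R by (subst (asm) summable_on_iff_abs_summable_on_real) (simp add: abs_mult abs_prod power_abs)
  obtain h :: "nat \<Rightarrow> 'a \<Rightarrow> nat" where h: "bij_betw h UNIV (multi_index TYPE('a))"
    by (rule countable_multi_index_bij)
  define M where "M = (\<lambda>n. \<bar>c (h n)\<bar> * (\<Prod>b\<in>Basis. R ^ h n b))"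
  have "M summable_on UNIV"
    using abs summable_on_reindex_bij_betw[OF h, of "\<lambda>k. \<bar>c k\<bar> * (\<Prod>b\<in>Basis. R ^ k b)"] by (simp add: M_def)
  then have M: "summable M" by (rule summable_on_imp_summable)
  have R_le: "R / 2 < r"
  proof -
    have "1 * R \<le> real DIM('a) * R" using R by (intro mult_right_mono) (simp_all add: Suc_leI)
    then show ?thesis using DR R by linarith
  qed
  have f_eq: "f x = (\<Sum>n. c (h n) * monomial (x - a) (h n))"
    and f_summable: "summable (\<lambda>n. c (h n) * monomial (x - a) (h n))" if "x \<in> ball a (R / 2)" for x
  proof -
    have "((\<lambda>n. c (h n) * monomial (x - a) (h n)) has_sum f x) UNIV"
      using f[of x] that R_le has_sum_reindex_bij_betw[OF h, of "\<lambda>k. c k * monomial (x - a) k"] by simp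
    then have "(\<lambda>n. c (h n) * monomial (x - a) (h n)) sums f x" by (rule has_sum_imp_sums)
    then show "f x = (\<Sum>n. c (h n) * monomial (x - a) (h n))"
      "summable (\<lambda>n. c (h n) * monomial (x - a) (h n))" by (auto simp: sums_iff)
  qed
  have bound: "\<bar>c (h n) * monomial (x - a) (h n)\<bar> \<le> M n"
    "b \<in> Basis \<Longrightarrow> \<bar>c (h n) * monomial_deriv b (x - a) (h n)\<bar> \<le> M n / R"
    if "x \<in> ball a (R / 2)" for x b n
  proof -
    have x: "norm (x - a) \<le> R / 2" using that by (simp add: dist_norm norm_minus_commute)
    obtain b0 :: 'a where "b0 \<in> Basis" using nonempty_Basis by blast
    then show "\<bar>c (h n) * monomial (x - a) (h n)\<bar> \<le> M n"
      using monomial_bounds(1)[OF x R] by (simp add: abs_mult M_def mult_left_mono)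
    show "\<bar>c (h n) * monomial_deriv b (x - a) (h n)\<bar> \<le> M n / R" if "b \<in> Basis"
      using mult_left_mono[OF monomial_bounds(2)[OF x R that, of "h n"], of "\<bar>c (h n)\<bar>"]
      by (simp add: abs_mult M_def)
  qed
  show thesis
  proof (rule that[of "R / 2"])
    show "R / 2 > 0" using R by simp
    have "uniform_limit (ball a (R / 2)) (\<lambda>n x. \<Sum>i<n. c (h i) * monomial (x - a) (h i))
        (\<lambda>x. \<Sum>i. c (h i) * monomial (x - a) (h i)) sequentially"
      using bound(1) M by (intro Weierstrass_m_test) auto
    then have "continuous_on (ball a (R / 2)) (\<lambda>x. \<Sum>i. c (h i) * monomial (x - a) (h i))"
      by (rule uniform_limit_theorem[rotated])
         (auto simp: monomial_def intro!: always_eventually continuous_intros)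
    then show "continuous_on (ball a (R / 2)) f"
      by (rule continuous_on_eq) (rule f_eq[symmetric])
  next
    fix x b assume b: "b \<in> (Basis :: 'a set)" and x: "x \<in> ball a (R / 2)"
    define e where "e = R / 2 - dist a x"
    have e: "e > 0" using x by (simp add: e_def)
    have in_ball: "x + s *\<^sub>R b \<in> ball a (R / 2)" if "s \<in> ball 0 e" for s
    proof -
      have "dist a (x + s *\<^sub>R b) \<le> dist a x + norm (s *\<^sub>R b)"
        using dist_triangle[of a "x + s *\<^sub>R b" x] by (simp add: dist_norm)
      also have "\<dots> < R / 2" using that b by (simp add: e_def)
      finally show ?thesis by simp
    qed
    define g where "g = (\<lambda>n s. c (h n) * monomial (x - a + s *\<^sub>R b) (h n))"
    define g' where "g' = (\<lambda>n s. c (h n) * monomial_deriv b (x - a + s *\<^sub>R b) (h n))"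
    have shift: "x + s *\<^sub>R b - a = x - a + s *\<^sub>R b" for s by (rule diff_add_eq[symmetric])
    have MR: "summable (\<lambda>n. M n / R)" using M by (rule summable_divide)
    have g'_le: "norm (g' n s) \<le> M n / R" if "s \<in> ball 0 e" for n s
      using bound(2)[OF in_ball[OF that] b] unfolding g'_def real_norm_def shift .
    have "(g n has_field_derivative g' n s) (at s)" for n s
      unfolding g_def g'_def by (rule DERIV_cmult[OF monomial_has_derivative[OF b]])
    moreover have "summable (\<lambda>n. g n 0)" using f_summable[OF x] by (simp add: g_def)
    ultimately have "((\<lambda>s. \<Sum>n. g n s) has_field_derivative (\<Sum>n. g' n 0)) (at 0)"
      by (intro termwise_derivative_at_0[OF e _ g'_le MR])
    moreover have "eventually (\<lambda>s. f (x + s *\<^sub>R b) = (\<Sum>n. g n s)) (nhds 0)"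
    proof (rule eventually_mono)
      show "eventually (\<lambda>s. s \<in> ball 0 e) (nhds (0 :: real))" using e by (intro eventually_nhds_in_open) auto
      show "f (x + s *\<^sub>R b) = (\<Sum>n. g n s)" if "s \<in> ball 0 e" for s
        using f_eq[OF in_ball[OF that]] unfolding g_def shift .
    qed
    ultimately have deriv: "((\<lambda>s. f (x + s *\<^sub>R b)) has_field_derivative (\<Sum>n. g' n 0)) (at 0)"
      by (subst DERIV_cong_ev[OF refl _ refl]) auto
    have summ: "summable (\<lambda>n. norm (g' n 0))"
    proof (rule summable_comparison_test'[OF MR, of 0])
      show "norm (norm (g' n 0)) \<le> M n / R" for n
        using bound(2)[OF x b, of n] by (simp add: g'_def)
    qed
    have "((\<lambda>n. g' n 0) has_sum (\<Sum>n. g' n 0)) UNIV"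
      by (rule norm_summable_imp_has_sum[OF summ summable_sums[OF summable_norm_cancel[OF summ]]])
    then have "((\<lambda>k. c k * monomial_deriv b (x - a) k) has_sum (\<Sum>n. g' n 0)) (multi_index TYPE('a))"
      using has_sum_reindex_bij_betw[OF h, of "\<lambda>k. c k * monomial_deriv b (x - a) k"] by (simp add: g'_def)
    with deriv show "\<exists>D. ((\<lambda>s. f (x + s *\<^sub>R b)) has_field_derivative D) (at 0) \<and>
       ((\<lambda>k. c k * monomial_deriv b (x - a) k) has_sum D) (multi_index TYPE('a))"
      by (intro exI[of _ "\<Sum>n. g' n 0"] conjI)
  qed
qed

text \<open>The differentiated series is again a power series, after raising the \<open>b\<close>-th exponent by one.\<close>
lemma has_sum_monomial_deriv_shift:
  fixes y :: "'a::euclidean_space"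
  assumes "b \<in> Basis"
    and "((\<lambda>k. c k * monomial_deriv b y k) has_sum D) (multi_index TYPE('a))"
  shows "((\<lambda>k. (c (k(b := Suc (k b))) * real (Suc (k b))) * monomial y k) has_sum D) (multi_index TYPE('a))"
proof -
  define up where "up = (\<lambda>k :: 'a \<Rightarrow> nat. k(b := Suc (k b)))"
  have up: "up k \<in> multi_index TYPE('a)" if "k \<in> multi_index TYPE('a)" for k
    using that assms(1) by (auto simp: up_def PiE_iff extensional_def)
  have inj: "inj_on up (multi_index TYPE('a))"
  proof (rule inj_onI)
    fix k k' assume eq: "up k = up k'"
    have "k b' = k' b'" for b'
      using fun_cong[OF eq, of b'] by (cases "b' = b") (simp_all add: up_def)
    then show "k = k'" by (rule ext)
  qed
  have range: "k \<in> up ` multi_index TYPE('a)" if "k \<in> multi_index TYPE('a)" "k b \<noteq> 0" for k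
  proof
    show "k = up (k(b := k b - 1))" using that by (auto simp: up_def)
    show "k(b := k b - 1) \<in> multi_index TYPE('a)"
      using that assms(1) by (auto simp: PiE_iff extensional_def)
  qed
  have "((\<lambda>k. c k * monomial_deriv b y k) has_sum D) (up ` multi_index TYPE('a)) \<longleftrightarrow>
        ((\<lambda>k. c k * monomial_deriv b y k) has_sum D) (multi_index TYPE('a))"
    by (rule has_sum_cong_neutral) (use up range in \<open>auto simp: monomial_deriv_def\<close>)
  with assms(2) have "((\<lambda>k. c k * monomial_deriv b y k) has_sum D) (up ` multi_index TYPE('a))" by simp
  then have "((\<lambda>k. c (up k) * monomial_deriv b y (up k)) has_sum D) (multi_index TYPE('a))"
    by (simp add: has_sum_reindex[OF inj] o_def)
  moreover have "monomial_deriv b y (up k) = real (Suc (k b)) * monomial y k" for k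
  proof -
    have "(\<Prod>b'\<in>Basis - {b}. (y \<bullet> b') ^ up k b') = (\<Prod>b'\<in>Basis - {b}. (y \<bullet> b') ^ k b')"
      by (rule prod.cong) (auto simp: up_def)
    then show ?thesis
      unfolding monomial_deriv_def monomial_split[OF assms(1)] by (simp add: up_def)
  qed
  ultimately show ?thesis by (simp add: up_def mult.assoc)
qed

lemma real_analytic_on_iff:
  fixes f :: "'a::euclidean_space \<Rightarrow> real"
  shows "real_analytic_on f S \<longleftrightarrow> (\<forall>a\<in>S. \<exists>r>0. \<exists>c. \<forall>x\<in>ball a r.
     ((\<lambda>k. c k * monomial (x - a) k) has_sum f x) (multi_index TYPE('a)))"
  unfolding real_analytic_on_def monomial_def ..

definition dir_deriv :: "'a::euclidean_space \<Rightarrow> ('a \<Rightarrow> real) \<Rightarrow> 'a \<Rightarrow> real" where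
  "dir_deriv b f x = deriv (\<lambda>s. f (x + s *\<^sub>R b)) 0"

lemma real_analytic_on_differentiable:
  fixes f :: "'a::euclidean_space \<Rightarrow> real"
  assumes "real_analytic_on f S" "b \<in> Basis"
  shows "x \<in> S \<Longrightarrow> isCont f x"
    and "x \<in> S \<Longrightarrow> ((\<lambda>s. f (x + s *\<^sub>R b)) has_field_derivative dir_deriv b f x) (at 0)"
    and "real_analytic_on (dir_deriv b f) S"
proof -
  have *: "\<exists>\<rho>>0. continuous_on (ball a \<rho>) f \<and> (\<exists>c. \<forall>x\<in>ball a \<rho>.
      ((\<lambda>s. f (x + s *\<^sub>R b)) has_field_derivative dir_deriv b f x) (at 0) \<and>
      ((\<lambda>k. c k * monomial (x - a) k) has_sum dir_deriv b f x) (multi_index TYPE('a)))" if "a \<in> S" for a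
  proof -
    have "\<exists>r>0. \<exists>c. \<forall>x\<in>ball a r. ((\<lambda>k. c k * monomial (x - a) k) has_sum f x) (multi_index TYPE('a))"
      using assms(1) that unfolding real_analytic_on_iff by (rule bspec)
    then obtain r c where r: "r > 0"
      and c: "\<forall>x\<in>ball a r. ((\<lambda>k. c k * monomial (x - a) k) has_sum f x) (multi_index TYPE('a))"
      by (elim exE conjE)
    obtain \<rho> where \<rho>: "\<rho> > 0" "continuous_on (ball a \<rho>) f"
      "\<And>x b. b \<in> Basis \<Longrightarrow> x \<in> ball a \<rho> \<Longrightarrow> \<exists>D.
       ((\<lambda>s. f (x + s *\<^sub>R b)) has_field_derivative D) (at 0) \<and>
       ((\<lambda>k. c k * monomial_deriv b (x - a) k) has_sum D) (multi_index TYPE('a))"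
      by (rule power_series_differentiable[OF r], erule bspec[OF c], rule that)
    have "((\<lambda>s. f (x + s *\<^sub>R b)) has_field_derivative dir_deriv b f x) (at 0) \<and>
      ((\<lambda>k. (c (k(b := Suc (k b))) * real (Suc (k b))) * monomial (x - a) k) has_sum dir_deriv b f x)
        (multi_index TYPE('a))" if "x \<in> ball a \<rho>" for x
    proof -
      obtain D where D: "((\<lambda>s. f (x + s *\<^sub>R b)) has_field_derivative D) (at 0)"
        "((\<lambda>k. c k * monomial_deriv b (x - a) k) has_sum D) (multi_index TYPE('a))"
        using \<rho>(3)[OF assms(2) \<open>x \<in> ball a \<rho>\<close>] by (elim exE conjE)
      have "dir_deriv b f x = D" unfolding dir_deriv_def using D(1) by (rule DERIV_imp_deriv)
      with D(1) has_sum_monomial_deriv_shift[OF assms(2) D(2)] show ?thesis by simp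
    qed
    then show ?thesis
      using \<rho>(1,2)
      by (intro exI[of _ \<rho>] conjI exI[of _ "\<lambda>k. c (k(b := Suc (k b))) * real (Suc (k b))"] ballI)
        simp_all
  qed
  show "isCont f x" if "x \<in> S"
  proof -
    obtain \<rho> where "\<rho> > 0" "continuous_on (ball x \<rho>) f" using *[OF \<open>x \<in> S\<close>] by (elim exE conjE)
    then show ?thesis
      using continuous_on_eq_continuous_at[OF open_ball, of x \<rho> f] by simp
  qed
  show "((\<lambda>s. f (x + s *\<^sub>R b)) has_field_derivative dir_deriv b f x) (at 0)" if "x \<in> S"
  proof -
    obtain \<rho> c where "\<rho> > 0" "\<forall>y\<in>ball x \<rho>.
      ((\<lambda>s. f (y + s *\<^sub>R b)) has_field_derivative dir_deriv b f y) (at 0) \<and>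
      ((\<lambda>k. c k * monomial (y - x) k) has_sum dir_deriv b f y) (multi_index TYPE('a))"
      using *[OF \<open>x \<in> S\<close>] by (elim exE conjE)
    then show ?thesis by simp
  qed
  show "real_analytic_on (dir_deriv b f) S"
    unfolding real_analytic_on_iff
  proof
    fix a assume "a \<in> S"
    obtain \<rho> c where "\<rho> > 0" "\<forall>x\<in>ball a \<rho>.
      ((\<lambda>s. f (x + s *\<^sub>R b)) has_field_derivative dir_deriv b f x) (at 0) \<and>
      ((\<lambda>k. c k * monomial (x - a) k) has_sum dir_deriv b f x) (multi_index TYPE('a))"
      using *[OF \<open>a \<in> S\<close>] by (elim exE conjE)
    then show "\<exists>r>0. \<exists>c. \<forall>x\<in>ball a r.
        ((\<lambda>k. c k * monomial (x - a) k) has_sum dir_deriv b f x) (multi_index TYPE('a))"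
      by (intro exI[of _ \<rho>] exI[of _ c] conjI ballI) simp_all
  qed
qed

text \<open>
  Moving the coordinate \<open>e b\<close> of \<open>p\<close> moves \<open>args p\<close> along the basis vector \<open>b\<close>, and moving any other
  coordinate leaves it fixed. As \<open>dir_deriv b f\<close> is again analytic, the argument can be iterated.
\<close>
lemma analytic_has_partial:
  fixes f :: "'a::euclidean_space \<Rightarrow> real"
  assumes "real_analytic_on f S" "args p \<in> S"
    and args: "\<And>p b. b \<in> Basis \<Longrightarrow> args p \<bullet> b = p (e b)" and inj: "inj_on e Basis"
  shows "b \<in> Basis \<Longrightarrow> has_partial (e b) (\<lambda>p. f (args p)) (dir_deriv b f (args p)) p"
    and "c \<notin> e ` Basis \<Longrightarrow> has_partial c (\<lambda>p. f (args p)) 0 p"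
proof -
  show "has_partial (e b) (\<lambda>p. f (args p)) (dir_deriv b f (args p)) p" if b: "b \<in> Basis"
  proof -
    have "args (p(e b := s)) = args p + (s - p (e b)) *\<^sub>R b" for s
    proof (rule euclidean_eqI)
      fix b' :: 'a assume b': "b' \<in> Basis"
      have "e b' = e b \<longleftrightarrow> b' = b" using inj_on_eq_iff[OF inj b' b] .
      then show "args (p(e b := s)) \<bullet> b' = (args p + (s - p (e b)) *\<^sub>R b) \<bullet> b'"
        using b b' by (auto simp: args inner_left_distrib inner_Basis)
    qed
    then have "(\<lambda>s. f (args (p(e b := s)))) = (\<lambda>s. f (args p + (s + - p (e b)) *\<^sub>R b))" by simp
    moreover have "((\<lambda>s. f (args p + (s + - p (e b)) *\<^sub>R b)) has_field_derivative dir_deriv b f (args p)) (at (p (e b)))"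
      using real_analytic_on_differentiable(2)[OF assms(1) b assms(2)]
        DERIV_shift[of "\<lambda>s. f (args p + s *\<^sub>R b)" "dir_deriv b f (args p)" "p (e b)" "- p (e b)"] by simp
    ultimately show ?thesis unfolding has_partial_def by simp
  qed
  show "has_partial c (\<lambda>p. f (args p)) 0 p" if "c \<notin> e ` Basis"
  proof -
    have "args (p(c := s)) = args p" for s
      by (rule euclidean_eqI) (use that in \<open>auto simp: args\<close>)
    then show ?thesis unfolding has_partial_def by simp
  qed
qed

lemma smooth_analytic:
  fixes f :: "'a::euclidean_space \<Rightarrow> real" and args :: "('c \<Rightarrow> real) \<Rightarrow> 'a"
  assumes "real_analytic_on f S" "open U" "args ` U \<subseteq> S"
    and args: "\<And>p b. b \<in> Basis \<Longrightarrow> args p \<bullet> b = p (e b)" and inj: "inj_on e Basis"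
  shows "smooth_fun_on U (\<lambda>p. f (args p))"
proof (rule smooth_funI[OF assms(2)])
  have args_eq: "args p = (\<Sum>b\<in>Basis. p (e b) *\<^sub>R b)" for p
    using euclidean_representation[of "args p"] by (simp add: args cong: sum.cong)
  have cont_args: "continuous_on U args"
    unfolding args_eq[abs_def] by (intro continuous_on_sum continuous_on_scaleR continuous_coord continuous_on_const)
  have cont: "continuous_on U (\<lambda>p. g (args p))" if "real_analytic_on g S" for g
  proof -
    obtain b :: 'a where "b \<in> Basis" using nonempty_Basis by blast
    then have "continuous_on S g"
      by (intro continuous_at_imp_continuous_on ballI real_analytic_on_differentiable(1)[OF that])
    then show ?thesis by (rule continuous_on_compose2[OF _ cont_args assms(3)])
  qed
  show "finitary_on U (\<lambda>p. f (args p))"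
  proof (rule finitary_onI[of "e ` Basis"])
    fix p q :: "'c \<Rightarrow> real" assume pq: "\<And>c. c \<in> e ` Basis \<Longrightarrow> p c = q c"
    have "p (e b) = q (e b)" if "b \<in> Basis" for b using that by (intro pq imageI)
    then have "args p = args q" by (simp add: args_eq cong: sum.cong)
    then show "f (args p) = f (args q)" by simp
  qed simp
  show "Ck n U (\<lambda>p. f (args p))" for n
    using assms(1)
  proof (induction n arbitrary: f)
    case 0
    then show ?case using cont[OF 0] by simp
  next
    case (Suc n)
    have "\<exists>g. Ck n U g \<and> (\<forall>p\<in>U. has_partial c (\<lambda>p. f (args p)) (g p) p)" for c
    proof (cases "c \<in> e ` Basis")
      case True
      then obtain b where b: "b \<in> Basis" "c = e b" by blast
      have "has_partial c (\<lambda>p. f (args p)) (dir_deriv b f (args p)) p" if "p \<in> U" for p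
        unfolding b(2) using assms(3) that
        by (intro analytic_has_partial(1)[OF Suc.prems _ args inj b(1)]) auto
      then show ?thesis
        using Suc.IH[OF real_analytic_on_differentiable(3)[OF Suc.prems b(1)]]
        by (intro exI[of _ "\<lambda>p. dir_deriv b f (args p)"] conjI ballI)
    next
      case False
      have "has_partial c (\<lambda>p. f (args p)) 0 p" if "p \<in> U" for p
        using assms(3) that by (intro analytic_has_partial(2)[OF Suc.prems _ args inj False]) auto
      then show ?thesis
        by (intro exI[of _ "\<lambda>p. 0"] conjI ballI Ck_const)
    qed
    then show ?case using cont[OF Suc.prems] by simp
  qed
qed

section \<open>Local diffeomorphisms that replace some of the coordinates\<close>

lemma smooth_map_compD: "smooth_map_on U \<phi> \<Longrightarrow> smooth_fun_on U (\<lambda>p. \<phi> p d)"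
  by (simp add: smooth_map_on_def)

lemma smooth_map_onI: "(\<And>d. smooth_fun_on U (\<lambda>p. \<phi> p d)) \<Longrightarrow> smooth_map_on U \<phi>"
  by (simp add: smooth_map_on_def)

lemma smooth_map_compose:
  assumes "open U" "open W" "\<phi> ` U \<subseteq> W" "smooth_map_on W \<psi>" "smooth_map_on U \<phi>"
  shows "smooth_map_on U (\<lambda>p. \<psi> (\<phi> p))"
  by (rule smooth_map_onI, rule smooth_compose[OF assms(1-3) smooth_map_compD[OF assms(4)] assms(5)])

lemma smooth_map_on_cong:
  assumes "open U" "\<And>q. q \<in> U \<Longrightarrow> f q = g q"
  shows "smooth_map_on U f \<longleftrightarrow> smooth_map_on U g"
proof -
  have "smooth_fun_on U (\<lambda>p. f p d) \<longleftrightarrow> smooth_fun_on U (\<lambda>p. g p d)" for d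
    by (rule smooth_fun_on_cong[OF assms(1)]) (simp add: assms(2))
  then show ?thesis by (simp add: smooth_map_on_def)
qed

lemma smooth_map_replace:
  assumes "\<And>c. c \<in> J \<Longrightarrow> smooth_fun_on U (\<lambda>p. f p c)" "\<And>c. c \<notin> J \<Longrightarrow> smooth_fun_on U (\<lambda>p. g p c)"
  shows "smooth_map_on U (\<lambda>p c. if c \<in> J then f p c else g p c)"
proof (rule smooth_map_onI)
  show "smooth_fun_on U (\<lambda>p. if d \<in> J then f p d else g p d)" for d
    by (cases "d \<in> J") (simp_all add: assms)
qed

lemma smooth_map_update:
  assumes "open U" "smooth_fun_on U G"
  shows "smooth_map_on U (\<lambda>Q. Q(k := G Q))"
proof (rule smooth_map_onI)
  show "smooth_fun_on U (\<lambda>Q. (Q(k := G Q)) d)" for d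
    by (cases "d = k") (simp_all add: assms smooth_coord)
qed

definition local_diffeo ::
    "(('c \<Rightarrow> real) \<Rightarrow> 'c \<Rightarrow> real) \<Rightarrow> ('c \<Rightarrow> real) \<Rightarrow> ('c \<Rightarrow> real) set \<Rightarrow> ('c \<Rightarrow> real) set \<Rightarrow>
     (('c \<Rightarrow> real) \<Rightarrow> 'c \<Rightarrow> real) \<Rightarrow> bool" where
  "local_diffeo T P N M S \<longleftrightarrow>
     cylinder_open N \<and> cylinder_open M \<and> P \<in> N \<and> smooth_map_on N T \<and> smooth_map_on M S \<and>
     T ` N \<subseteq> M \<and> S ` M \<subseteq> N \<and> (\<forall>Q\<in>N. S (T Q) = Q) \<and> (\<forall>R\<in>M. T (S R) = R)"

lemma local_diffeo_compose:
  assumes "local_diffeo T1 P N1 M1 S1" "local_diffeo T2 (T1 P) N2 M2 S2"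
  shows "local_diffeo (\<lambda>Q. T2 (T1 Q)) P {Q \<in> N1. T1 Q \<in> N2} {R \<in> M2. S2 R \<in> M1} (\<lambda>R. S1 (S2 R))"
    (is "local_diffeo _ P ?N ?M _")
proof -
  note a = assms[unfolded local_diffeo_def]
  have N: "cylinder_open ?N" and M: "cylinder_open ?M"
    using a by (simp_all add: cylinder_open_preimage)
  have "smooth_map_on ?N (\<lambda>Q. T2 (T1 Q))"
    by (rule smooth_map_compose[of _ N2])
       (use a N in \<open>auto simp: cylinder_openD intro: smooth_map_on_subset\<close>)
  moreover have "smooth_map_on ?M (\<lambda>R. S1 (S2 R))"
    by (rule smooth_map_compose[of _ M1])
       (use a M in \<open>auto simp: cylinder_openD intro: smooth_map_on_subset\<close>)
  moreover have "T2 (T1 Q) \<in> ?M \<and> S1 (S2 (T2 (T1 Q))) = Q" if "Q \<in> ?N" for Q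
    using a that by (auto simp: image_subset_iff)
  moreover have "S1 (S2 R) \<in> ?N \<and> T2 (T1 (S1 (S2 R))) = R" if "R \<in> ?M" for R
    using a that by (auto simp: image_subset_iff)
  ultimately show ?thesis
    unfolding local_diffeo_def using N M a by (simp add: image_subset_iff)
qed

lemma local_diffeo_cong:
  assumes "local_diffeo T P N M S" "\<And>Q. Q \<in> N \<Longrightarrow> T Q = T' Q"
  shows "local_diffeo T' P N M S"
proof -
  note a = assms(1)[unfolded local_diffeo_def]
  have "smooth_map_on N T'"
    using a smooth_map_on_cong[OF cylinder_openD assms(2), of N] by simp
  then show ?thesis
    unfolding local_diffeo_def using a assms(2) by (auto simp: image_subset_iff)
qed

text \<open>
  The implicit function theorem in one unknown. Where \<open>\<partial>G/\<partial>k > 0\<close>, the equation \<open>G = R k\<close> for the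
  coordinate \<open>k\<close> has at most one solution \<open>y R\<close> by monotonicity, and it persists near a solvable \<open>R\<close>
  by the intermediate value theorem, which also makes \<open>y\<close> continuous. The mean value theorem gives
  the partial derivatives of \<open>y\<close>; these are smooth functions of \<open>R(k := y R)\<close>, so that \<open>y\<close> gains one
  order of differentiability at a time.
\<close>
lemma local_diffeo_update_pos:
  assumes "open D" "smooth_fun_on D G" "P \<in> D" "partial k G P > 0"
  obtains N M S where "local_diffeo (\<lambda>Q. Q(k := G Q)) P N M S" "N \<subseteq> D"
proof -
  have smooth_k: "smooth_fun_on D (partial c G)" for c
    by (rule smooth_fun_on_partial[OF assms(2,1)])
  have "open (partial k G -` {0<..} \<inter> D)"
    using continuous_on_open_vimage[OF assms(1), of "partial k G"] smooth_fun_on_continuous[OF smooth_k]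
    by (metis open_greaterThan)
  moreover have "P \<in> partial k G -` {0<..} \<inter> D" using assms(3,4) by simp
  ultimately obtain B0 d where B0: "finite B0" "d > 0"
    "\<And>p. (\<And>b. b \<in> B0 \<Longrightarrow> \<bar>p b - P b\<bar> < d) \<Longrightarrow> p \<in> partial k G -` {0<..} \<inter> D"
    by (rule open_contains_box) blast
  define B where "B = insert k B0"
  define N where "N = {Q. \<forall>b\<in>B. \<bar>Q b - P b\<bar> < d}"
  have "finite B" using B0(1) by (simp add: B_def)
  then have cyl_N: "cylinder_open N" unfolding N_def by (rule cylinder_open_box)
  then have "open N" by (rule cylinder_openD)
  have N_D: "Q \<in> D" and N_pos: "partial k G Q > 0" if "Q \<in> N" for Q
    using B0(3)[of Q] that by (auto simp: N_def B_def)
  have "N \<subseteq> D" using N_D by blast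
  have "P \<in> N" using B0(2) by (simp add: N_def)
  have slice: "Q(k := s) \<in> N \<longleftrightarrow> (\<forall>b\<in>B - {k}. \<bar>Q b - P b\<bar> < d) \<and> \<bar>s - P k\<bar> < d" for Q s
    by (auto simp: N_def B_def)
  have deriv_k: "((\<lambda>s. G (Q(k := s))) has_field_derivative partial k G (Q(k := s))) (at s)"
    if "Q(k := s) \<in> N" for Q s
    using smooth_fun_on_has_partial[OF assms(2) N_D[OF that], of k] by (simp add: has_partial_def)
  have between: "Q(k := s) \<in> N" if "Q(k := s1) \<in> N" "Q(k := s2) \<in> N" "s1 \<le> s" "s \<le> s2" for Q s1 s2 s
    using that unfolding slice by auto
  have mono: "G (Q(k := s1)) < G (Q(k := s2))" if "Q(k := s1) \<in> N" "Q(k := s2) \<in> N" "s1 < s2" for Q s1 s2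
  proof (rule DERIV_pos_imp_increasing[OF that(3)])
    fix s assume "s1 \<le> s" "s \<le> s2"
    then have s: "Q(k := s) \<in> N" by (rule between[OF that(1,2)])
    show "\<exists>y. ((\<lambda>s. G (Q(k := s))) has_field_derivative y) (at s) \<and> 0 < y"
      using deriv_k[OF s] N_pos[OF s] by (intro exI[of _ "partial k G (Q(k := s))"] conjI)
  qed
  define sol where "sol = (\<lambda>R s. R(k := s) \<in> N \<and> G (R(k := s)) = R k)"
  have sol_unique: "s = s'" if "sol R s" "sol R s'" for R s s'
    using mono[of R s s'] mono[of R s' s] that unfolding sol_def by (cases s s' rule: linorder_cases) auto
  define M where "M = {R. \<exists>s. sol R s}"
  define y where "y = (\<lambda>R. THE s. sol R s)"
  define S where "S = (\<lambda>R. R(k := y R))"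
  have y_eq: "y R = s" if "sol R s" for R s
    unfolding y_def using that sol_unique[OF _ that] by (rule the_equality)
  have y_sol: "sol R (y R)" if "R \<in> M" for R
    using that y_eq unfolding M_def by auto
  have S_N: "S R \<in> N" and G_S: "G (S R) = R k" if "R \<in> M" for R
    using y_sol[OF that] by (simp_all add: sol_def S_def)

  \<comment> \<open>Values of \<open>G\<close> on both sides of \<open>R k\<close>, at \<open>s1 < y R < s2\<close>, stay on their sides for \<open>R'\<close> near \<open>R\<close>.\<close>
  have persist: "\<exists>V. open V \<and> R \<in> V \<and> (\<forall>R'\<in>V. R' \<in> M \<and> \<bar>y R' - y R\<bar> < e)" if R: "R \<in> M" and e: "e > 0" for R e
  proof -
    define s0 where "s0 = y R"
    have s0: "\<bar>s0 - P k\<bar> < d" using S_N[OF R] unfolding S_def s0_def slice by simp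
    obtain \<delta> where "0 < \<delta>" "\<delta> < min e (d - \<bar>s0 - P k\<bar>)"
      using dense[of 0 "min e (d - \<bar>s0 - P k\<bar>)"] e s0 by auto
    then have \<delta>: "\<delta> > 0" "\<delta> < e" "\<bar>s0 - P k\<bar> + \<delta> < d" by simp_all
    define s1 s2 where "s1 = s0 - \<delta>" and "s2 = s0 + \<delta>"
    have in_N: "R(k := s0) \<in> N" "R(k := s1) \<in> N" "R(k := s2) \<in> N"
    proof -
      have "\<bar>s1 - P k\<bar> < d" "\<bar>s2 - P k\<bar> < d" using \<delta> unfolding s1_def s2_def by - linarith+
      then show "R(k := s0) \<in> N" "R(k := s1) \<in> N" "R(k := s2) \<in> N"
        using S_N[OF R] unfolding S_def s0_def[symmetric] slice by blast+
    qed
    have G0: "G (R(k := s0)) = R k" using G_S[OF R] by (simp add: S_def s0_def)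
    define V where "V = {R'. R'(k := s1) \<in> N} \<inter> {R'. R'(k := s2) \<in> N} \<inter>
       {R' \<in> {R'. R'(k := s1) \<in> N}. G (R'(k := s1)) < R' k} \<inter>
       {R' \<in> {R'. R'(k := s2) \<in> N}. R' k < G (R'(k := s2))}"
    have cont_upd: "continuous_on UNIV (\<lambda>R :: _ \<Rightarrow> real. R(k := s))" for s
      by (rule smooth_map_on_continuous[OF smooth_map_update[OF open_UNIV smooth_const[OF open_UNIV]]])
    have op: "open {R'. R'(k := s) \<in> N}" for s
      using open_vimage[OF \<open>open N\<close> cont_upd, of s] by (simp add: vimage_def)
    have cont: "continuous_on {R'. R'(k := s) \<in> N} (\<lambda>R'. G (R'(k := s)))" for s
      using smooth_fun_on_continuous[OF assms(2)] N_D
      by (intro continuous_on_compose2[OF _ continuous_on_subset[OF cont_upd]]) auto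
    have op_less: "open {R' \<in> E. f R' < g R'}" if "open E" "continuous_on E f" "continuous_on E g"
      for E and f g :: "_ \<Rightarrow> real"
    proof -
      have "open ((\<lambda>R'. g R' - f R') -` {0<..} \<inter> E)"
        using continuous_on_open_vimage[OF that(1)] continuous_on_diff[OF that(3,2)] by (metis open_greaterThan)
      moreover have "(\<lambda>R'. g R' - f R') -` {0<..} \<inter> E = {R' \<in> E. f R' < g R'}" by auto
      ultimately show ?thesis by simp
    qed
    have "open V"
      unfolding V_def by (intro open_Int op op_less cont continuous_coord)
    moreover have "R \<in> V"
      using mono[OF in_N(2,1)] mono[OF in_N(1,3)] in_N G0 \<delta>(1) by (auto simp: V_def s1_def s2_def)
    moreover have "R' \<in> M \<and> \<bar>y R' - y R\<bar> < e" if "R' \<in> V" for R'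
    proof -
      have R': "R'(k := s1) \<in> N" "R'(k := s2) \<in> N" "G (R'(k := s1)) \<le> R' k" "R' k \<le> G (R'(k := s2))"
        using that by (auto simp: V_def)
      have "s1 \<le> s2" using \<delta>(1) by (simp add: s1_def s2_def)
      have "isCont (\<lambda>s. G (R'(k := s))) s" if "s1 \<le> s" "s \<le> s2" for s
        by (rule DERIV_isCont[OF deriv_k[OF between[OF R'(1,2) that]]])
      then have "\<exists>s. s1 \<le> s \<and> s \<le> s2 \<and> G (R'(k := s)) = R' k"
        using IVT[of "\<lambda>s. G (R'(k := s))" s1 "R' k" s2] R'(3,4) \<open>s1 \<le> s2\<close> by simp
      then obtain s where s: "s1 \<le> s" "s \<le> s2" "G (R'(k := s)) = R' k" by blast
      have "sol R' s" unfolding sol_def using between[OF R'(1,2) s(1,2)] s(3) by simp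
      then have "R' \<in> M" "y R' = s" using y_eq by (auto simp: M_def)
      moreover have "\<bar>s - s0\<bar> < e" using s(1,2) \<delta> unfolding s1_def s2_def by linarith
      ultimately show ?thesis by (simp add: s0_def)
    qed
    ultimately show ?thesis by (intro exI[of _ V]) simp
  qed
  have "open M"
  proof (subst open_subopen, intro ballI)
    fix R assume "R \<in> M"
    then obtain V where "open V" "R \<in> V" "\<forall>R'\<in>V. R' \<in> M \<and> \<bar>y R' - y R\<bar> < 1"
      using persist[of R 1] by auto
    then show "\<exists>V. open V \<and> R \<in> V \<and> V \<subseteq> M" by (intro exI[of _ V]) auto
  qed
  have cont_y: "continuous_on M y"
    unfolding continuous_on_def
  proof (intro ballI tendstoI)
    fix R and e :: real assume "R \<in> M" "e > 0"
    then obtain V where "open V" "R \<in> V" "\<forall>R'\<in>V. R' \<in> M \<and> \<bar>y R' - y R\<bar> < e"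
      using persist[of R e] by auto
    then show "eventually (\<lambda>R'. dist (y R') (y R) < e) (at R within M)"
      unfolding eventually_at_topological dist_real_def by (intro exI[of _ V]) simp
  qed

  obtain A where A: "finite A"
    "\<And>p q. p \<in> D \<Longrightarrow> q \<in> D \<Longrightarrow> (\<And>c. c \<in> A \<Longrightarrow> p c = q c) \<Longrightarrow> G p = G q"
    using finitary_onE[OF smooth_fun_on_finitary[OF assms(2)]] by blast
  have sol_transfer: "sol R' s" if s: "sol R s" and eq: "\<And>c. c \<in> A \<union> B \<Longrightarrow> R c = R' c" for R R' s
  proof -
    have N: "R(k := s) \<in> N" "R'(k := s) \<in> N"
      using s eq unfolding sol_def slice by auto
    have "G (R(k := s)) = G (R'(k := s))"
      by (rule A(2)[OF N_D[OF N(1)] N_D[OF N(2)]]) (simp add: eq)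
    then show ?thesis using s N eq[of k] by (simp add: sol_def B_def)
  qed
  have "finite (A \<union> B)" using A(1) \<open>finite B\<close> by simp
  have cyl_M: "cylinder_open M"
  proof (rule cylinder_openI[OF \<open>open M\<close> \<open>finite (A \<union> B)\<close>])
    fix R R' assume R: "R \<in> M" and eq: "\<And>c. c \<in> A \<union> B \<Longrightarrow> R c = R' c"
    have "sol R' (y R)" by (rule sol_transfer[OF y_sol[OF R] eq])
    then show "R' \<in> M" by (auto simp: M_def)
  qed
  have fin_y: "finitary_on M y"
  proof (rule finitary_onI[OF \<open>finite (A \<union> B)\<close>])
    fix R R' assume R: "R \<in> M" and "R' \<in> M" and eq: "\<And>c. c \<in> A \<union> B \<Longrightarrow> R c = R' c"
    have "sol R' (y R)" by (rule sol_transfer[OF y_sol[OF R] eq])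
    then show "y R = y R'" using y_eq by simp
  qed

  define y' where "y' = (\<lambda>c q. (if c = k then 1 else - partial c G q) / partial k G q)"
  have deriv_y: "has_partial c y (y' c (S R)) R" if R: "R \<in> M" for c R
  proof -
    define Y where "Y = (\<lambda>t. y (R(c := t)))"
    define t0 where "t0 = R c"
    have Y0: "Y t0 = y R" by (simp add: Y_def t0_def)
    have "R(c := t0) = R" by (simp add: t0_def)
    have ev_M: "eventually (\<lambda>t. R(c := t) \<in> M) (nhds t0)"
      unfolding t0_def by (rule eventually_fun_upd_in_open[OF \<open>open M\<close> R])
    have contY: "isCont Y t0"
      unfolding isCont_def
    proof (rule tendstoI)
      fix e :: real assume "e > 0"
      then obtain V where V: "open V" "R \<in> V" "\<forall>R'\<in>V. R' \<in> M \<and> \<bar>y R' - y R\<bar> < e"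
        using persist[OF R, of e] by auto
      have "eventually (\<lambda>t. R(c := t) \<in> V) (nhds t0)"
        unfolding t0_def by (rule eventually_fun_upd_in_open[OF V(1,2)])
      then have "eventually (\<lambda>t. dist (Y t) (Y t0) < e) (nhds t0)"
        by (rule eventually_mono) (use V(3) Y0 in \<open>simp add: Y_def dist_real_def\<close>)
      then show "eventually (\<lambda>t. dist (Y t) (Y t0) < e) (at t0)"
        unfolding eventually_at_filter by (rule eventually_mono) simp
    qed
    have pos: "partial k G (S R) > 0" by (rule N_pos[OF S_N[OF R]])
    have "(Y has_field_derivative y' c (S R)) (at t0)"
    proof (cases "c = k")
      case True
      obtain e where e: "e > 0" "\<And>t. dist t t0 < e \<Longrightarrow> R(c := t) \<in> M"
        using ev_M unfolding eventually_nhds_metric by auto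
      have "((\<lambda>s. G (R(k := s))) has_field_derivative partial k G (S R)) (at (Y t0))"
        using deriv_k[of R "y R"] S_N[OF R] by (simp add: S_def Y0)
      then have "(Y has_field_derivative inverse (partial k G (S R))) (at t0)"
      proof (rule DERIV_inverse_function[where a = "t0 - e" and b = "t0 + e"])
        show "G (R(k := Y t)) = t" if "t0 - e < t" "t < t0 + e" for t
          using G_S[OF e(2), of t] that True by (simp add: dist_real_def S_def Y_def abs_less_iff)
      qed (use pos e contY in auto)
      then show ?thesis by (simp add: y'_def True inverse_eq_divide)
    next
      case False
      \<comment> \<open>The mean value theorem turns \<open>F t (Y t) - F t s0\<close> into \<open>Y t - s0\<close> times a derivative at some \<open>\<eta> t\<close>
         between; as \<open>F t (Y t)\<close> is constant, the difference quotient of \<open>Y\<close> is that of \<open>F _ s0\<close>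
         divided by a quantity that tends to \<open>- \<partial>G/\<partial>k\<close>.\<close>
      define F where "F = (\<lambda>t s. G (R(c := t, k := s)))"
      define s0 where "s0 = y R"
      have S_eq: "S R = R(c := t0, k := s0)" by (simp add: S_def s0_def t0_def)
      have S_eq': "R(k := s0, c := t0) = S R" using False by (simp add: S_def s0_def t0_def fun_upd_twist)
      have F_Y: "F t (Y t) = R k" if "R(c := t) \<in> M" for t
        using G_S[OF that] False by (simp add: F_def S_def Y_def)
      have ev_N: "eventually (\<lambda>t. R(c := t, k := s0) \<in> N) (nhds t0)"
      proof -
        have "eventually (\<lambda>t. (R(k := s0))(c := t) \<in> N) (nhds ((R(k := s0)) c))"
          by (rule eventually_fun_upd_in_open[OF \<open>open N\<close>])
             (use S_N[OF R] in \<open>simp add: S_def s0_def\<close>)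
        then show ?thesis using False by (simp add: t0_def fun_upd_twist)
      qed
      have "\<exists>\<eta>. \<bar>\<eta> - s0\<bar> \<le> \<bar>Y t - s0\<bar> \<and> R(c := t, k := \<eta>) \<in> N \<and>
          F t (Y t) - F t s0 = (Y t - s0) * partial k G (R(c := t, k := \<eta>))"
        if t: "R(c := t) \<in> M" "R(c := t, k := s0) \<in> N" for t
      proof -
        have YN: "R(c := t, k := Y t) \<in> N" using S_N[OF t(1)] by (simp add: S_def Y_def)
        consider "s0 < Y t" | "Y t < s0" | "Y t = s0" by linarith
        then show ?thesis
        proof cases
          case 1
          have "(F t has_field_derivative partial k G (R(c := t, k := s))) (at s)" if "s0 \<le> s" "s \<le> Y t" for s
            unfolding F_def by (rule deriv_k[OF between[OF t(2) YN that]])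
          from MVT2[OF 1 this] obtain z where z: "s0 < z" "z < Y t"
            "F t (Y t) - F t s0 = (Y t - s0) * partial k G (R(c := t, k := z))" by auto
          then show ?thesis
            using between[OF t(2) YN, of z] by (intro exI[of _ z]) auto
        next
          case 2
          have "(F t has_field_derivative partial k G (R(c := t, k := s))) (at s)" if "Y t \<le> s" "s \<le> s0" for s
            unfolding F_def by (rule deriv_k[OF between[OF YN t(2) that]])
          from MVT2[OF 2 this] obtain z where z: "Y t < z" "z < s0"
            "F t s0 - F t (Y t) = (s0 - Y t) * partial k G (R(c := t, k := z))" by auto
          then show ?thesis
            using between[OF YN t(2), of z] by (intro exI[of _ z]) (auto simp: algebra_simps)
        next
          case 3
          then show ?thesis using t(2) by (intro exI[of _ s0]) auto
        qed
      qed
      then have "\<exists>\<eta>. R(c := t) \<in> M \<and> R(c := t, k := s0) \<in> N \<longrightarrow> \<bar>\<eta> - s0\<bar> \<le> \<bar>Y t - s0\<bar> \<and>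
          R(c := t, k := \<eta>) \<in> N \<and>
          F t (Y t) - F t s0 = (Y t - s0) * partial k G (R(c := t, k := \<eta>))" for t by meson
      then obtain \<eta> where \<eta>: "\<And>t. R(c := t) \<in> M \<Longrightarrow> R(c := t, k := s0) \<in> N \<Longrightarrow>
          \<bar>\<eta> t - s0\<bar> \<le> \<bar>Y t - s0\<bar> \<and> R(c := t, k := \<eta> t) \<in> N \<and>
          F t (Y t) - F t s0 = (Y t - s0) * partial k G (R(c := t, k := \<eta> t))"
        by metis
      have ev: "eventually (\<lambda>t. R(c := t) \<in> M \<and> R(c := t, k := s0) \<in> N) (at t0)"
        using eventually_conj[OF ev_M ev_N] unfolding eventually_at_filter
        by (rule eventually_mono) simp
      have Ylim: "(Y \<longlongrightarrow> s0) (at t0)" using contY Y0 by (simp add: isCont_def s0_def)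
      have "((\<lambda>t. \<eta> t - s0) \<longlongrightarrow> 0) (at t0)"
      proof (rule Lim_null_comparison)
        show "eventually (\<lambda>t. norm (\<eta> t - s0) \<le> \<bar>Y t - s0\<bar>) (at t0)"
          using ev by (rule eventually_mono) (use \<eta> in auto)
        show "((\<lambda>t. \<bar>Y t - s0\<bar>) \<longlongrightarrow> 0) (at t0)"
          using tendsto_rabs[OF tendsto_diff[OF Ylim tendsto_const[of s0]]] by simp
      qed
      then have \<eta>lim: "(\<eta> \<longlongrightarrow> s0) (at t0)" using Lim_null by blast
      have g: "((\<lambda>t. partial k G (R(c := t, k := \<eta> t))) \<longlongrightarrow> partial k G (S R)) (at t0)"
      proof (rule tendstoI)
        fix e :: real assume e: "e > 0"
        have "open ((\<lambda>q. \<bar>partial k G q - partial k G (S R)\<bar>) -` {..<e} \<inter> D)"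
        proof -
          have "continuous_on D (\<lambda>q. \<bar>partial k G q - partial k G (S R)\<bar>)"
            by (intro continuous_intros smooth_fun_on_continuous smooth_k)
          then show ?thesis using continuous_on_open_vimage[OF assms(1)] by (metis open_lessThan)
        qed
        moreover have "S R \<in> (\<lambda>q. \<bar>partial k G q - partial k G (S R)\<bar>) -` {..<e} \<inter> D"
          using e N_D[OF S_N[OF R]] by simp
        ultimately obtain C \<rho> where C: "finite C" "\<rho> > 0" "\<And>p. (\<And>b. b \<in> C \<Longrightarrow> \<bar>p b - S R b\<bar> < \<rho>) \<Longrightarrow>
            p \<in> (\<lambda>q. \<bar>partial k G q - partial k G (S R)\<bar>) -` {..<e} \<inter> D"
          by (rule open_contains_box) blast
        have "eventually (\<lambda>t. dist t t0 < \<rho>) (at t0)" using C(2) eventually_at by blast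
        moreover have "eventually (\<lambda>t. dist (\<eta> t) s0 < \<rho>) (at t0)" using tendstoD[OF \<eta>lim C(2)] .
        ultimately show "eventually (\<lambda>t. dist (partial k G (R(c := t, k := \<eta> t))) (partial k G (S R)) < e) (at t0)"
        proof eventually_elim
          case (elim t)
          have "R(c := t, k := \<eta> t) \<in> (\<lambda>q. \<bar>partial k G q - partial k G (S R)\<bar>) -` {..<e} \<inter> D"
            by (rule C(3)) (use elim C(2) in \<open>auto simp: S_eq dist_real_def\<close>)
          then show ?case by (simp add: dist_real_def)
        qed
      qed
      have "((\<lambda>t. F t s0) has_field_derivative partial c G (S R)) (at t0)"
      proof -
        have "has_partial c G (partial c G (S R)) (S R)"
          by (rule smooth_fun_on_has_partial[OF assms(2) N_D[OF S_N[OF R]]])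
        then show ?thesis
          using False unfolding has_partial_def F_def S_def s0_def[symmetric] by (simp add: t0_def fun_upd_twist)
      qed
      then have F: "((\<lambda>t. (F t s0 - F t0 s0) / (t - t0)) \<longlongrightarrow> partial c G (S R)) (at t0)"
        unfolding has_field_derivative_iff .
      have "((\<lambda>t. - ((F t s0 - F t0 s0) / (t - t0)) / partial k G (R(c := t, k := \<eta> t))) \<longlongrightarrow>
          - partial c G (S R) / partial k G (S R)) (at t0)"
        using pos by (intro tendsto_divide tendsto_minus F g) simp
      moreover have "eventually (\<lambda>t. - ((F t s0 - F t0 s0) / (t - t0)) / partial k G (R(c := t, k := \<eta> t)) =
          (Y t - Y t0) / (t - t0)) (at t0)"
        using ev
      proof (rule eventually_mono)
        fix t assume t: "R(c := t) \<in> M \<and> R(c := t, k := s0) \<in> N"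
        have "partial k G (R(c := t, k := \<eta> t)) > 0" using \<eta> t by (intro N_pos) blast
        moreover have "F t0 s0 = R k" using G_S[OF R] by (simp add: F_def S_eq)
        moreover have "F t (Y t) = R k" using F_Y t by blast
        moreover have "F t (Y t) - F t s0 = (Y t - s0) * partial k G (R(c := t, k := \<eta> t))" using \<eta> t by blast
        ultimately have "- (F t s0 - F t0 s0) / partial k G (R(c := t, k := \<eta> t)) = Y t - Y t0"
          unfolding Y0 s0_def[symmetric] by (simp add: field_simps)
        then show "- ((F t s0 - F t0 s0) / (t - t0)) / partial k G (R(c := t, k := \<eta> t)) = (Y t - Y t0) / (t - t0)"
          by (metis divide_divide_eq_left minus_divide_left mult.commute)
      qed
      ultimately have "((\<lambda>t. (Y t - Y t0) / (t - t0)) \<longlongrightarrow> - partial c G (S R) / partial k G (S R)) (at t0)"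
        by (rule Lim_transform_eventually)
      then show ?thesis unfolding has_field_derivative_iff by (simp add: y'_def False)
    qed
    then show ?thesis unfolding has_partial_def Y_def t0_def .
  qed

  have smooth_N: "smooth_fun_on N (partial c G)" for c
    by (rule smooth_fun_on_subset[OF smooth_k assms(1) \<open>open N\<close> \<open>N \<subseteq> D\<close>])
  have smooth_y': "smooth_fun_on N (y' c)" for c
  proof (cases "c = k")
    case True
    have "smooth_fun_on N (\<lambda>q. 1 / partial k G q)"
      by (intro smooth_divide smooth_const \<open>open N\<close> smooth_N) (use N_pos in fastforce)
    then show ?thesis by (simp add: y'_def True)
  next
    case False
    have "smooth_fun_on N (\<lambda>q. - partial c G q / partial k G q)"
      by (intro smooth_divide smooth_minus \<open>open N\<close> smooth_N) (use N_pos in fastforce)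
    then show ?thesis by (simp add: y'_def False)
  qed
  have S_image: "S ` M \<subseteq> N" using S_N by blast
  have "Ck n M y" for n
  proof (induction n)
    case 0
    then show ?case using cont_y by simp
  next
    case (Suc n)
    have S_Ck: "Ck n M (\<lambda>R. S R d)" for d
      using Suc Ck_coord[of n M d] by (cases "d = k") (simp_all add: S_def)
    have "Ck n M (\<lambda>R. y' c (S R))" for c
      by (rule Ck_compose[OF \<open>open M\<close> \<open>open N\<close> S_image smooth_fun_on_finitary[OF smooth_y']
          smooth_fun_on_Ck[OF \<open>open N\<close> smooth_y'] S_Ck])
    then have "\<exists>g. Ck n M g \<and> (\<forall>R\<in>M. has_partial c y (g R) R)" for c
      using deriv_y by (intro exI[of _ "\<lambda>R. y' c (S R)"]) simp
    then show ?case using cont_y by simp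
  qed
  then have "smooth_fun_on M y" by (rule smooth_funI[OF \<open>open M\<close> fin_y])
  then have smooth_S: "smooth_map_on M S"
    unfolding S_def by (rule smooth_map_update[OF \<open>open M\<close>])
  have smooth_T: "smooth_map_on N (\<lambda>Q. Q(k := G Q))"
    by (rule smooth_map_update[OF \<open>open N\<close> smooth_fun_on_subset[OF assms(2,1) \<open>open N\<close> \<open>N \<subseteq> D\<close>]])
  have T: "Q(k := G Q) \<in> M" "S (Q(k := G Q)) = Q" if "Q \<in> N" for Q
  proof -
    have s: "sol (Q(k := G Q)) (Q k)" using that by (simp add: sol_def)
    then show "Q(k := G Q) \<in> M" by (auto simp: M_def)
    show "S (Q(k := G Q)) = Q" using y_eq[OF s] by (simp add: S_def)
  qed
  have "(S R)(k := G (S R)) = R" if "R \<in> M" for R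
    using G_S[OF that] by (simp add: S_def)
  then have "local_diffeo (\<lambda>Q. Q(k := G Q)) P N M S"
    unfolding local_diffeo_def using cyl_N cyl_M \<open>P \<in> N\<close> smooth_T smooth_S T S_image by auto
  then show thesis using \<open>N \<subseteq> D\<close> by (rule that)
qed

text \<open>A negative derivative is made positive by reflecting the coordinate \<open>k\<close> afterwards.\<close>
lemma local_diffeo_update:
  assumes "open D" "smooth_fun_on D G" "P \<in> D" "partial k G P \<noteq> 0"
  obtains N M S where "local_diffeo (\<lambda>Q. Q(k := G Q)) P N M S" "N \<subseteq> D"
proof (cases "partial k G P > 0")
  case True
  show thesis by (rule local_diffeo_update_pos[OF assms(1-3) True], rule that)
next
  case False
  have smooth: "smooth_fun_on D (\<lambda>Q. - G Q)" by (rule smooth_minus[OF assms(1,2)])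
  have "has_partial k (\<lambda>Q. - G Q) (- partial k G P) P"
    using smooth_fun_on_has_partial[OF assms(2,3)] unfolding has_partial_def by (rule DERIV_minus)
  then have "partial k (\<lambda>Q. - G Q) P > 0"
    using has_partial_imp_partial False assms(4) by fastforce
  then obtain N M S where N: "local_diffeo (\<lambda>Q. Q(k := - G Q)) P N M S" "N \<subseteq> D"
    by (rule local_diffeo_update_pos[OF assms(1) smooth assms(3)])
  have UNIV: "cylinder_open UNIV" by (rule cylinder_openI[of _ "{}"]) auto
  have flip: "smooth_map_on UNIV (\<lambda>Q. Q(k := - Q k))"
    by (intro smooth_map_update smooth_minus smooth_coord open_UNIV)
  have "local_diffeo (\<lambda>Q. Q(k := - Q k)) (P(k := - G P)) UNIV UNIV (\<lambda>Q. Q(k := - Q k))"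
    unfolding local_diffeo_def using UNIV flip by simp
  from local_diffeo_compose[OF N(1) this]
  have comp: "local_diffeo (\<lambda>Q. (Q(k := - G Q))(k := - (Q(k := - G Q)) k)) P {Q \<in> N. Q(k := - G Q) \<in> UNIV}
      {R \<in> UNIV. R(k := - R k) \<in> M} (\<lambda>R. S (R(k := - R k)))" .
  have "local_diffeo (\<lambda>Q. Q(k := G Q)) P {Q \<in> N. Q(k := - G Q) \<in> UNIV}
      {R \<in> UNIV. R(k := - R k) \<in> M} (\<lambda>R. S (R(k := - R k)))"
    by (rule local_diffeo_cong[OF comp]) simp
  then show thesis by (rule that) (use N(2) in auto)
qed

lemma partial_compose_update:
  assumes "open U" "open W" "smooth_fun_on U G" "smooth_fun_on W f" "\<And>Q. Q \<in> U \<Longrightarrow> Q(k := G Q) \<in> W" "P \<in> U"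
  shows "partial c (\<lambda>Q. f (Q(k := G Q))) P =
     (if c = k then 0 else partial c f (P(k := G P))) + partial k f (P(k := G P)) * partial c G P"
proof -
  obtain A where A: "finite A"
    "\<And>p q. p \<in> W \<Longrightarrow> q \<in> W \<Longrightarrow> (\<And>c. c \<in> A \<Longrightarrow> p c = q c) \<Longrightarrow> f p = f q"
    using finitary_onE[OF smooth_fun_on_finitary[OF assms(4)]] by blast
  define B where "B = insert c (insert k A)"
  have dep: "f p = f q" if "p \<in> W" "q \<in> W" "\<And>c. c \<in> B \<Longrightarrow> p c = q c" for p q
    by (rule A(2)[OF that(1,2)], rule that(3)) (simp add: B_def)
  define h where "h = (\<lambda>d. if d = k then partial c G P else if d = c then 1 else 0 :: real)"
  have inner: "has_partial c (\<lambda>Q. (Q(k := G Q)) d) (h d) P" for d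
    using smooth_fun_on_has_partial[OF assms(3,6), of c] has_partial_coord[of c d P]
    by (cases "d = k") (simp_all add: h_def)
  have cont: "continuous_on U (\<lambda>Q. Q(k := G Q))"
    by (rule smooth_map_on_continuous[OF smooth_map_update[OF assms(1,3)]])
  have image: "(\<lambda>Q. Q(k := G Q)) ` U \<subseteq> W" using assms(5) by blast
  have "finite B" using A(1) by (simp add: B_def)
  have "has_partial c (\<lambda>Q. f (Q(k := G Q))) (\<Sum>d\<in>B. partial d f (P(k := G P)) * h d) P"
    by (rule has_partial_compose[OF assms(1,2,6) cont image \<open>finite B\<close>])
       (rule dep inner smooth_fun_on_has_partial[OF assms(4)]
         smooth_fun_on_continuous[OF smooth_fun_on_partial[OF assms(4,2)]]; assumption)+
  then have "partial c (\<lambda>Q. f (Q(k := G Q))) P = (\<Sum>d\<in>B. partial d f (P(k := G P)) * h d)"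
    by (rule has_partial_imp_partial)
  also have "\<dots> = (\<Sum>d\<in>{k, c}. partial d f (P(k := G P)) * h d)"
    using \<open>finite B\<close> by (intro sum.mono_neutral_right) (auto simp: B_def h_def)
  also have "\<dots> = (if c = k then 0 else partial c f (P(k := G P))) + partial k f (P(k := G P)) * partial c G P"
    by (cases "c = k") (simp_all add: h_def)
  finally show ?thesis .
qed

text \<open>
  Several coordinates are replaced by elimination: a function \<open>G i\<close> with \<open>\<partial>(G i)/\<partial>j \<noteq> 0\<close> takes the place
  of the coordinate \<open>j\<close>, and the Jacobian of the remaining functions in the new coordinates is a
  Schur complement, hence again has trivial left kernel. The pivots determine which function
  ends up in which coordinate.
\<close>
lemma local_diffeo_family:
  fixes G :: "'i \<Rightarrow> ('c \<Rightarrow> real) \<Rightarrow> real"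
  assumes "finite J" "finite I" "card I = card J" "open D" "P \<in> D"
    and "\<And>i. i \<in> I \<Longrightarrow> smooth_fun_on D (G i)"
    and "\<forall>a. (\<forall>j\<in>J. (\<Sum>i\<in>I. a i * partial j (G i) P) = 0) \<longrightarrow> (\<forall>i\<in>I. a i = 0)"
  shows "\<exists>\<sigma> N M S. bij_betw \<sigma> J I \<and> N \<subseteq> D \<and>
     local_diffeo (\<lambda>Q c. if c \<in> J then G (\<sigma> c) Q else Q c) P N M S"
  using assms
proof (induction "card J" arbitrary: I J G D P)
  case 0
  then have "J = {}" "I = {}" by simp_all
  obtain N where N: "cylinder_open N" "P \<in> N" "N \<subseteq> D"
    using open_contains_cylinder_open[OF \<open>open D\<close> \<open>P \<in> D\<close>] by blast
  have "smooth_map_on N (\<lambda>Q. Q)"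
    by (intro smooth_map_onI smooth_coord cylinder_openD N(1))
  then have "local_diffeo (\<lambda>Q c. if c \<in> J then G (undefined c) Q else Q c) P N N (\<lambda>Q. Q)"
    using N \<open>J = {}\<close> by (simp add: local_diffeo_def)
  moreover have "bij_betw (undefined :: 'c \<Rightarrow> 'i) J I" using \<open>J = {}\<close> \<open>I = {}\<close> by (simp add: bij_betw_def)
  ultimately show ?case using N(3) by blast
next
  case (Suc n)
  note nonsing = Suc.prems(7)
  have "card I = Suc n" using Suc.hyps(2) Suc.prems(3) by simp
  then obtain i0 where i0: "i0 \<in> I" by fastforce
  have "\<exists>j\<in>J. partial j (G i0) P \<noteq> 0"
  proof (rule ccontr)
    assume none: "\<not> (\<exists>j\<in>J. partial j (G i0) P \<noteq> 0)"
    have "(\<Sum>i\<in>I. (if i = i0 then 1 else 0) * partial j (G i) P) = partial j (G i0) P" for j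
      using i0 Suc.prems(2) by (simp add: if_distrib[of "\<lambda>x. x * _"] cong: if_cong)
    then have "\<forall>j\<in>J. (\<Sum>i\<in>I. (if i = i0 then 1 else 0) * partial j (G i) P) = 0"
      using none by simp
    from bspec[OF nonsing[THEN spec, THEN mp, OF this] i0] show False by simp
  qed
  then obtain j0 where j0: "j0 \<in> J" "partial j0 (G i0) P \<noteq> 0" by blast
  obtain N1 M1 S1 where T1: "local_diffeo (\<lambda>Q. Q(j0 := G i0 Q)) P N1 M1 S1" and N1: "N1 \<subseteq> D"
    by (rule local_diffeo_update[OF Suc.prems(4) Suc.prems(6)[OF i0] Suc.prems(5) j0(2)])
  note a = T1[unfolded local_diffeo_def]
  have opens: "open N1" "open M1" using a by (simp_all add: cylinder_openD)
  define P' where "P' = P(j0 := G i0 P)"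
  define G' where "G' = (\<lambda>i R. G i (S1 R))"
  have "P \<in> N1" "P' \<in> M1" using a by (auto simp: P'_def)
  have smooth': "smooth_fun_on M1 (G' i)" if "i \<in> I" for i
    unfolding G'_def
    by (rule smooth_compose[OF opens(2) Suc.prems(4) _ Suc.prems(6)[OF that]]) (use a N1 in auto)
  have smooth0: "smooth_fun_on N1 (G i0)"
    by (rule smooth_fun_on_subset[OF Suc.prems(6)[OF i0] Suc.prems(4) opens(1) N1])
  define p where "p = (\<lambda>j. partial j (G i0) P)"
  define b where "b = (\<lambda>i. partial j0 (G' i) P')"
  have partial_G: "partial j (G i) P = (if j = j0 then 0 else partial j (G' i) P') + b i * p j" if "i \<in> I" for i j
  proof -
    have "partial j (G i) P = partial j (\<lambda>Q. G' i (Q(j0 := G i0 Q))) P"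
      by (rule partial_cong[OF opens(1) \<open>P \<in> N1\<close>]) (use a in \<open>simp add: G'_def\<close>)
    also have "\<dots> = (if j = j0 then 0 else partial j (G' i) P') + b i * p j"
      unfolding b_def p_def P'_def
      by (rule partial_compose_update[OF opens smooth0 smooth'[OF that] _ \<open>P \<in> N1\<close>]) (use a in auto)
    finally show ?thesis .
  qed
  have "\<exists>\<sigma> N M S. bij_betw \<sigma> (J - {j0}) (I - {i0}) \<and> N \<subseteq> M1 \<and>
     local_diffeo (\<lambda>Q c. if c \<in> J - {j0} then G' (\<sigma> c) Q else Q c) P' N M S"
  proof (rule Suc.hyps(1))
    show "n = card (J - {j0})" using Suc.hyps(2) j0(1) Suc.prems(1) by simp
    show "finite (J - {j0})" "finite (I - {i0})" using Suc.prems by simp_all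
    show "card (I - {i0}) = card (J - {j0})" using Suc.prems(1-3) i0 j0(1) by simp
    show "open M1" "P' \<in> M1" by fact+
    show "smooth_fun_on M1 (G' i)" if "i \<in> I - {i0}" for i using smooth' that by simp
    show "\<forall>a. (\<forall>j\<in>J - {j0}. (\<Sum>i\<in>I - {i0}. a i * partial j (G' i) P') = 0) \<longrightarrow> (\<forall>i\<in>I - {i0}. a i = 0)"
    proof (intro allI impI ballI)
      fix a :: "'i \<Rightarrow> real" and i1
      assume a0: "\<forall>j\<in>J - {j0}. (\<Sum>i\<in>I - {i0}. a i * partial j (G' i) P') = 0" and i1: "i1 \<in> I - {i0}"
      define s where "s = (\<Sum>i\<in>I - {i0}. a i * b i)"
      define a' where "a' = (\<lambda>i. if i = i0 then - s else a i)"
      have "(\<Sum>i\<in>I. a' i * partial j (G i) P) = 0" if j: "j \<in> J" for j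
      proof -
        have "(\<Sum>i\<in>I. a' i * partial j (G i) P) = a' i0 * p j + (\<Sum>i\<in>I - {i0}. a' i * partial j (G i) P)"
          using sum.remove[OF Suc.prems(2) i0, of "\<lambda>i. a' i * partial j (G i) P"] by (simp add: p_def)
        also have "(\<Sum>i\<in>I - {i0}. a' i * partial j (G i) P) =
            (\<Sum>i\<in>I - {i0}. a i * (if j = j0 then 0 else partial j (G' i) P') + a i * b i * p j)"
          by (rule sum.cong) (simp_all add: a'_def partial_G algebra_simps)
        also have "\<dots> = (\<Sum>i\<in>I - {i0}. a i * (if j = j0 then 0 else partial j (G' i) P')) + s * p j"
          unfolding sum.distrib s_def sum_distrib_right ..
        also have "(\<Sum>i\<in>I - {i0}. a i * (if j = j0 then 0 else partial j (G' i) P')) = 0"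
          using a0 j by (cases "j = j0") simp_all
        finally show ?thesis by (simp add: a'_def)
      qed
      then have "\<forall>j\<in>J. (\<Sum>i\<in>I. a' i * partial j (G i) P) = 0" by simp
      from bspec[OF nonsing[THEN spec, THEN mp, OF this], of i1] i1 have "a' i1 = 0" by simp
      then show "a i1 = 0" using i1 by (simp add: a'_def)
    qed
  qed
  then obtain \<sigma> N2 M2 S2 where \<sigma>: "bij_betw \<sigma> (J - {j0}) (I - {i0})"
    and T2: "local_diffeo (\<lambda>Q c. if c \<in> J - {j0} then G' (\<sigma> c) Q else Q c) P' N2 M2 S2"
    by (elim exE conjE)
  define \<sigma>' where "\<sigma>' = \<sigma>(j0 := i0)"
  have "bij_betw \<sigma>' (J - {j0}) (I - {i0})"
    using \<sigma> by (subst bij_betw_cong[of _ _ \<sigma>]) (simp_all add: \<sigma>'_def)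
  then have "bij_betw \<sigma>' ((J - {j0}) \<union> {j0}) ((I - {i0}) \<union> {\<sigma>' j0})"
    by (intro notIn_Un_bij_betw) (simp_all add: \<sigma>'_def)
  moreover have "(J - {j0}) \<union> {j0} = J" "(I - {i0}) \<union> {\<sigma>' j0} = I"
    using i0 j0(1) by (auto simp: \<sigma>'_def)
  ultimately have bij: "bij_betw \<sigma>' J I" by simp
  let ?N = "{Q \<in> N1. Q(j0 := G i0 Q) \<in> N2}"
  have "local_diffeo (\<lambda>Q c. if c \<in> J then G (\<sigma>' c) Q else Q c) P ?N {R \<in> M2. S2 R \<in> M1} (\<lambda>R. S1 (S2 R))"
  proof (rule local_diffeo_cong[OF local_diffeo_compose[OF T1 T2[unfolded P'_def]]], rule ext)
    fix Q c assume Q: "Q \<in> ?N"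
    have "S1 (Q(j0 := G i0 Q)) = Q" using a Q by simp
    then show "(if c \<in> J - {j0} then G' (\<sigma> c) (Q(j0 := G i0 Q)) else (Q(j0 := G i0 Q)) c) =
        (if c \<in> J then G (\<sigma>' c) Q else Q c)"
      using j0(1) by (simp add: G'_def \<sigma>'_def)
  qed
  moreover have "?N \<subseteq> D" using N1 by auto
  ultimately show ?case using bij by blast
qed

section \<open>Inverting a map of diffieties coordinate by coordinate\<close>

locale diffiety_map =
  fixes D :: "('c \<Rightarrow> real) set" and v :: "('c \<Rightarrow> real) \<Rightarrow> 'c \<Rightarrow> real"
    and w :: "('d \<Rightarrow> real) \<Rightarrow> 'd \<Rightarrow> real" and \<phi> :: "('c \<Rightarrow> real) \<Rightarrow> 'd \<Rightarrow> real" and P :: "'c \<Rightarrow> real"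
  assumes open_D: "open D" and P_D: "P \<in> D"
    and smooth_v: "smooth_map_on D v" and smooth_w: "smooth_map_on UNIV w"
    and smooth_\<phi>: "smooth_map_on D \<phi>"
    and compat: "\<And>Q d. Q \<in> D \<Longrightarrow> derivation v (\<lambda>q. \<phi> q d) Q = w (\<phi> Q) d"
begin

text \<open>
  The set \<open>K\<close> collects the coordinates that are already expressed through \<open>\<phi>\<close>, and \<open>L\<close> those whose
  differential equation these expressions satisfy. The remaining components of \<open>\<psi>\<close> are dummies;
  \<open>\<psi> (\<phi> P) = P\<close> is required for them too, so that the next equations can be solved near \<open>P\<close>.
\<close>
definition partial_inverse :: "'c set \<Rightarrow> 'c set \<Rightarrow> ('d \<Rightarrow> real) set \<Rightarrow> (('d \<Rightarrow> real) \<Rightarrow> 'c \<Rightarrow> real) \<Rightarrow> bool" where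
  "partial_inverse K L W \<psi> \<longleftrightarrow>
     cylinder_open W \<and> smooth_map_on W \<psi> \<and> \<psi> ` W \<subseteq> D \<and> \<psi> (\<phi> P) = P \<and>
     (\<exists>N. open N \<and> P \<in> N \<and> N \<subseteq> D \<and> (\<forall>Q\<in>N. \<phi> Q \<in> W \<and> (\<forall>c\<in>K. \<psi> (\<phi> Q) c = Q c))) \<and>
     (\<forall>c\<in>L. \<forall>\<zeta>\<in>W. derivation w (\<lambda>\<zeta>. \<psi> \<zeta> c) \<zeta> = v (\<psi> \<zeta>) c)"

lemma derivation_\<phi>:
  assumes "open N" "N \<subseteq> D" "open W" "\<phi> ` N \<subseteq> W" "smooth_fun_on W g" "Q \<in> N"
  shows "derivation v (\<lambda>q. g (\<phi> q)) Q = derivation w g (\<phi> Q)"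
  by (rule derivation_compose[OF assms(1,3,4) smooth_map_on_subset[OF smooth_\<phi> open_D assms(1,2)] assms(5,6)])
     (rule compat, use assms(2,6) in auto)

text \<open>
  New coordinates \<open>J\<close> are recovered by solving the equations \<open>v\<^sub>i = D \<psi>\<^sub>i\<close>, \<open>i \<in> I\<close>, for them. Both sides of
  these equations are available: \<open>\<psi>\<^sub>i\<close> is already known, and apart from \<open>J\<close> only known coordinates occur
  in \<open>v\<^sub>i\<close>. The compatibility of \<open>\<psi>\<close> with the derivations on \<open>I\<close> then holds by construction, and no
  derivative of the implicitly defined functions has to be computed.
\<close>
lemma partial_inverse_step:
  assumes \<psi>: "partial_inverse K L W \<psi>"
    and fin: "finite J" "finite I" "card I = card J" and sub: "I \<subseteq> K" "L \<subseteq> K" "J \<inter> K = {}"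
    and depI: "\<And>i Q R. i \<in> I \<Longrightarrow> Q \<in> D \<Longrightarrow> R \<in> D \<Longrightarrow> (\<And>c. c \<in> K \<union> J \<Longrightarrow> Q c = R c) \<Longrightarrow> v Q i = v R i"
    and depL: "\<And>l Q R. l \<in> L \<Longrightarrow> Q \<in> D \<Longrightarrow> R \<in> D \<Longrightarrow> (\<And>c. c \<in> K \<Longrightarrow> Q c = R c) \<Longrightarrow> v Q l = v R l"
    and nonsing: "\<forall>a. (\<forall>j\<in>J. (\<Sum>i\<in>I. a i * partial j (\<lambda>Q. v Q i) P) = 0) \<longrightarrow> (\<forall>i\<in>I. a i = 0)"
  shows "\<exists>W' \<psi>'. partial_inverse (K \<union> J) (L \<union> I) W' \<psi>' \<and> (\<forall>\<zeta>\<in>W'. \<zeta> \<in> W \<and> (\<forall>c\<in>K. \<psi>' \<zeta> c = \<psi> \<zeta> c))"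
proof -
  obtain N where cyl_W: "cylinder_open W" and smooth_\<psi>: "smooth_map_on W \<psi>" and \<psi>_D: "\<psi> ` W \<subseteq> D"
    and \<psi>_P: "\<psi> (\<phi> P) = P" and N: "open N" "P \<in> N" "N \<subseteq> D"
    and N_W: "\<And>Q. Q \<in> N \<Longrightarrow> \<phi> Q \<in> W" and inv: "\<And>Q c. Q \<in> N \<Longrightarrow> c \<in> K \<Longrightarrow> \<psi> (\<phi> Q) c = Q c"
    and L: "\<And>c \<zeta>. c \<in> L \<Longrightarrow> \<zeta> \<in> W \<Longrightarrow> derivation w (\<lambda>\<zeta>. \<psi> \<zeta> c) \<zeta> = v (\<psi> \<zeta>) c"
    using \<psi> unfolding partial_inverse_def by (elim conjE exE) metis
  have open_W: "open W" by (rule cylinder_openD[OF cyl_W])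
  have smooth_vi: "smooth_fun_on D (\<lambda>Q. v Q i)" for i by (rule smooth_map_compD[OF smooth_v])
  have smooth_w': "smooth_map_on W w" by (rule smooth_map_on_subset[OF smooth_w open_UNIV open_W]) simp
  have "\<exists>\<sigma> N M S. bij_betw \<sigma> J I \<and> N \<subseteq> D \<and>
     local_diffeo (\<lambda>Q c. if c \<in> J then v Q (\<sigma> c) else Q c) P N M S"
    by (rule local_diffeo_family[of J I D P "\<lambda>i Q. v Q i", OF fin open_D P_D smooth_vi nonsing])
  then obtain \<sigma> N0 M S where \<sigma>: "bij_betw \<sigma> J I" and N0: "N0 \<subseteq> D"
    and T: "local_diffeo (\<lambda>Q c. if c \<in> J then v Q (\<sigma> c) else Q c) P N0 M S"
    by (elim exE conjE)
  define T where "T = (\<lambda>Q c. if c \<in> J then v Q (\<sigma> c) else Q c)"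
  note t = T[folded T_def, unfolded local_diffeo_def]
  have \<sigma>_I: "\<sigma> j \<in> I" if "j \<in> J" for j using \<sigma> that by (auto simp: bij_betw_def)
  define m where "m = (\<lambda>\<zeta> c. if c \<in> J then derivation w (\<lambda>\<zeta>. \<psi> \<zeta> (\<sigma> c)) \<zeta> else \<psi> \<zeta> c)"
  have smooth_m: "smooth_map_on W m"
    unfolding m_def
    by (intro smooth_map_replace smooth_derivation open_W smooth_w' smooth_map_compD[OF smooth_\<psi>])
  define W' where "W' = {\<zeta> \<in> W. m \<zeta> \<in> M}"
  define \<psi>' where "\<psi>' = (\<lambda>\<zeta>. S (m \<zeta>))"
  have cyl_W': "cylinder_open W'"
    unfolding W'_def using t by (intro cylinder_open_preimage cyl_W smooth_m) simp
  have open_W': "open W'" by (rule cylinder_openD[OF cyl_W'])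
  have smooth_\<psi>': "smooth_map_on W' \<psi>'"
    unfolding \<psi>'_def
  proof (rule smooth_map_compose[of W' M m S, OF open_W'])
    show "open M" "smooth_map_on M S" using t by (simp_all add: cylinder_openD)
    show "m ` W' \<subseteq> M" by (auto simp: W'_def)
    show "smooth_map_on W' m" by (rule smooth_map_on_subset[OF smooth_m open_W open_W']) (auto simp: W'_def)
  qed
  have \<psi>'_N0: "\<psi>' \<zeta> \<in> N0" and T_\<psi>': "T (\<psi>' \<zeta>) = m \<zeta>" if "\<zeta> \<in> W'" for \<zeta>
    using that t by (auto simp: W'_def \<psi>'_def)
  have \<psi>'_D: "\<psi>' \<zeta> \<in> D" if "\<zeta> \<in> W'" for \<zeta> using \<psi>'_N0[OF that] N0 by blast
  have \<psi>'_old: "\<psi>' \<zeta> c = \<psi> \<zeta> c" if "\<zeta> \<in> W'" "c \<notin> J" for \<zeta> c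
    using fun_cong[OF T_\<psi>'[OF that(1)], of c] that(2) by (simp add: T_def m_def)
  have \<psi>'_new: "v (\<psi>' \<zeta>) (\<sigma> j) = derivation w (\<lambda>\<zeta>. \<psi> \<zeta> (\<sigma> j)) \<zeta>" if "\<zeta> \<in> W'" "j \<in> J" for \<zeta> j
    using fun_cong[OF T_\<psi>'[OF that(1)], of j] that(2) by (simp add: T_def m_def)
  have D_old: "derivation w (\<lambda>\<zeta>. \<psi>' \<zeta> c) \<zeta> = derivation w (\<lambda>\<zeta>. \<psi> \<zeta> c) \<zeta>" if "\<zeta> \<in> W'" "c \<notin> J" for \<zeta> c
    by (rule derivation_cong[OF open_W' that(1)]) (rule \<psi>'_old[OF _ that(2)])
  have m_\<phi>: "m (\<phi> Q) c = (if c \<in> J then v Q (\<sigma> c) else \<psi> (\<phi> Q) c)" if Q: "Q \<in> N" for Q c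
  proof (cases "c \<in> J")
    case True
    have \<sigma>K: "\<sigma> c \<in> K" using \<sigma>_I[OF True] sub(1) by blast
    have "derivation w (\<lambda>\<zeta>. \<psi> \<zeta> (\<sigma> c)) (\<phi> Q) = derivation v (\<lambda>q. \<psi> (\<phi> q) (\<sigma> c)) Q"
      by (rule derivation_\<phi>[OF N(1,3) open_W _ smooth_map_compD[OF smooth_\<psi>] Q, symmetric]) (use N_W in auto)
    also have "\<dots> = derivation v (\<lambda>q. q (\<sigma> c)) Q"
      by (rule derivation_cong[OF N(1) Q]) (rule inv[OF _ \<sigma>K])
    also have "\<dots> = v Q (\<sigma> c)" by (rule derivation_coord)
    finally show ?thesis using True by (simp add: m_def)
  next
    case False
    then show ?thesis by (simp add: m_def)
  qed
  have "m (\<phi> P) = T P"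
    by (rule ext) (simp add: m_\<phi>[OF N(2)] T_def \<psi>_P)
  then have \<psi>'_P: "\<psi>' (\<phi> P) = P" using t by (simp add: \<psi>'_def)

  \<comment> \<open>the point with the coordinates of \<open>Q\<close> on \<open>J\<close> and those of \<open>\<psi> (\<phi> Q)\<close> elsewhere is \<open>\<psi>' (\<phi> Q)\<close>\<close>
  define E where "E = (\<lambda>Q c. if c \<in> J then Q c else \<psi> (\<phi> Q) c)"
  have E_P: "E P = P" by (rule ext) (simp add: E_def \<psi>_P)
  have "smooth_map_on N (\<lambda>Q. \<psi> (\<phi> Q))"
    by (rule smooth_map_compose[OF N(1) open_W _ smooth_\<psi> smooth_map_on_subset[OF smooth_\<phi> open_D N(1,3)]])
       (use N_W in auto)
  then have smooth_E: "smooth_map_on N E"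
    unfolding E_def by (intro smooth_map_replace smooth_coord N(1)) (rule smooth_map_compD)
  define N' where "N' = {Q \<in> N. E Q \<in> N0}"
  have "open (E -` N0 \<inter> N)"
    using continuous_on_open_vimage[OF N(1)] smooth_map_on_continuous[OF smooth_E] cylinder_openD[of N0] t by blast
  moreover have "E -` N0 \<inter> N = N'" by (auto simp: N'_def)
  ultimately have open_N': "open N'" by simp
  have P_N': "P \<in> N'" using N(2) E_P t by (simp add: N'_def)
  have near: "\<phi> Q \<in> W' \<and> (\<forall>c\<in>K \<union> J. \<psi>' (\<phi> Q) c = Q c)" if Q': "Q \<in> N'" for Q
  proof -
    have Q: "Q \<in> N" and EQ: "E Q \<in> N0" using Q' by (simp_all add: N'_def)
    have QD: "Q \<in> D" "E Q \<in> D" using Q N(3) EQ N0 by auto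
    have E_eq: "E Q c = Q c" if "c \<in> K \<union> J" for c
      using that inv[OF Q] sub(3) by (auto simp: E_def)
    have "T (E Q) = m (\<phi> Q)"
    proof (rule ext)
      fix c
      show "T (E Q) c = m (\<phi> Q) c"
      proof (cases "c \<in> J")
        case True
        have "v (E Q) (\<sigma> c) = v Q (\<sigma> c)"
          by (rule depI[OF \<sigma>_I[OF True] QD(2,1) E_eq])
        then show ?thesis using True m_\<phi>[OF Q] by (simp add: T_def)
      next
        case False
        then show ?thesis using m_\<phi>[OF Q] by (simp add: T_def E_def)
      qed
    qed
    moreover have "T (E Q) \<in> M" "S (T (E Q)) = E Q" using t EQ by auto
    ultimately have "m (\<phi> Q) \<in> M" "\<psi>' (\<phi> Q) = E Q" by (simp_all add: \<psi>'_def)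
    then show ?thesis using N_W[OF Q] E_eq by (simp add: W'_def)
  qed
  have compat': "derivation w (\<lambda>\<zeta>. \<psi>' \<zeta> c) \<zeta> = v (\<psi>' \<zeta>) c" if c: "c \<in> L \<union> I" and \<zeta>: "\<zeta> \<in> W'" for c \<zeta>
  proof (cases "c \<in> I")
    case True
    then obtain j where j: "j \<in> J" "c = \<sigma> j" using \<sigma> by (auto simp: bij_betw_def)
    have "c \<notin> J" using True sub by blast
    then show ?thesis using D_old[OF \<zeta>] \<psi>'_new[OF \<zeta> j(1)] j(2) by simp
  next
    case False
    then have "c \<in> L" using c by simp
    have "c \<notin> J" using \<open>c \<in> L\<close> sub by blast
    have \<zeta>W: "\<zeta> \<in> W" using \<zeta> by (simp add: W'_def)
    have "v (\<psi> \<zeta>) c = v (\<psi>' \<zeta>) c"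
    proof (rule depL[OF \<open>c \<in> L\<close> _ \<psi>'_D[OF \<zeta>]])
      show "\<psi> \<zeta> \<in> D" using \<psi>_D \<zeta>W by blast
      show "\<psi> \<zeta> c' = \<psi>' \<zeta> c'" if "c' \<in> K" for c'
        by (rule \<psi>'_old[OF \<zeta>, symmetric]) (use that sub(3) in blast)
    qed
    then show ?thesis using D_old[OF \<zeta> \<open>c \<notin> J\<close>] L[OF \<open>c \<in> L\<close> \<zeta>W] by simp
  qed
  have "N' \<subseteq> D" using N(3) by (auto simp: N'_def)
  have "partial_inverse (K \<union> J) (L \<union> I) W' \<psi>'"
    unfolding partial_inverse_def
    using cyl_W' smooth_\<psi>' \<psi>'_D \<psi>'_P open_N' P_N' \<open>N' \<subseteq> D\<close> near compat'
    by (intro conjI exI[of _ N'] ballI) (simp_all add: image_subset_iff)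
  moreover have "\<zeta> \<in> W \<and> (\<forall>c\<in>K. \<psi>' \<zeta> c = \<psi> \<zeta> c)" if "\<zeta> \<in> W'" for \<zeta>
    using that \<psi>'_old[OF that] sub(3) by (auto simp: W'_def)
  ultimately show ?thesis by (intro exI[of _ W'] exI[of _ \<psi>'] conjI ballI) simp_all
qed

text \<open>
  A cylinder \<open>U\<close> around \<open>P\<close> on which \<open>\<psi> \<circ> \<phi>\<close> is the identity is mapped onto \<open>\<psi>\<^sup>-\<^sup>1(U)\<close>, and this is again a
  cylinder because every component of \<open>\<psi>\<close> depends on finitely many coordinates.
\<close>
lemma flat_chart_of_inverse:
  assumes \<psi>: "partial_inverse UNIV UNIV W \<psi>" and right: "\<And>\<zeta>. \<zeta> \<in> W \<Longrightarrow> \<phi> (\<psi> \<zeta>) = \<zeta>"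
  shows "\<exists>U V. cylinder_open U \<and> U \<subseteq> D \<and> P \<in> U \<and> cylinder_open V \<and> diffiety_iso v U w V \<phi>"
proof -
  obtain N where cyl_W: "cylinder_open W" and smooth_\<psi>: "smooth_map_on W \<psi>"
    and N: "open N" "P \<in> N" "N \<subseteq> D"
    and N_W: "\<And>Q. Q \<in> N \<Longrightarrow> \<phi> Q \<in> W" and inv: "\<And>Q c. Q \<in> N \<Longrightarrow> \<psi> (\<phi> Q) c = Q c"
    using \<psi> unfolding partial_inverse_def by (elim conjE exE) (metis UNIV_I)
  have left: "\<psi> (\<phi> Q) = Q" if "Q \<in> N" for Q by (rule ext) (rule inv[OF that])
  obtain U where U: "cylinder_open U" "P \<in> U" "U \<subseteq> N"
    using open_contains_cylinder_open[OF N(1,2)] by blast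
  define V where "V = {\<zeta> \<in> W. \<psi> \<zeta> \<in> U}"
  have cyl_V: "cylinder_open V" unfolding V_def by (rule cylinder_open_preimage[OF cyl_W U(1) smooth_\<psi>])
  have opens: "open U" "open V" "open W" by (intro cylinder_openD U(1) cyl_V cyl_W)+
  have UV: "\<phi> Q \<in> V" if "Q \<in> U" for Q
    using that U(3) N_W left by (auto simp: V_def)
  have bij: "bij_betw \<phi> U V"
    by (rule bij_betw_byWitness[of U \<psi> \<phi> V]) (use UV U(3) left right in \<open>auto simp: V_def\<close>)
  have inv_eq: "inv_into U \<phi> \<zeta> = \<psi> \<zeta>" if "\<zeta> \<in> V" for \<zeta>
  proof -
    have "\<psi> \<zeta> \<in> U" "\<phi> (\<psi> \<zeta>) = \<zeta>" using that right by (simp_all add: V_def)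
    then show ?thesis using inv_into_f_f[OF bij_betw_imp_inj_on[OF bij], of "\<psi> \<zeta>"] by simp
  qed
  have "smooth_map_on V (inv_into U \<phi>)"
    using smooth_map_on_cong[OF opens(2) inv_eq] smooth_map_on_subset[OF smooth_\<psi> opens(3,2)] by (auto simp: V_def)
  moreover have "smooth_map_on U \<phi>"
    by (rule smooth_map_on_subset[OF smooth_\<phi> open_D opens(1)]) (use U(3) N(3) in auto)
  moreover have "derivation v (\<lambda>q. g (\<phi> q)) p = derivation w g (\<phi> p)" if "smooth_fun_on V g" "p \<in> U" for g p
    by (rule derivation_\<phi>[OF opens(1) _ opens(2) _ that]) (use U(3) N(3) UV in auto)
  ultimately have "diffiety_iso v U w V \<phi>" unfolding diffiety_iso_def using bij by simp
  then show ?thesis using U N(3) cyl_V by (intro exI[of _ U] exI[of _ V]) auto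
qed

end

section \<open>Jet prolongation of a flat output\<close>

definition jet_prolongation ::
    "(('c \<Rightarrow> real) \<Rightarrow> 'c \<Rightarrow> real) \<Rightarrow> (('c \<Rightarrow> real) \<Rightarrow> real) \<Rightarrow> ('n \<Rightarrow> ('c \<Rightarrow> real) \<Rightarrow> real) \<Rightarrow>
     ('c \<Rightarrow> real) \<Rightarrow> 'n jet_coord \<Rightarrow> real" where
  "jet_prolongation v \<tau> z Q d =
     (case d of Jet_time \<Rightarrow> \<tau> Q | Zeta i k \<Rightarrow> (derivation v ^^ k) (z i) Q)"

lemma smooth_derivation_funpow:
  assumes "open U" "smooth_map_on U v" "smooth_fun_on U f"
  shows "smooth_fun_on U ((derivation v ^^ k) f)"
  by (induction k) (simp_all add: assms smooth_derivation)

lemma smooth_jet_prolongation: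
  assumes "open U" "smooth_map_on U v" "smooth_fun_on U \<tau>" "\<And>i. smooth_fun_on U (z i)"
  shows "smooth_map_on U (jet_prolongation v \<tau> z)"
proof (rule smooth_map_onI)
  fix d :: "'b jet_coord"
  show "smooth_fun_on U (\<lambda>Q. jet_prolongation v \<tau> z Q d)"
    by (cases d) (simp_all add: jet_prolongation_def assms(3) smooth_derivation_funpow[OF assms(1,2,4)])
qed

lemma derivation_jet_prolongation:
  assumes "derivation v \<tau> Q = 1"
  shows "derivation v (\<lambda>q. jet_prolongation v \<tau> z q d) Q = jet_field (jet_prolongation v \<tau> z Q) d"
  by (cases d) (simp_all add: jet_prolongation_def assms)

lemma smooth_jet_field: "smooth_map_on UNIV jet_field"
proof (rule smooth_map_onI)
  fix d :: "'n jet_coord"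
  show "smooth_fun_on UNIV (\<lambda>\<zeta>. jet_field \<zeta> d)"
    by (cases d) (simp_all add: smooth_const smooth_coord)
qed

text \<open>
  Since \<open>\<phi> \<circ> \<psi>\<close> respects the derivations, differentiating \<open>k\<close> times the equation for the undifferentiated
  jet coordinates gives the equation for those of order \<open>k\<close>.
\<close>
lemma jet_right_inverse:
  assumes map: "diffiety_map D v jet_field \<phi> P"
    and \<psi>: "diffiety_map.partial_inverse D v jet_field \<phi> P UNIV UNIV W \<psi>"
    and time: "\<And>\<zeta>. \<zeta> \<in> W \<Longrightarrow> \<phi> (\<psi> \<zeta>) Jet_time = \<zeta> Jet_time"
    and zero: "\<And>\<zeta> i. \<zeta> \<in> W \<Longrightarrow> \<phi> (\<psi> \<zeta>) (Zeta i 0) = \<zeta> (Zeta i 0)"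
    and "\<zeta> \<in> W"
  shows "\<phi> (\<psi> \<zeta>) = \<zeta>"
proof -
  interpret diffiety_map D v jet_field \<phi> P by (rule map)
  have cyl_W: "cylinder_open W" and smooth_\<psi>: "smooth_map_on W \<psi>" and \<psi>_D: "\<psi> ` W \<subseteq> D"
    and compat': "\<And>c \<zeta>. \<zeta> \<in> W \<Longrightarrow> derivation jet_field (\<lambda>\<zeta>. \<psi> \<zeta> c) \<zeta> = v (\<psi> \<zeta>) c"
    using \<psi> unfolding partial_inverse_def by simp_all
  have open_W: "open W" by (rule cylinder_openD[OF cyl_W])
  have Zeta: "\<forall>\<zeta>\<in>W. \<phi> (\<psi> \<zeta>) (Zeta i k) = \<zeta> (Zeta i k)" for i k
  proof (induction k)
    case 0
    show ?case using zero by blast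
  next
    case (Suc k)
    show ?case
    proof
      fix \<zeta> assume \<zeta>: "\<zeta> \<in> W"
      have \<psi>\<zeta>: "\<psi> \<zeta> \<in> D" using \<zeta> \<psi>_D by blast
      have "\<phi> (\<psi> \<zeta>) (Zeta i (Suc k)) = derivation v (\<lambda>q. \<phi> q (Zeta i k)) (\<psi> \<zeta>)"
        using compat[OF \<psi>\<zeta>, of "Zeta i k"] by simp
      also have "\<dots> = derivation jet_field (\<lambda>\<zeta>. \<phi> (\<psi> \<zeta>) (Zeta i k)) \<zeta>"
        by (rule derivation_compose[OF open_W open_D \<psi>_D smooth_\<psi> smooth_map_compD[OF smooth_\<phi>] \<zeta>, symmetric])
           (rule compat'[OF \<zeta>])
      also have "\<dots> = derivation jet_field (\<lambda>\<zeta>. \<zeta> (Zeta i k)) \<zeta>"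
        by (rule derivation_cong[OF open_W \<zeta>]) (rule bspec[OF Suc])
      also have "\<dots> = \<zeta> (Zeta i (Suc k))" by (simp add: derivation_coord)
      finally show "\<phi> (\<psi> \<zeta>) (Zeta i (Suc k)) = \<zeta> (Zeta i (Suc k))" .
    qed
  qed
  show ?thesis
  proof (rule ext)
    fix d
    show "\<phi> (\<psi> \<zeta>) d = \<zeta> d"
      using time[OF \<open>\<zeta> \<in> W\<close>] Zeta \<open>\<zeta> \<in> W\<close> by (cases d) simp_all
  qed
qed

section \<open>Derivatives of the controls\<close>

definition base_coords :: "coord set" where
  "base_coords = {c. \<forall>u k. c \<noteq> Control u (Suc k)}"

text \<open>
  Once the states and the controls are expressed through \<open>\<phi>\<close>, their expressions extend to all
  derivatives \<open>u\<^sup>(\<^sup>k\<^sup>)\<close> of the controls by differentiating the expression for \<open>u\<close>.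
\<close>
lemma partial_inverse_controls:
  fixes v :: "point \<Rightarrow> coord \<Rightarrow> real"
  assumes map: "diffiety_map D v w \<phi> P"
    and shift: "\<And>Q u k. v Q (Control u k) = Q (Control u (Suc k))"
    and \<psi>: "diffiety_map.partial_inverse D v w \<phi> P base_coords (insert Time (range State)) W \<psi>"
    and depL: "\<And>l Q R. l \<in> insert Time (range State) \<Longrightarrow> Q \<in> D \<Longrightarrow> R \<in> D \<Longrightarrow>
        (\<And>c. c \<in> base_coords \<Longrightarrow> Q c = R c) \<Longrightarrow> v Q l = v R l"
    and depD: "\<And>Q R. Q \<in> D \<Longrightarrow> (\<And>c. c \<in> base_coords \<Longrightarrow> Q c = R c) \<Longrightarrow> R \<in> D"
  shows "\<exists>\<psi>'. diffiety_map.partial_inverse D v w \<phi> P UNIV UNIV W \<psi>' \<and>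
     (\<forall>\<zeta>\<in>W. \<forall>c\<in>base_coords. \<psi>' \<zeta> c = \<psi> \<zeta> c)"
proof -
  interpret diffiety_map D v w \<phi> P by (rule map)
  obtain N where cyl_W: "cylinder_open W" and smooth_\<psi>: "smooth_map_on W \<psi>" and \<psi>_D: "\<psi> ` W \<subseteq> D"
    and \<psi>_P: "\<psi> (\<phi> P) = P" and N: "open N" "P \<in> N" "N \<subseteq> D"
    and N_W: "\<And>Q. Q \<in> N \<Longrightarrow> \<phi> Q \<in> W" and inv: "\<And>Q c. Q \<in> N \<Longrightarrow> c \<in> base_coords \<Longrightarrow> \<psi> (\<phi> Q) c = Q c"
    and L: "\<And>c \<zeta>. c \<in> insert Time (range State) \<Longrightarrow> \<zeta> \<in> W \<Longrightarrow> derivation w (\<lambda>\<zeta>. \<psi> \<zeta> c) \<zeta> = v (\<psi> \<zeta>) c"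
    using \<psi> unfolding partial_inverse_def by (elim conjE exE) metis
  have open_W: "open W" by (rule cylinder_openD[OF cyl_W])
  have smooth_w': "smooth_map_on W w" by (rule smooth_map_on_subset[OF smooth_w open_UNIV open_W]) simp
  define ext where "ext = (\<lambda>u k. (derivation w ^^ k) (\<lambda>\<zeta>. \<psi> \<zeta> (Control u 0)))"
  define \<psi>' where "\<psi>' = (\<lambda>\<zeta> c. case c of Control u k \<Rightarrow> ext u k \<zeta> | _ \<Rightarrow> \<psi> \<zeta> c)"
  have \<psi>'_base: "\<psi>' \<zeta> c = \<psi> \<zeta> c" if "c \<in> base_coords" for \<zeta> c
  proof (cases c)
    case (Control u k)
    then show ?thesis using that by (cases k) (simp_all add: \<psi>'_def ext_def base_coords_def)
  qed (simp_all add: \<psi>'_def)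
  have \<psi>'_L: "(\<lambda>\<zeta>. \<psi>' \<zeta> c) = (\<lambda>\<zeta>. \<psi> \<zeta> c)" if "c \<in> insert Time (range State)" for c
    using that by (auto simp: \<psi>'_def)
  have smooth_ext: "smooth_fun_on W (ext u k)" for u k
    unfolding ext_def by (rule smooth_derivation_funpow[OF open_W smooth_w' smooth_map_compD[OF smooth_\<psi>]])
  have smooth_\<psi>': "smooth_map_on W \<psi>'"
  proof (rule smooth_map_onI)
    fix c
    show "smooth_fun_on W (\<lambda>\<zeta>. \<psi>' \<zeta> c)"
      by (cases c) (simp_all add: \<psi>'_def smooth_ext smooth_map_compD[OF smooth_\<psi>])
  qed
  have \<psi>'_D: "\<psi>' \<zeta> \<in> D" if "\<zeta> \<in> W" for \<zeta>
  proof (rule depD)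
    show "\<psi> \<zeta> \<in> D" using that \<psi>_D by blast
    show "\<psi> \<zeta> c = \<psi>' \<zeta> c" if "c \<in> base_coords" for c by (rule \<psi>'_base[OF that, symmetric])
  qed
  have ext: "\<forall>Q\<in>N. ext u k (\<phi> Q) = Q (Control u k)" for u k
  proof (induction k)
    case 0
    show ?case using inv by (simp add: ext_def base_coords_def)
  next
    case (Suc k)
    show ?case
    proof
      fix Q assume Q: "Q \<in> N"
      have "ext u (Suc k) (\<phi> Q) = derivation w (ext u k) (\<phi> Q)" by (simp add: ext_def)
      also have "\<dots> = derivation v (\<lambda>q. ext u k (\<phi> q)) Q"
        by (rule derivation_\<phi>[OF N(1,3) open_W _ smooth_ext Q, symmetric]) (use N_W in auto)
      also have "\<dots> = derivation v (\<lambda>q. q (Control u k)) Q"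
        by (rule derivation_cong[OF N(1) Q]) (rule bspec[OF Suc])
      also have "\<dots> = Q (Control u (Suc k))" by (simp add: derivation_coord shift)
      finally show "ext u (Suc k) (\<phi> Q) = Q (Control u (Suc k))" .
    qed
  qed
  have inv': "\<psi>' (\<phi> Q) c = Q c" if "Q \<in> N" for Q c
  proof (cases c)
    case (Control u k)
    then show ?thesis using ext that by (simp add: \<psi>'_def)
  qed (use inv[OF that, of c] in \<open>simp_all add: \<psi>'_def base_coords_def\<close>)
  have "\<psi>' (\<phi> P) = P" by (rule HOL.ext) (rule inv'[OF N(2)])
  moreover have "derivation w (\<lambda>\<zeta>. \<psi>' \<zeta> c) \<zeta> = v (\<psi>' \<zeta>) c" if \<zeta>: "\<zeta> \<in> W" for c \<zeta>
  proof (cases "c \<in> insert Time (range State)")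
    case True
    have "v (\<psi> \<zeta>) c = v (\<psi>' \<zeta>) c"
    proof (rule depL[OF True _ \<psi>'_D[OF \<zeta>]])
      show "\<psi> \<zeta> \<in> D" using \<zeta> \<psi>_D by blast
      show "\<psi> \<zeta> c = \<psi>' \<zeta> c" if "c \<in> base_coords" for c by (rule \<psi>'_base[OF that, symmetric])
    qed
    then show ?thesis using L[OF True \<zeta>] \<psi>'_L[OF True] by simp
  next
    case False
    then obtain u k where c: "c = Control u k" by (cases c) auto
    have "(\<lambda>\<zeta>. \<psi>' \<zeta> c) = ext u k" by (simp add: \<psi>'_def c)
    then show ?thesis by (simp add: c shift \<psi>'_def ext_def)
  qed
  ultimately have "partial_inverse UNIV UNIV W \<psi>'"
    unfolding partial_inverse_def using cyl_W smooth_\<psi>' \<psi>'_D N N_W inv'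
    by (intro conjI exI[of _ N] ballI) (simp_all add: image_subset_iff)
  then show ?thesis using \<psi>'_base by blast
qed

section \<open>Nonsingular matrices\<close>

lemma left_kernel_trivial:
  fixes M :: "real^'n^'n"
  assumes "det M \<noteq> 0" "\<And>j. (\<Sum>i\<in>UNIV. b $ i * M $ i $ j) = 0"
  shows "b = 0"
proof -
  have "transpose M *v b = 0"
    using assms(2) by (simp add: vec_eq_iff matrix_vector_mult_def transpose_def mult.commute)
  moreover have "invertible (transpose M)" using assms(1) by (simp add: invertible_det_nz)
  ultimately show ?thesis
    by (metis invertible_left_inverse matrix_left_invertible_ker)
qed

lemma left_kernel_nontrivial:
  fixes M :: "real^'n^'n"
  assumes "det M = 0"
  obtains b where "b \<noteq> 0" "\<And>j. (\<Sum>i\<in>UNIV. b $ i * M $ i $ j) = 0"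
proof -
  have "\<not> invertible (transpose M)" using assms by (simp add: invertible_det_nz)
  then obtain b where "b \<noteq> 0" "transpose M *v b = 0"
    by (metis invertible_left_inverse matrix_left_invertible_ker)
  then show thesis
    using that[of b] by (simp add: vec_eq_iff matrix_vector_mult_def transpose_def mult.commute)
qed

lemma exists_3: "(\<exists>i::3. Q i) \<longleftrightarrow> Q 1 \<or> Q 2 \<or> Q 3"
  by (metis exhaust_3)

lemma drop_column_component:
  shows "l \<noteq> k \<Longrightarrow> \<exists>j. \<forall>i. drop_column M k $ i $ j = M $ i $ l"
    and "\<exists>l. l \<noteq> k \<and> (\<forall>i. drop_column M k $ i $ j = M $ i $ l)"
proof -
  have v: "(vector [a, b, c] :: 4^3) $ 1 = a" "(vector [a, b, c] :: 4^3) $ 2 = b" "(vector [a, b, c] :: 4^3) $ 3 = c"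
    for a b c by simp_all
  have num: "(1::4) \<noteq> 2" "(1::4) \<noteq> 3" "(1::4) \<noteq> 4" "(2::4) \<noteq> 3" "(2::4) \<noteq> 4" "(3::4) \<noteq> 4"
    by simp_all
  show "\<exists>j. \<forall>i. drop_column M k $ i $ j = M $ i $ l" if "l \<noteq> k"
    unfolding drop_column_def using that exhaust_4[of k] exhaust_4[of l] num
    by (elim disjE; simp add: exists_3)
  show "\<exists>l. l \<noteq> k \<and> (\<forall>i. drop_column M k $ i $ j = M $ i $ l)"
    unfolding drop_column_def using exhaust_4[of k] exhaust_3[of j] num
    by (elim disjE; simp; metis)
qed

text \<open>
  There is a nontrivial linear relation between the four columns; let \<open>k\<close> be a column that occurs in it.
  If the minor without column \<open>k\<close> vanished, a nonzero linear form would kill the other three columns,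
  by the relation also column \<open>k\<close>, and hence the whole range.
\<close>
lemma rank_3_imp_minor:
  fixes M :: "real^4^3"
  assumes "rank M = 3"
  shows "\<exists>k. det (drop_column M k) \<noteq> 0"
proof (rule ccontr)
  assume "\<not> ?thesis"
  then have sing: "det (drop_column M k) = 0" for k by simp
  have surj: "surj ((*v) M)" using assms full_rank_surjective[of M] by simp
  have "rank M \<noteq> CARD(4)" using assms by simp
  then obtain x where x: "x \<noteq> 0" "M *v x = 0"
    using matrix_nonfull_linear_equations_eq[of M] by blast
  then obtain k where k: "x $ k \<noteq> 0" by (auto simp: vec_eq_iff)
  obtain b where b: "b \<noteq> 0" "\<And>j. (\<Sum>i\<in>UNIV. b $ i * drop_column M k $ i $ j) = 0"
    using left_kernel_nontrivial[OF sing[of k]] by blast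
  have others: "(\<Sum>i\<in>UNIV. b $ i * M $ i $ l) = 0" if "l \<noteq> k" for l
  proof -
    obtain j where "\<forall>i. drop_column M k $ i $ j = M $ i $ l" using drop_column_component(1)[OF \<open>l \<noteq> k\<close>] by blast
    then show ?thesis using b(2)[of j] by simp
  qed
  have form: "b \<bullet> (M *v y) = (\<Sum>l\<in>UNIV. (\<Sum>i\<in>UNIV. b $ i * M $ i $ l) * y $ l)" for y
  proof -
    have "b \<bullet> (M *v y) = (\<Sum>i\<in>UNIV. \<Sum>l\<in>UNIV. b $ i * M $ i $ l * y $ l)"
      by (simp add: inner_vec_def matrix_vector_mult_def sum_distrib_left mult.assoc)
    also have "\<dots> = (\<Sum>l\<in>UNIV. \<Sum>i\<in>UNIV. b $ i * M $ i $ l * y $ l)" by (rule sum.swap)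
    finally show ?thesis by (simp add: sum_distrib_right)
  qed
  have form_k: "b \<bullet> (M *v y) = (\<Sum>i\<in>UNIV. b $ i * M $ i $ k) * y $ k" for y
  proof -
    let ?f = "\<lambda>l. (\<Sum>i\<in>UNIV. b $ i * M $ i $ l) * y $ l"
    have "sum ?f UNIV = ?f k + sum ?f (UNIV - {k})" by (rule sum.remove) simp_all
    also have "sum ?f (UNIV - {k}) = 0" by (rule sum.neutral) (simp add: others)
    finally show ?thesis unfolding form by simp
  qed
  define s where "s = (\<Sum>i\<in>UNIV. b $ i * M $ i $ k)"
  have "s * x $ k = 0"
    using form_k[of x] unfolding x(2) inner_zero_right s_def[symmetric] by (rule sym)
  then have "s = 0" using k by simp
  then have "b \<bullet> (M *v y) = 0" for y
    using form_k[of y] by (simp add: s_def)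
  moreover obtain y where "b = M *v y" using surj by (rule surjE)
  ultimately have "b \<bullet> b = 0" by simp
  then show False using b(1) by simp
qed

section \<open>Smoothness of the aircraft model\<close>

text \<open>The Jacobian that occurs in \<open>aircraft_dom\<close> is continuous on this larger set; this is how
  \<open>aircraft_dom\<close> is seen to be open.\<close>
definition coeff_dom :: "aircraft \<Rightarrow> point set" where
  "coeff_dom A = {P. P (State St_z) \<in> density_dom A \<and> force_args P \<in> force_dom A \<and>
     torque_args P \<in> torque_dom A}"

lemma open_coeff_dom:
  assumes "aircraft_model A"
  shows "open (coeff_dom A)"
proof -
  have "open ((\<lambda>P :: point. P (State St_z)) -` density_dom A)"
    using assms by (intro open_vimage continuous_coord) (simp add: aircraft_model_def)
  moreover have "open (force_args -` force_dom A)"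
    using assms by (intro open_vimage)
      (auto simp: aircraft_model_def force_args_def[abs_def] intro!: continuous_on_Pair continuous_coord)
  moreover have "open (torque_args -` torque_dom A)"
    using assms by (intro open_vimage)
      (auto simp: aircraft_model_def torque_args_def[abs_def] intro!: continuous_on_Pair continuous_coord)
  moreover have "coeff_dom A = (\<lambda>P. P (State St_z)) -` density_dom A \<inter> force_args -` force_dom A \<inter>
      torque_args -` torque_dom A"
    by (auto simp: coeff_dom_def)
  ultimately show ?thesis by auto
qed

text \<open>\<open>force_coord b\<close> and \<open>torque_coord b\<close> are the coordinates that the basis vector \<open>b\<close> of the argument
  space of the coefficients stands for.\<close>
definition force_coord :: "real \<times> real \<Rightarrow> coord" where
  "force_coord b = (if fst b \<noteq> 0 then State St_alpha else State St_beta)"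

definition torque_coord :: "real8 \<Rightarrow> coord" where
  "torque_coord = (\<lambda>(a, b, p, q, r, l, m, n).
     if a \<noteq> 0 then State St_alpha else if b \<noteq> 0 then State St_beta else if p \<noteq> 0 then State St_p
     else if q \<noteq> 0 then State St_q else if r \<noteq> 0 then State St_r else if l \<noteq> 0 then Control Ct_l 0
     else if m \<noteq> 0 then Control Ct_m 0 else Control Ct_n 0)"

lemma force_args_coords: "b \<in> Basis \<Longrightarrow> force_args P \<bullet> b = P (force_coord b)"
  by (auto simp: force_args_def force_coord_def Basis_prod_def)

lemma inj_force_coord: "inj_on force_coord Basis"
  by (auto simp: inj_on_def force_coord_def Basis_prod_def)

lemma torque_args_coords: "b \<in> Basis \<Longrightarrow> torque_args P \<bullet> b = P (torque_coord b)"
  by (auto simp: torque_args_def torque_coord_def Basis_prod_def zero_prod_def)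

lemma inj_torque_coord: "inj_on torque_coord Basis"
  by (auto simp: inj_on_def torque_coord_def Basis_prod_def zero_prod_def)

lemma smooth_coefficients:
  assumes "aircraft_model A" "open U" "U \<subseteq> coeff_dom A"
  shows "smooth_fun_on U (\<lambda>P. air_density A (P (State St_z)))"
    and "smooth_fun_on U (\<lambda>P. C_x A (force_args P))" "smooth_fun_on U (\<lambda>P. C_y A (force_args P))"
    and "smooth_fun_on U (\<lambda>P. C_z A (force_args P))"
    and "smooth_fun_on U (\<lambda>P. C_l A (torque_args P))" "smooth_fun_on U (\<lambda>P. C_m A (torque_args P))"
    and "smooth_fun_on U (\<lambda>P. C_n A (torque_args P))"
proof -
  have sub: "(\<lambda>P. P (State St_z)) ` U \<subseteq> density_dom A" "force_args ` U \<subseteq> force_dom A"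
    "torque_args ` U \<subseteq> torque_dom A" using assms(3) by (auto simp: coeff_dom_def)
  note a = assms(1)[unfolded aircraft_model_def]
  have "real_analytic_on (air_density A) (density_dom A)" using a by blast
  then show "smooth_fun_on U (\<lambda>P. air_density A (P (State St_z)))"
    by (rule smooth_analytic[OF _ assms(2) sub(1), where e = "\<lambda>_. State St_z"]) auto
  have force: "smooth_fun_on U (\<lambda>P. f (force_args P))" if "real_analytic_on f (force_dom A)" for f
    by (rule smooth_analytic[OF that assms(2) sub(2) force_args_coords inj_force_coord])
  show "smooth_fun_on U (\<lambda>P. C_x A (force_args P))" "smooth_fun_on U (\<lambda>P. C_y A (force_args P))"
    "smooth_fun_on U (\<lambda>P. C_z A (force_args P))"
    using a by (intro force; blast)+
  have torque: "smooth_fun_on U (\<lambda>P. f (torque_args P))" if "real_analytic_on f (torque_dom A)" for f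
    by (rule smooth_analytic[OF that assms(2) sub(3) torque_args_coords inj_torque_coord])
  show "smooth_fun_on U (\<lambda>P. C_l A (torque_args P))" "smooth_fun_on U (\<lambda>P. C_m A (torque_args P))"
    "smooth_fun_on U (\<lambda>P. C_n A (torque_args P))"
    using a by (intro torque; blast)+
qed

lemma open_aircraft_dom:
  assumes "aircraft_model A"
  shows "open (aircraft_dom A)"
proof -
  note open_c = open_coeff_dom[OF assms]
  note smooth = smooth_coefficients[OF assms open_c order.refl]
  have "smooth_fun_on (coeff_dom A) (\<lambda>P. torque_jacobian A P $ i $ j)" for i j
  proof -
    have "smooth_fun_on (coeff_dom A)
        (\<lambda>Q. (vector [C_l A (torque_args Q), C_m A (torque_args Q), C_n A (torque_args Q)] :: real^3) $ i)"
      using smooth(5-7) exhaust_3[of i] by auto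
    then show ?thesis
      unfolding torque_jacobian_def by (simp add: smooth_fun_on_partial open_c)
  qed
  then have "smooth_fun_on (coeff_dom A) (\<lambda>P. det (torque_jacobian A P))"
    unfolding det_3 by (intro smooth_diff smooth_add smooth_mult open_c)
  then have "smooth_fun_on (coeff_dom A) (\<lambda>P. P (State St_V) * cos (P (State St_gamma)) * cos (P (State St_beta)) *
      det (torque_jacobian A P))"
    by (intro smooth_mult smooth_cos smooth_coord open_c)
  from continuous_on_open_vimage[OF open_c, THEN iffD1, OF smooth_fun_on_continuous[OF this], rule_format, of "- {0}"]
  have "open ((\<lambda>P. P (State St_V) * cos (P (State St_gamma)) * cos (P (State St_beta)) *
      det (torque_jacobian A P)) -` (- {0}) \<inter> coeff_dom A)" by (simp add: open_Compl)
  moreover have "(\<lambda>P. P (State St_V) * cos (P (State St_gamma)) * cos (P (State St_beta)) *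
      det (torque_jacobian A P)) -` (- {0}) \<inter> coeff_dom A = aircraft_dom A"
    by (auto simp: aircraft_dom_def coeff_dom_def)
  ultimately show ?thesis by simp
qed

lemma smooth_forces:
  assumes "aircraft_model A"
  shows "smooth_fun_on (aircraft_dom A) (dyn_pressure_area A)"
    and "smooth_fun_on (aircraft_dom A) (force_X A)" "smooth_fun_on (aircraft_dom A) (force_Y A)"
    and "smooth_fun_on (aircraft_dom A) (force_Z A)"
    and "smooth_fun_on (aircraft_dom A) (torque_L A)" "smooth_fun_on (aircraft_dom A) (torque_M A)"
    and "smooth_fun_on (aircraft_dom A) (torque_N A)"
proof -
  note op = open_aircraft_dom[OF assms]
  have "aircraft_dom A \<subseteq> coeff_dom A" by (auto simp: aircraft_dom_def coeff_dom_def)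
  note smooth = smooth_coefficients[OF assms op this]
  show d: "smooth_fun_on (aircraft_dom A) (dyn_pressure_area A)"
    unfolding dyn_pressure_area_def[abs_def]
    by (intro smooth_mult smooth_divide smooth_power smooth_const smooth_coord smooth(1) op) simp
  note rules = smooth_add smooth_diff smooth_minus smooth_mult smooth_sin smooth_cos smooth_const smooth_coord
  show "smooth_fun_on (aircraft_dom A) (force_X A)" "smooth_fun_on (aircraft_dom A) (force_Y A)"
    "smooth_fun_on (aircraft_dom A) (force_Z A)"
    unfolding force_X_def[abs_def] force_Y_def[abs_def] force_Z_def[abs_def] Let_def
    by (intro rules d smooth op)+
  show "smooth_fun_on (aircraft_dom A) (torque_L A)" "smooth_fun_on (aircraft_dom A) (torque_M A)"
    "smooth_fun_on (aircraft_dom A) (torque_N A)"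
    unfolding torque_L_def[abs_def] torque_M_def[abs_def] torque_N_def[abs_def]
    by (intro rules d smooth op)+
qed

lemma aircraft_dom_nonzero:
  assumes "aircraft_model A" "P \<in> aircraft_dom A"
  shows "mass A \<noteq> 0" "P (State St_V) \<noteq> 0" "cos (P (State St_gamma)) \<noteq> 0" "cos (P (State St_beta)) \<noteq> 0"
    "dyn_pressure_area A P \<noteq> 0"
proof -
  have "air_density A (P (State St_z)) > 0" "wing_area A > 0"
    using assms by (auto simp: aircraft_model_def aircraft_dom_def)
  moreover show "mass A \<noteq> 0" using assms by (auto simp: aircraft_model_def)
  moreover show "P (State St_V) \<noteq> 0" "cos (P (State St_gamma)) \<noteq> 0" "cos (P (State St_beta)) \<noteq> 0"
    using assms(2) by (auto simp: aircraft_dom_def)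
  ultimately show "dyn_pressure_area A P \<noteq> 0" by (simp add: dyn_pressure_area_def)
qed

text \<open>The right-hand side of Euler's equations before multiplication by \<open>J\<^sup>-\<^sup>1\<close>.\<close>
definition net_torque :: "aircraft \<Rightarrow> point \<Rightarrow> 3 \<Rightarrow> real" where
  "net_torque A P k =
     (let p = P (State St_p); q = P (State St_q); r = P (State St_r)
      in if k = 1 then (I_yy A - I_zz A) * q * r + I_xz A * p * q + torque_L A P
         else if k = 2 then (I_zz A - I_xx A) * p * r + I_xz A * (r\<^sup>2 - p\<^sup>2) + torque_M A P
         else (I_xx A - I_yy A) * p * q - I_xz A * r * q + torque_N A P)"

lemma angular_acceleration_component:
  "angular_acceleration A P $ i = (\<Sum>k\<in>UNIV. matrix_inv (inertia A) $ i $ k * net_torque A P k)"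
  by (simp add: angular_acceleration_def net_torque_def Let_def matrix_vector_mult_def sum_3)

lemma smooth_aircraft_field:
  assumes "aircraft_model A"
  shows "smooth_map_on (aircraft_dom A) (aircraft_field A)"
proof (rule smooth_map_onI)
  fix c
  note op = open_aircraft_dom[OF assms]
  note smooth = smooth_forces[OF assms]
  note nz = aircraft_dom_nonzero[OF assms]
  note rules = smooth_add smooth_diff smooth_minus smooth_mult smooth_sin smooth_cos smooth_divide
    smooth_power smooth_const smooth_coord
  have "smooth_fun_on (aircraft_dom A) (\<lambda>P. net_torque A P k)" for k
    using exhaust_3[of k] unfolding net_torque_def Let_def
    by (elim disjE; simp; intro rules smooth op)
  then have ang: "smooth_fun_on (aircraft_dom A) (\<lambda>P. angular_acceleration A P $ i)" for i
    unfolding angular_acceleration_component by (intro smooth_sum smooth_mult smooth_const op)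
  show "smooth_fun_on (aircraft_dom A) (\<lambda>P. aircraft_field A P c)"
  proof (cases c)
    case (State s)
    show ?thesis
      unfolding State aircraft_field.simps state_derivative_def Let_def
      by (cases s; simp add: tan_def ang; intro rules smooth op; simp add: nz)
  qed (simp_all add: smooth_const smooth_coord op)
qed

section \<open>The coordinates on which the model depends\<close>

lemma forces_cong:
  assumes "\<And>s. s \<in> {St_z, St_V, St_gamma, St_alpha, St_beta, St_mu} \<Longrightarrow> Q (State s) = R (State s)"
    "Q (Control Ct_F 0) = R (Control Ct_F 0)"
  shows "force_X A Q = force_X A R" "force_Y A Q = force_Y A R" "force_Z A Q = force_Z A R"
    "dyn_pressure_area A Q = dyn_pressure_area A R"
  using assms
  by (simp_all add: force_X_def force_Y_def force_Z_def dyn_pressure_area_def force_args_def Let_def)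

lemma kinematics_cong:
  assumes "s \<in> {St_x, St_y, St_z}"
    and "\<And>s. s \<in> {St_V, St_gamma, St_chi} \<Longrightarrow> Q (State s) = R (State s)"
  shows "aircraft_field A Q (State s) = aircraft_field A R (State s)"
  using assms by (auto simp: state_derivative_def Let_def)

lemma velocity_cong:
  assumes "s \<in> {St_V, St_gamma, St_chi}"
    and eq: "\<And>s. s \<in> {St_z, St_V, St_gamma, St_alpha, St_beta, St_mu} \<Longrightarrow> Q (State s) = R (State s)"
    and F: "Q (Control Ct_F 0) = R (Control Ct_F 0)"
  shows "aircraft_field A Q (State s) = aircraft_field A R (State s)"
  using assms(1) eq forces_cong[OF eq F] by (auto simp: state_derivative_def Let_def)

lemma attitude_cong:
  assumes "s \<in> {St_alpha, St_beta, St_mu}"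
    and eq: "\<And>s. s \<in> {St_z, St_V, St_gamma, St_alpha, St_beta, St_mu} \<Longrightarrow> Q (State s) = R (State s)"
    and F: "Q (Control Ct_F 0) = R (Control Ct_F 0)"
    and rates: "\<And>s. s \<in> {St_p, St_q, St_r} \<Longrightarrow> Q (State s) = R (State s)"
  shows "aircraft_field A Q (State s) = aircraft_field A R (State s)"
  using assms(1) eq rates forces_cong[OF eq F] by (auto simp: state_derivative_def Let_def)

lemma aircraft_field_cong:
  assumes "l \<in> insert Time (range State)" and eq: "\<And>c. c \<in> base_coords \<Longrightarrow> Q c = R c"
  shows "aircraft_field A Q l = aircraft_field A R l"
proof -
  have s: "Q (State s) = R (State s)" for s by (rule eq) (simp add: base_coords_def)
  have u: "Q (Control u 0) = R (Control u 0)" for u by (rule eq) (simp add: base_coords_def)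
  note f = forces_cong[of Q R A, OF s u]
  have t: "torque_args Q = torque_args R" by (simp add: torque_args_def s u)
  have n: "net_torque A Q k = net_torque A R k" for k
    by (simp add: net_torque_def Let_def s u torque_L_def torque_M_def torque_N_def f t)
  show ?thesis
  proof (cases l)
    case (State st)
    show ?thesis
      unfolding State aircraft_field.simps state_derivative_def Let_def s f angular_acceleration_component n ..
  qed (use assms(1) in auto)
qed

lemma aircraft_dom_cong:
  assumes "Q \<in> aircraft_dom A" and eq: "\<And>c. c \<in> base_coords \<Longrightarrow> Q c = R c"
  shows "R \<in> aircraft_dom A"
proof -
  have s: "Q (State s) = R (State s)" for s by (rule eq) (simp add: base_coords_def)
  have u: "Q (Control u 0) = R (Control u 0)" for u by (rule eq) (simp add: base_coords_def)
  have t: "torque_args (Q(c := x)) = torque_args (R(c := x))" for c x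
    by (simp add: torque_args_def s u)
  have "Q (if j = 1 then Control Ct_l 0 else if j = 2 then Control Ct_m 0 else Control Ct_n 0) =
      R (if j = 1 then Control Ct_l 0 else if j = 2 then Control Ct_m 0 else Control Ct_n 0)" for j :: 3
    by (simp add: u)
  then have "torque_jacobian A Q = torque_jacobian A R"
    unfolding torque_jacobian_def partial_def t by (simp only:)
  moreover have "torque_args Q = torque_args R" by (simp add: torque_args_def s u)
  moreover have "force_args Q = force_args R" by (simp add: force_args_def s)
  ultimately show ?thesis using assms(1) by (simp add: aircraft_dom_def s)
qed

section \<open>The Jacobians of the four steps\<close>

lemma has_partial_invariant: "(\<And>s. f (p(c := s)) = f p) \<Longrightarrow> has_partial c f 0 p"
  unfolding has_partial_def by simp

lemma has_partial_sum:
  "(\<And>i. i \<in> I \<Longrightarrow> has_partial c (f i) (D i) p) \<Longrightarrow> has_partial c (\<lambda>p. \<Sum>i\<in>I. f i p) (\<Sum>i\<in>I. D i) p"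
  unfolding has_partial_def by (rule DERIV_sum)

lemma has_partial_mult_invariant:
  assumes "has_partial c f D p" "\<And>s. h (p(c := s)) = h p"
  shows "has_partial c (\<lambda>p. f p * h p) (D * h p) p"
  using has_partial_mult[OF assms(1) has_partial_invariant[of h, OF assms(2)]] by simp

text \<open>\<open>(V, \<gamma>, \<chi>)\<close> are spherical coordinates of the velocity vector \<open>(x', y', z')\<close>, with Jacobian
  determinant \<open>\<plusminus>V\<^sup>2 cos \<gamma>\<close>.\<close>
lemma kinematics_nonsingular:
  assumes "P (State St_V) \<noteq> 0" "cos (P (State St_gamma)) \<noteq> 0"
  shows "\<forall>a. (\<forall>j\<in>{State St_V, State St_gamma, State St_chi}. (\<Sum>i\<in>{State St_x, State St_y, State St_z}.
       a i * partial j (\<lambda>Q. aircraft_field A Q i) P) = 0) \<longrightarrow> (\<forall>i\<in>{State St_x, State St_y, State St_z}. a i = 0)"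
proof (intro allI impI)
  fix a :: "coord \<Rightarrow> real"
  let ?I = "{State St_x, State St_y, State St_z}"
  assume sum: "\<forall>j\<in>{State St_V, State St_gamma, State St_chi}. (\<Sum>i\<in>?I. a i * partial j (\<lambda>Q. aircraft_field A Q i) P) = 0"
  define V c s C S where "V = P (State St_V)" and "c = cos (P (State St_gamma))" and "s = sin (P (State St_gamma))"
    and "C = cos (P (State St_chi))" and "S = sin (P (State St_chi))"
  note d = V_def c_def s_def C_def S_def
  have p: "partial (State St_V) (\<lambda>Q. aircraft_field A Q (State St_x)) P = C * c"
    "partial (State St_V) (\<lambda>Q. aircraft_field A Q (State St_y)) P = S * c"
    "partial (State St_V) (\<lambda>Q. aircraft_field A Q (State St_z)) P = - s"
    "partial (State St_gamma) (\<lambda>Q. aircraft_field A Q (State St_x)) P = - V * C * s"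
    "partial (State St_gamma) (\<lambda>Q. aircraft_field A Q (State St_y)) P = - V * S * s"
    "partial (State St_gamma) (\<lambda>Q. aircraft_field A Q (State St_z)) P = - V * c"
    "partial (State St_chi) (\<lambda>Q. aircraft_field A Q (State St_x)) P = - V * S * c"
    "partial (State St_chi) (\<lambda>Q. aircraft_field A Q (State St_y)) P = V * C * c"
    "partial (State St_chi) (\<lambda>Q. aircraft_field A Q (State St_z)) P = 0"
    by (rule has_partial_imp_partial; auto simp: has_partial_def state_derivative_def Let_def d
        intro!: derivative_eq_intros)+
  define x y z where "x = a (State St_x)" and "y = a (State St_y)" and "z = a (State St_z)"
  have e1: "x * (C * c) + y * (S * c) - z * s = 0"
    and e2: "V * (x * (C * s) + y * (S * s) + z * c) = 0" and e3: "V * c * (y * C - x * S) = 0"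
    using sum by (simp_all add: p[unfolded aircraft_field.simps] x_def y_def z_def algebra_simps)
  have V: "V \<noteq> 0" "c \<noteq> 0" using assms by (simp_all add: d)
  have e2': "x * (C * s) + y * (S * s) + z * c = 0" and e3': "y * C - x * S = 0" using e2 e3 V by simp_all
  have t: "s\<^sup>2 + c\<^sup>2 = 1" "S\<^sup>2 + C\<^sup>2 = 1" by (simp_all add: d)
  have "z = 0" using e1 e2' t by algebra
  moreover have u: "x * C + y * S = 0" using e1 e2' t by algebra
  moreover have "x = 0" using u e3' t by algebra
  moreover have "y = 0" using u e3' t by algebra
  ultimately show "\<forall>i\<in>?I. a i = 0" by (simp add: x_def y_def z_def)
qed

lemma has_partial_Delta_rows:
  assumes "aircraft_model A" "P \<in> aircraft_dom A"
  shows "has_partial (Xi2 l) (\<lambda>Q. Delta_rows A Q $ i) (Delta A P $ i $ l) P"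
proof -
  note op = open_aircraft_dom[OF assms(1)]
  note smooth = smooth_forces[OF assms(1)]
  have "smooth_fun_on (aircraft_dom A) (\<lambda>Q. Delta_rows A Q $ i)"
    unfolding Delta_rows_def Let_def using exhaust_3[of i]
    by (elim disjE; simp; intro smooth_add smooth_diff smooth_minus smooth_mult smooth_sin smooth_cos smooth_coord smooth op)
  from smooth_fun_on_has_partial[OF this assms(2)] show ?thesis by (simp add: Delta_def)
qed

lemma Xi2_inj: "Xi2 k = Xi2 l \<Longrightarrow> k = l"
  using exhaust_4[of k] exhaust_4[of l] by (auto simp: Xi2_def)

text \<open>Up to nonzero factors free of the variables \<open>\<Xi>\<^sub>2\<close>, the rows of \<open>\<Delta>\<close> are the gradients of
  \<open>V'\<close>, \<open>\<gamma>'\<close> and \<open>\<chi>'\<close>.\<close>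
lemma velocity_nonsingular:
  assumes model: "aircraft_model A" "P \<in> aircraft_dom A" and det: "det (drop_column (Delta A P) j0) \<noteq> 0"
  shows "\<forall>a. (\<forall>j\<in>Xi2 ` (- {j0}). (\<Sum>i\<in>{State St_V, State St_gamma, State St_chi}.
       a i * partial j (\<lambda>Q. aircraft_field A Q i) P) = 0) \<longrightarrow> (\<forall>i\<in>{State St_V, State St_gamma, State St_chi}. a i = 0)"
proof (intro allI impI)
  fix a :: "coord \<Rightarrow> real"
  let ?I = "{State St_V, State St_gamma, State St_chi}"
  assume sum: "\<forall>j\<in>Xi2 ` (- {j0}). (\<Sum>i\<in>?I. a i * partial j (\<lambda>Q. aircraft_field A Q i) P) = 0"
  define h where "h = (\<lambda>i :: 3. \<lambda>Q :: point. if i = 1 then 1 / mass A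
    else if i = 2 then - 1 / (mass A * Q (State St_V))
    else - 1 / (mass A * Q (State St_V) * cos (Q (State St_gamma))))"
  define st where "st = (\<lambda>i :: 3. if i = 1 then State St_V else if i = 2 then State St_gamma else State St_chi)"
  have h_nz: "h i P \<noteq> 0" for i
    using aircraft_dom_nonzero[OF model] by (simp add: h_def)
  have field_eq: "(\<lambda>Q. aircraft_field A Q (st i)) = (\<lambda>Q. Delta_rows A Q $ i * h i Q)" for i
  proof (rule ext)
    fix Q
    show "aircraft_field A Q (st i) = Delta_rows A Q $ i * h i Q"
      using exhaust_3[of i]
    proof (elim disjE)
      assume "i = 3"
      moreover have "(force_Y A Q * cos (Q (State St_mu)) - force_Z A Q * sin (Q (State St_mu))) /
          (mass A * Q (State St_V) * cos (Q (State St_gamma))) =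
        (- cos (Q (State St_mu)) * force_Y A Q + sin (Q (State St_mu)) * force_Z A Q) *
          (- 1 / (mass A * Q (State St_V) * cos (Q (State St_gamma))))"
        by (simp add: divide_inverse algebra_simps)
      ultimately show ?thesis by (simp add: state_derivative_def Let_def Delta_rows_def h_def st_def)
    next
      assume "i = 2"
      moreover have "- (force_Y A Q * sin (Q (State St_mu)) + force_Z A Q * cos (Q (State St_mu))) /
          (mass A * Q (State St_V)) =
        (sin (Q (State St_mu)) * force_Y A Q + cos (Q (State St_mu)) * force_Z A Q) *
          (- 1 / (mass A * Q (State St_V)))"
        by (simp add: divide_inverse algebra_simps)
      ultimately show ?thesis by (simp add: state_derivative_def Let_def Delta_rows_def h_def st_def)
    qed (simp add: state_derivative_def Let_def Delta_rows_def h_def st_def)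
  qed
  have h_inv: "h i (P(Xi2 l := s)) = h i P" for i l s by (simp add: h_def Xi2_def)
  have partial: "partial (Xi2 l) (\<lambda>Q. aircraft_field A Q (st i)) P = Delta A P $ i $ l * h i P" for i l
    unfolding field_eq
    by (rule has_partial_imp_partial[OF has_partial_mult_invariant[OF has_partial_Delta_rows[OF model] h_inv]])
  define b :: "real^3" where "b = (\<chi> i. a (st i) * h i P)"
  have "b = 0"
  proof (rule left_kernel_trivial[OF det])
    fix k
    obtain l where l: "l \<noteq> j0" "\<And>i. drop_column (Delta A P) j0 $ i $ k = Delta A P $ i $ l"
      using drop_column_component(2)[of j0 "Delta A P" k] by blast
    have "(\<Sum>i\<in>?I. a i * partial (Xi2 l) (\<lambda>Q. aircraft_field A Q i) P) = 0"
      using sum l(1) by simp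
    then have "(\<Sum>i\<in>UNIV. a (st i) * partial (Xi2 l) (\<lambda>Q. aircraft_field A Q (st i)) P) = 0"
      by (simp add: sum_3 st_def add.assoc)
    then show "(\<Sum>i\<in>UNIV. b $ i * drop_column (Delta A P) j0 $ i $ k) = 0"
      by (simp add: partial l(2) b_def mult_ac)
  qed
  then have b0: "b $ i = 0" for i by simp
  have "a (st i) = 0" for i using b0[of i] h_nz[of i] by (simp add: b_def)
  from this[of 1] this[of 2] this[of 3] show "\<forall>i\<in>?I. a i = 0" by (simp add: st_def)
qed

text \<open>The forces do not involve \<open>p, q, r\<close>, so that \<open>(\<alpha>', \<beta>', \<mu>')\<close> is affine in them; the determinant of
  the linear part is \<open>\<plusminus>1 / cos \<beta>\<close>.\<close>
lemma attitude_nonsingular: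
  assumes "cos (P (State St_beta)) \<noteq> 0"
  shows "\<forall>a. (\<forall>j\<in>{State St_p, State St_q, State St_r}. (\<Sum>i\<in>{State St_alpha, State St_beta, State St_mu}.
       a i * partial j (\<lambda>Q. aircraft_field A Q i) P) = 0) \<longrightarrow> (\<forall>i\<in>{State St_alpha, State St_beta, State St_mu}. a i = 0)"
proof (intro allI impI)
  fix a :: "coord \<Rightarrow> real"
  let ?I = "{State St_alpha, State St_beta, State St_mu}"
  assume sum: "\<forall>j\<in>{State St_p, State St_q, State St_r}. (\<Sum>i\<in>?I. a i * partial j (\<lambda>Q. aircraft_field A Q i) P) = 0"
  define c s C S where "c = cos (P (State St_beta))" and "s = sin (P (State St_beta))"
    and "C = cos (P (State St_alpha))" and "S = sin (P (State St_alpha))"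
  note d = c_def s_def C_def S_def
  have f: "force_Y A (P(State st := x)) = force_Y A P" "force_Z A (P(State st := x)) = force_Z A P"
    if "st \<in> {St_p, St_q, St_r}" for st x
    using that by (auto intro!: forces_cong)
  have p: "partial (State St_p) (\<lambda>Q. aircraft_field A Q (State St_alpha)) P = - C * s / c"
    "partial (State St_q) (\<lambda>Q. aircraft_field A Q (State St_alpha)) P = c / c"
    "partial (State St_r) (\<lambda>Q. aircraft_field A Q (State St_alpha)) P = - S * s / c"
    "partial (State St_p) (\<lambda>Q. aircraft_field A Q (State St_beta)) P = S"
    "partial (State St_q) (\<lambda>Q. aircraft_field A Q (State St_beta)) P = 0"
    "partial (State St_r) (\<lambda>Q. aircraft_field A Q (State St_beta)) P = - C"
    "partial (State St_p) (\<lambda>Q. aircraft_field A Q (State St_mu)) P = C / c"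
    "partial (State St_q) (\<lambda>Q. aircraft_field A Q (State St_mu)) P = 0"
    "partial (State St_r) (\<lambda>Q. aircraft_field A Q (State St_mu)) P = S / c"
    by (rule has_partial_imp_partial; auto simp: has_partial_def state_derivative_def Let_def d f assms
        intro!: derivative_eq_intros)+
  define x y z where "x = a (State St_alpha)" and "y = a (State St_beta)" and "z = a (State St_mu) / c"
  have c: "c \<noteq> 0" using assms by (simp add: d)
  have "x = 0" using sum c by (simp add: p[unfolded aircraft_field.simps] x_def)
  then have e: "y * S + z * C = 0" "z * S - y * C = 0"
    using sum by (simp_all add: p[unfolded aircraft_field.simps] x_def y_def z_def algebra_simps)
  have t: "S\<^sup>2 + C\<^sup>2 = 1" by (simp add: d)
  have "y = 0" using e t by algebra
  moreover have "z = 0" using e t by algebra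
  ultimately show "\<forall>i\<in>?I. a i = 0" using \<open>x = 0\<close> c by (simp add: x_def y_def z_def)
qed

lemma invertible_matrix_inv:
  fixes M :: "real^'n^'n"
  assumes "invertible M"
  shows "invertible (matrix_inv M)"
proof -
  have "\<exists>B. M ** B = mat 1 \<and> B ** M = mat 1" using assms by (simp add: invertible_def)
  then have "M ** matrix_inv M = mat 1 \<and> matrix_inv M ** M = mat 1"
    unfolding matrix_inv_def by (rule someI_ex)
  then show ?thesis unfolding invertible_def by blast
qed

definition deflection :: "3 \<Rightarrow> coord" where
  "deflection j = (if j = 1 then Control Ct_l 0 else if j = 2 then Control Ct_m 0 else Control Ct_n 0)"

definition rate :: "3 \<Rightarrow> coord" where
  "rate j = (if j = 1 then State St_p else if j = 2 then State St_q else State St_r)"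

text \<open>The Jacobian of \<open>(p', q', r')\<close> in the deflections is the product of the inverse inertia matrix, a
  diagonal matrix with the nonzero entries \<open>\<rho>/2 S V\<^sup>2 a\<close>, \<open>\<rho>/2 S V\<^sup>2 b\<close>, \<open>\<rho>/2 S V\<^sup>2 a\<close>, and the Jacobian of
  \<open>C\<^sub>l, C\<^sub>m, C\<^sub>n\<close>.\<close>
lemma rotation_nonsingular:
  assumes model: "aircraft_model A" "P \<in> aircraft_dom A"
  shows "\<forall>a. (\<forall>j\<in>range deflection. (\<Sum>i\<in>range rate.
       a i * partial j (\<lambda>Q. aircraft_field A Q i) P) = 0) \<longrightarrow> (\<forall>i\<in>range rate. a i = 0)"
proof (intro allI impI)
  fix a :: "coord \<Rightarrow> real"
  assume sum: "\<forall>j\<in>range deflection. (\<Sum>i\<in>range rate. a i * partial j (\<lambda>Q. aircraft_field A Q i) P) = 0"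
  note op = open_aircraft_dom[OF model(1)]
  define coef where "coef = (\<lambda>(k :: 3) Q. (vector [C_l A (torque_args Q), C_m A (torque_args Q), C_n A (torque_args Q)] :: real^3) $ k)"
  define len where "len = (\<lambda>k :: 3. if k = 2 then chord A else wing_span A)"
  define factor where "factor = (\<lambda>(k :: 3) Q. dyn_pressure_area A Q * len k)"
  define rest where "rest = (\<lambda>(k :: 3) (Q :: point). let p = Q (State St_p); q = Q (State St_q); r = Q (State St_r)
      in if k = 1 then (I_yy A - I_zz A) * q * r + I_xz A * p * q - y_p A * sin (eps A) * (thrust_ratio A * Q (Control Ct_F 0))
         else if k = 2 then (I_zz A - I_xx A) * p * r + I_xz A * (r\<^sup>2 - p\<^sup>2)
         else (I_xx A - I_yy A) * p * q - I_xz A * r * q + y_p A * cos (eps A) * (thrust_ratio A * Q (Control Ct_F 0)))"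
  have torque: "net_torque A Q k = rest k Q + coef k Q * factor k Q" for Q k
    using exhaust_3[of k]
    by (elim disjE) (simp_all add: net_torque_def rest_def coef_def factor_def len_def Let_def
        torque_L_def torque_M_def torque_N_def)
  have factor_nz: "factor k P \<noteq> 0" for k
    using aircraft_dom_nonzero(5)[OF model] model(1) by (simp add: factor_def len_def aircraft_model_def)
  have rest_inv: "rest k (P(deflection j := x)) = rest k P" for k j x
    by (simp add: rest_def deflection_def Let_def)
  have factor_inv: "factor k (P(deflection j := x)) = factor k P" for k j x
    by (simp add: factor_def dyn_pressure_area_def deflection_def)
  have "aircraft_dom A \<subseteq> coeff_dom A" by (auto simp: aircraft_dom_def coeff_dom_def)
  note smooth = smooth_coefficients[OF model(1) op this]
  have smooth_coef: "smooth_fun_on (aircraft_dom A) (coef k)" for k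
    using exhaust_3[of k] smooth unfolding coef_def by auto
  have "has_partial (deflection j) (coef k) (torque_jacobian A P $ k $ j) P" for j k
    using smooth_fun_on_has_partial[OF smooth_coef model(2), of "deflection j" k]
    by (simp add: torque_jacobian_def coef_def deflection_def)
  then have "has_partial (deflection j) (\<lambda>Q. net_torque A Q k) (0 + torque_jacobian A P $ k $ j * factor k P) P" for j k
    unfolding torque
    by (intro has_partial_add has_partial_invariant has_partial_mult_invariant rest_inv factor_inv)
  then have torque_partial: "has_partial (deflection j) (\<lambda>Q. net_torque A Q k) (torque_jacobian A P $ k $ j * factor k P) P" for j k
    by simp
  let ?J = "matrix_inv (inertia A)"
  have "aircraft_field A Q (rate i) = (\<Sum>k\<in>UNIV. net_torque A Q k * ?J $ i $ k)" for Q i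
    using exhaust_3[of i]
    by (elim disjE) (simp_all add: rate_def state_derivative_def Let_def angular_acceleration_component mult.commute)
  then have partial: "partial (deflection j) (\<lambda>Q. aircraft_field A Q (rate i)) P =
      (\<Sum>k\<in>UNIV. torque_jacobian A P $ k $ j * factor k P * ?J $ i $ k)" for i j
    by (simp only:) (intro has_partial_imp_partial has_partial_sum has_partial_mult_invariant torque_partial refl)
  have inj_rate: "inj rate"
    by (rule injI) (use exhaust_3 in \<open>auto simp: rate_def split: if_splits\<close>)
  define b :: "real^3" where "b = (\<chi> k. (\<Sum>i\<in>UNIV. a (rate i) * ?J $ i $ k) * factor k P)"
  have "det (torque_jacobian A P) \<noteq> 0" using model(2) by (simp add: aircraft_dom_def)
  then have "b = 0"
  proof (rule left_kernel_trivial)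
    fix j
    have "(\<Sum>i\<in>UNIV. a (rate i) * partial (deflection j) (\<lambda>Q. aircraft_field A Q (rate i)) P) = 0"
      using sum sum.reindex[OF inj_rate, of "\<lambda>i. a i * partial (deflection j) (\<lambda>Q. aircraft_field A Q i) P"]
      by (simp add: o_def)
    then have "(\<Sum>i\<in>UNIV. \<Sum>k\<in>UNIV. a (rate i) * ?J $ i $ k * factor k P * torque_jacobian A P $ k $ j) = 0"
      by (simp add: partial sum_distrib_left mult_ac)
    then have "(\<Sum>k\<in>UNIV. \<Sum>i\<in>UNIV. a (rate i) * ?J $ i $ k * factor k P * torque_jacobian A P $ k $ j) = 0"
      by (subst sum.swap)
    then show "(\<Sum>k\<in>UNIV. b $ k * torque_jacobian A P $ k $ j) = 0"
      by (simp add: b_def sum_distrib_right)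
  qed
  then have b0: "b $ k = 0" for k by simp
  have "(\<Sum>i\<in>UNIV. a (rate i) * ?J $ i $ k) = 0" for k
    using b0[of k] factor_nz[of k] by (simp add: b_def)
  moreover have "invertible (inertia A)" using model(1) by (simp add: aircraft_model_def)
  then have "det ?J \<noteq> 0" using invertible_matrix_inv invertible_det_nz by blast
  ultimately have "(\<chi> i. a (rate i)) = (0 :: real^3)"
    by (intro left_kernel_trivial) simp_all
  then show "\<forall>i\<in>range rate. a i = 0" by (simp add: vec_eq_iff)
qed

section \<open>The flat outputs of the aircraft\<close>

lemma vector_4:
  "(vector [x, y, z, u] :: 'a::zero^4) $ 1 = x" "(vector [x, y, z, u] :: 'a^4) $ 2 = y"
  "(vector [x, y, z, u] :: 'a^4) $ 3 = z" "(vector [x, y, z, u] :: 'a^4) $ 4 = u"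
  unfolding vector_def by simp_all

definition output_coord :: "4 \<Rightarrow> 4 \<Rightarrow> coord" where
  "output_coord j i = (if i = 1 then State St_x else if i = 2 then State St_y
     else if i = 3 then State St_z else Xi2 j)"

lemma Xi2_cases: "Xi2 k \<in> {State St_alpha, State St_beta, State St_mu, Control Ct_F 0}"
  by (simp add: Xi2_def)

lemma output_coord_inj: "output_coord j i = output_coord j i' \<Longrightarrow> i = i'"
proof -
  have "Xi2 j \<noteq> State St_x" "Xi2 j \<noteq> State St_y" "Xi2 j \<noteq> State St_z" using Xi2_cases[of j] by auto
  then show "output_coord j i = output_coord j i' \<Longrightarrow> i = i'"
    using exhaust_4[of i] exhaust_4[of i'] unfolding output_coord_def by (simp split: if_splits)
qed

lemma output_coord_vector:
  "(vector [Q (State St_x), Q (State St_y), Q (State St_z), Q (Xi2 j)] :: real^4) $ i = Q (output_coord j i)"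
  using exhaust_4[of i] by (elim disjE) (simp_all add: vector_4 output_coord_def)

lemma Xi2_split: "range Xi2 = Xi2 ` (- {j}) \<union> {Xi2 j}"
proof -
  have u: "UNIV = - {j} \<union> {j}" by blast
  show ?thesis by (subst u) (simp only: image_Un image_insert image_empty)
qed

lemma range_Xi2: "range Xi2 = {State St_alpha, State St_beta, State St_mu, Control Ct_F 0}"
  unfolding UNIV_4 by (simp add: Xi2_def) blast

lemma range_deflection: "range deflection = {Control Ct_l 0, Control Ct_m 0, Control Ct_n 0}"
  unfolding UNIV_3 by (simp add: deflection_def) blast

lemma range_rate: "range rate = {State St_p, State St_q, State St_r}"
  unfolding UNIV_3 by (simp add: rate_def) blast

text \<open>
  The sets \<open>K1 \<subseteq> K2 \<subseteq> K3 \<subseteq> K4 \<subseteq> base_coords\<close> of known coordinates grow with the four steps; the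
  sets of coordinates whose differential equation is satisfied follow one step behind.
\<close>
lemma regular_flat_output_of_minor:
  assumes model: "aircraft_model A" and P: "P \<in> aircraft_dom A"
    and minor: "det (drop_column (Delta A P) j) \<noteq> 0"
  shows "aircraft_regular_flat_output A P
     (\<lambda>Q. vector [Q (State St_x), Q (State St_y), Q (State St_z), Q (Xi2 j)])"
proof -
  let ?D = "aircraft_dom A" and ?v = "aircraft_field A"
  define \<phi> :: "point \<Rightarrow> 4 jet_coord \<Rightarrow> real" where
    "\<phi> = jet_prolongation ?v (\<lambda>Q. Q Time) (\<lambda>i Q. Q (output_coord j i))"
  note op = open_aircraft_dom[OF model]
  note smooth_v = smooth_aircraft_field[OF model]
  have smooth_\<phi>: "smooth_map_on ?D \<phi>"
    unfolding \<phi>_def by (intro smooth_jet_prolongation op smooth_v smooth_coord)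
  have map: "diffiety_map ?D ?v jet_field \<phi> P"
  proof (unfold_locales; (rule op P smooth_v smooth_jet_field smooth_\<phi>)?)
    fix Q d assume "Q \<in> ?D"
    have "derivation ?v (\<lambda>Q. Q Time) Q = 1" by (simp add: derivation_coord)
    then show "derivation ?v (\<lambda>q. \<phi> q d) Q = jet_field (\<phi> Q) d"
      unfolding \<phi>_def by (rule derivation_jet_prolongation)
  qed
  interpret diffiety_map ?D ?v jet_field \<phi> P by (rule map)
  have \<phi>_time: "\<phi> Q Jet_time = Q Time" and \<phi>_out: "\<phi> Q (Zeta i 0) = Q (output_coord j i)" for Q i
    by (simp_all add: \<phi>_def jet_prolongation_def)

  \<comment> \<open>before the first step only \<open>t\<close> and the outputs are known; the others are frozen at \<open>P\<close>\<close>
  define K1 where "K1 = insert Time (range (output_coord j))"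
  define \<psi>0 :: "(4 jet_coord \<Rightarrow> real) \<Rightarrow> point" where
    "\<psi>0 = (\<lambda>\<zeta> c. if c = Time then \<zeta> Jet_time
       else if c \<in> range (output_coord j) then \<zeta> (Zeta (inv (output_coord j) c) 0) else P c)"
  have inj_out: "inj (output_coord j)" by (rule injI) (rule output_coord_inj)
  have out_Time: "output_coord j i \<noteq> Time" for i using Xi2_cases[of j] by (auto simp: output_coord_def)
  have \<psi>0_time: "\<psi>0 \<zeta> Time = \<zeta> Jet_time" and \<psi>0_out: "\<psi>0 \<zeta> (output_coord j i) = \<zeta> (Zeta i 0)" for \<zeta> i
    using out_Time inv_f_f[OF inj_out] by (simp_all add: \<psi>0_def)
  have \<psi>0_\<phi>: "\<psi>0 (\<phi> Q) c = Q c" if "c \<in> K1" for Q c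
    using that by (auto simp: K1_def \<psi>0_time \<psi>0_out \<phi>_time \<phi>_out)
  have \<psi>0_P: "\<psi>0 (\<phi> P) = P"
  proof (rule ext)
    fix c
    show "\<psi>0 (\<phi> P) c = P c" using \<psi>0_\<phi>[of c P] by (cases "c \<in> K1") (auto simp: \<psi>0_def K1_def)
  qed
  have smooth_\<psi>0: "smooth_map_on UNIV \<psi>0"
  proof (rule smooth_map_onI)
    fix c
    show "smooth_fun_on UNIV (\<lambda>\<zeta>. \<psi>0 \<zeta> c)"
      by (cases "c = Time"; cases "c \<in> range (output_coord j)")
         (simp_all add: \<psi>0_def smooth_coord smooth_const)
  qed
  obtain N0 where N0: "cylinder_open N0" "P \<in> N0" "N0 \<subseteq> ?D"
    using open_contains_cylinder_open[OF op P] by blast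
  define W0 where "W0 = {\<zeta> \<in> UNIV. \<psi>0 \<zeta> \<in> N0}"
  have "cylinder_open (UNIV :: (4 jet_coord \<Rightarrow> real) set)" by (rule cylinder_openI[of _ "{}"]) auto
  then have cyl_W0: "cylinder_open W0" unfolding W0_def by (rule cylinder_open_preimage[OF _ N0(1) smooth_\<psi>0])
  have "smooth_map_on W0 \<psi>0"
    by (rule smooth_map_on_subset[OF smooth_\<psi>0 open_UNIV cylinder_openD[OF cyl_W0]]) simp
  moreover have "derivation jet_field (\<lambda>\<zeta>. \<psi>0 \<zeta> Time) \<zeta> = ?v (\<psi>0 \<zeta>) Time" for \<zeta>
    by (simp add: \<psi>0_time derivation_coord)
  moreover have "open (\<phi> -` W0 \<inter> ?D)"
    using continuous_on_open_vimage[OF op] smooth_map_on_continuous[OF smooth_\<phi>] cylinder_openD[OF cyl_W0] by blast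
  moreover have "P \<in> \<phi> -` W0 \<inter> ?D" using P N0(2) by (simp add: W0_def \<psi>0_P)
  ultimately have step0: "partial_inverse K1 {Time} W0 \<psi>0"
    unfolding partial_inverse_def using cyl_W0 N0(3) \<psi>0_P \<psi>0_\<phi>
    by (intro conjI exI[of _ "\<phi> -` W0 \<inter> ?D"] ballI) (auto simp: W0_def)

  have Xi2_j: "Xi2 j \<in> K1"
    unfolding K1_def using rangeI[of "output_coord j" 4] by (simp add: output_coord_def)
  have K1_eq: "K1 = {Time, State St_x, State St_y, State St_z, Xi2 j}"
    unfolding K1_def UNIV_4 by (simp add: output_coord_def) blast
  note nz = aircraft_dom_nonzero[OF model P]

  define K2 where "K2 = K1 \<union> {State St_V, State St_gamma, State St_chi}"
  define L2 where "L2 = {Time} \<union> {State St_x, State St_y, State St_z}"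
  have "\<exists>W' \<psi>'. partial_inverse K2 L2 W' \<psi>' \<and> (\<forall>\<zeta>\<in>W'. \<zeta> \<in> W0 \<and> (\<forall>c\<in>K1. \<psi>' \<zeta> c = \<psi>0 \<zeta> c))"
    unfolding K2_def L2_def
  proof (rule partial_inverse_step[OF step0])
    show "{State St_V, State St_gamma, State St_chi} \<inter> K1 = {}" using Xi2_cases[of j] by (auto simp: K1_eq)
    show "?v Q i = ?v R i" if i: "i \<in> {State St_x, State St_y, State St_z}"
      and eq: "\<And>c. c \<in> K1 \<union> {State St_V, State St_gamma, State St_chi} \<Longrightarrow> Q c = R c" for i Q R
    proof -
      obtain s where s: "i = State s" "s \<in> {St_x, St_y, St_z}" using i by auto
      show ?thesis
        unfolding s(1) by (rule kinematics_cong[OF s(2)]; rule eq; auto)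
    qed
  qed (use kinematics_nonsingular nz in \<open>simp_all add: K1_eq\<close>)
  then obtain W1 \<psi>1 where step1: "partial_inverse K2 L2 W1 \<psi>1"
    and old1: "\<forall>\<zeta>\<in>W1. \<zeta> \<in> W0 \<and> (\<forall>c\<in>K1. \<psi>1 \<zeta> c = \<psi>0 \<zeta> c)" by (elim exE conjE)
  have K2_eq: "K2 = {Time, State St_x, State St_y, State St_z, State St_V, State St_gamma, State St_chi, Xi2 j}"
    by (auto simp: K2_def K1_eq)

  define K3 where "K3 = K2 \<union> Xi2 ` (- {j})"
  define L3 where "L3 = L2 \<union> {State St_V, State St_gamma, State St_chi}"
  have K3_eq: "K3 = {Time, State St_x, State St_y, State St_z, State St_V, State St_gamma, State St_chi,
      State St_alpha, State St_beta, State St_mu, Control Ct_F 0}"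
  proof -
    have "K3 = {Time, State St_x, State St_y, State St_z, State St_V, State St_gamma, State St_chi} \<union> range Xi2"
      unfolding K3_def K2_eq Xi2_split[of j] by (simp add: insert_commute)
    then show ?thesis unfolding range_Xi2 by (simp only: Un_insert_left Un_empty_left)
  qed
  have "\<exists>W' \<psi>'. partial_inverse K3 L3 W' \<psi>' \<and> (\<forall>\<zeta>\<in>W'. \<zeta> \<in> W1 \<and> (\<forall>c\<in>K2. \<psi>' \<zeta> c = \<psi>1 \<zeta> c))"
    unfolding K3_def L3_def
  proof (rule partial_inverse_step[OF step1])
    have "card (Xi2 ` (- {j})) = card (- {j})"
      by (intro card_image inj_onI) (rule Xi2_inj)
    also have "\<dots> = 3" by (simp add: Compl_eq_Diff_UNIV card_Diff_singleton)
    finally show "card {State St_V, State St_gamma, State St_chi} = card (Xi2 ` (- {j}))" by simp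
    show "Xi2 ` (- {j}) \<inter> K2 = {}"
    proof -
      have "Xi2 k \<notin> K2" if "k \<noteq> j" for k
        using that Xi2_inj[of k j] Xi2_cases[of k] by (auto simp: K2_eq)
      then show ?thesis by auto
    qed
    show "?v Q i = ?v R i" if i: "i \<in> {State St_V, State St_gamma, State St_chi}"
      and eq: "\<And>c. c \<in> K2 \<union> Xi2 ` (- {j}) \<Longrightarrow> Q c = R c" for i Q R
    proof -
      obtain s where s: "i = State s" "s \<in> {St_V, St_gamma, St_chi}" using i by auto
      show ?thesis
        unfolding s(1) by (rule velocity_cong[OF s(2)]; rule eq[folded K3_def]; auto simp: K3_eq)
    qed
    show "?v Q l = ?v R l" if l: "l \<in> L2" and eq: "\<And>c. c \<in> K2 \<Longrightarrow> Q c = R c" for l Q R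
    proof (cases "l = Time")
      case False
      then obtain s where s: "l = State s" "s \<in> {St_x, St_y, St_z}" using l by (auto simp: L2_def)
      show ?thesis
        unfolding s(1) by (rule kinematics_cong[OF s(2)]; rule eq; auto simp: K2_eq)
    qed simp
  qed (use velocity_nonsingular[OF model P minor] in \<open>simp_all add: K2_eq L2_def\<close>)
  then obtain W2 \<psi>2 where step2: "partial_inverse K3 L3 W2 \<psi>2"
    and old2: "\<forall>\<zeta>\<in>W2. \<zeta> \<in> W1 \<and> (\<forall>c\<in>K2. \<psi>2 \<zeta> c = \<psi>1 \<zeta> c)" by (elim exE conjE)
  have L3_cong: "?v Q l = ?v R l" if l: "l \<in> L3" and eq: "\<And>c. c \<in> K3 \<Longrightarrow> Q c = R c" for l Q R
  proof (cases "l = Time")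
    case False
    then obtain s where s: "l = State s" "s \<in> {St_x, St_y, St_z} \<or> s \<in> {St_V, St_gamma, St_chi}"
      using l by (auto simp: L2_def L3_def)
    show ?thesis
      unfolding s(1) using s(2)
    proof
      assume "s \<in> {St_x, St_y, St_z}"
      then show "?v Q (State s) = ?v R (State s)"
        by (rule kinematics_cong; intro eq; auto simp: K3_eq)
    next
      assume "s \<in> {St_V, St_gamma, St_chi}"
      then show "?v Q (State s) = ?v R (State s)"
        by (rule velocity_cong; intro eq; auto simp: K3_eq)
    qed
  qed simp

  define K4 where "K4 = K3 \<union> range rate"
  define L4 where "L4 = L3 \<union> {State St_alpha, State St_beta, State St_mu}"
  have K4_eq: "K4 = {Time, State St_x, State St_y, State St_z, State St_V, State St_gamma, State St_chi,
      State St_alpha, State St_beta, State St_mu, Control Ct_F 0, State St_p, State St_q, State St_r}"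
  proof -
    have "K4 = K3 \<union> {State St_p, State St_q, State St_r}" unfolding K4_def range_rate ..
    also have "\<dots> = {Time, State St_x, State St_y, State St_z, State St_V, State St_gamma, State St_chi,
      State St_alpha, State St_beta, State St_mu, Control Ct_F 0, State St_p, State St_q, State St_r}"
      unfolding K3_eq Un_insert_left Un_empty_left by (rule refl)
    finally show ?thesis .
  qed
  have att_cong: "?v Q i = ?v R i" if i: "i \<in> {State St_alpha, State St_beta, State St_mu}"
    and eq: "\<And>c. c \<in> K4 \<Longrightarrow> Q c = R c" for i Q R
  proof -
    obtain s where s: "i = State s" "s \<in> {St_alpha, St_beta, St_mu}" using i by auto
    show ?thesis
      unfolding s(1) by (rule attitude_cong[OF s(2)]; rule eq; auto simp: K4_eq)
  qed
  have "\<exists>W' \<psi>'. partial_inverse K4 L4 W' \<psi>' \<and> (\<forall>\<zeta>\<in>W'. \<zeta> \<in> W2 \<and> (\<forall>c\<in>K3. \<psi>' \<zeta> c = \<psi>2 \<zeta> c))"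
    unfolding K4_def L4_def
  proof (rule partial_inverse_step[OF step2])
    show "?v Q i = ?v R i" if "i \<in> {State St_alpha, State St_beta, State St_mu}"
      and "\<And>c. c \<in> K3 \<union> range rate \<Longrightarrow> Q c = R c" for i Q R
      by (rule att_cong[OF that(1) that(2)[folded K4_def]])
    show "?v Q l = ?v R l" if "l \<in> L3" and "\<And>c. c \<in> K3 \<Longrightarrow> Q c = R c" for l Q R
      by (rule L3_cong[OF that])
    show "\<forall>a. (\<forall>j\<in>range rate. (\<Sum>i\<in>{State St_alpha, State St_beta, State St_mu}. a i * partial j (\<lambda>Q. ?v Q i) P) = 0)
        \<longrightarrow> (\<forall>i\<in>{State St_alpha, State St_beta, State St_mu}. a i = 0)"
      unfolding range_rate by (rule attitude_nonsingular[of P, OF nz(4)])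
  qed (simp_all add: K3_eq L3_def L2_def range_rate)
  then obtain W3 \<psi>3 where step3: "partial_inverse K4 L4 W3 \<psi>3"
    and old3: "\<forall>\<zeta>\<in>W3. \<zeta> \<in> W2 \<and> (\<forall>c\<in>K3. \<psi>3 \<zeta> c = \<psi>2 \<zeta> c)" by (elim exE conjE)

  have base_eq: "base_coords = K4 \<union> range deflection"
  proof -
    have "c \<in> base_coords \<longleftrightarrow> c \<in> K4 \<union> range deflection" for c
    proof (cases c)
      case (State s)
      then show ?thesis by (cases s) (simp_all add: base_coords_def K4_eq)
    next
      case (Control u k)
      then show ?thesis
        by (cases u; cases k) (simp_all add: base_coords_def K4_eq range_deflection)
    qed (simp add: base_coords_def K4_eq)
    then show ?thesis by blast
  qed
  have L_eq: "insert Time (range State) = L4 \<union> range rate"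
  proof -
    have "State s \<in> L4 \<union> range rate" for s by (cases s) (simp_all add: L4_def L3_def L2_def range_rate)
    then show ?thesis by (auto simp: L4_def L3_def L2_def range_rate)
  qed
  have "\<exists>W' \<psi>'. partial_inverse base_coords (insert Time (range State)) W' \<psi>' \<and>
      (\<forall>\<zeta>\<in>W'. \<zeta> \<in> W3 \<and> (\<forall>c\<in>K4. \<psi>' \<zeta> c = \<psi>3 \<zeta> c))"
    unfolding base_eq L_eq
  proof (rule partial_inverse_step[OF step3])
    show "?v Q i = ?v R i" if "i \<in> range rate" and eq: "\<And>c. c \<in> K4 \<union> range deflection \<Longrightarrow> Q c = R c" for i Q R
    proof (rule aircraft_field_cong)
      show "i \<in> insert Time (range State)" using that(1) unfolding L_eq by (rule UnI2)
      show "Q c = R c" if "c \<in> base_coords" for c using eq that unfolding base_eq .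
    qed
    show "?v Q l = ?v R l" if l: "l \<in> L4" and eq: "\<And>c. c \<in> K4 \<Longrightarrow> Q c = R c" for l Q R
    proof (cases "l \<in> L3")
      case True
      then show ?thesis by (rule L3_cong) (rule eq, simp only: K4_def UnI1)
    next
      case False
      then have "l \<in> {State St_alpha, State St_beta, State St_mu}" using l by (simp add: L4_def)
      then show ?thesis by (rule att_cong[OF _ eq])
    qed
    show "\<forall>a. (\<forall>j\<in>range deflection. (\<Sum>i\<in>range rate. a i * partial j (\<lambda>Q. ?v Q i) P) = 0)
        \<longrightarrow> (\<forall>i\<in>range rate. a i = 0)"
      by (rule rotation_nonsingular[OF model P])
  qed (auto simp: K4_eq L4_def L3_def L2_def range_rate range_deflection)
  then obtain W4 \<psi>4 where step4: "partial_inverse base_coords (insert Time (range State)) W4 \<psi>4"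
    and old4: "\<forall>\<zeta>\<in>W4. \<zeta> \<in> W3 \<and> (\<forall>c\<in>K4. \<psi>4 \<zeta> c = \<psi>3 \<zeta> c)" by (elim exE conjE)

  have "\<exists>\<psi>'. partial_inverse UNIV UNIV W4 \<psi>' \<and> (\<forall>\<zeta>\<in>W4. \<forall>c\<in>base_coords. \<psi>' \<zeta> c = \<psi>4 \<zeta> c)"
  proof (rule partial_inverse_controls[OF map _ step4])
    show "?v Q l = ?v R l" if "l \<in> insert Time (range State)" "\<And>c. c \<in> base_coords \<Longrightarrow> Q c = R c" for l Q R
      by (rule aircraft_field_cong[OF that])
    show "R \<in> ?D" if "Q \<in> ?D" "\<And>c. c \<in> base_coords \<Longrightarrow> Q c = R c" for Q R
      by (rule aircraft_dom_cong[OF that])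
  qed simp
  then obtain \<psi> where \<psi>: "partial_inverse UNIV UNIV W4 \<psi>"
    and old5: "\<forall>\<zeta>\<in>W4. \<forall>c\<in>base_coords. \<psi> \<zeta> c = \<psi>4 \<zeta> c" by (elim exE conjE)
  have \<psi>_K1: "\<psi> \<zeta> c = \<psi>0 \<zeta> c" if "\<zeta> \<in> W4" "c \<in> K1" for \<zeta> c
  proof -
    have "\<zeta> \<in> W3" using that(1) old4 by blast
    then have "\<zeta> \<in> W2" using old3 by blast
    then have "\<zeta> \<in> W1" using old2 by blast
    have "c \<in> K2" using that(2) by (simp add: K2_def)
    then have "c \<in> K3" by (simp add: K3_def)
    then have "c \<in> K4" by (simp add: K4_def)
    then have "c \<in> base_coords" by (simp add: base_eq)
    show ?thesis
      using that old1 old2 old3 old4 old5 \<open>\<zeta> \<in> W3\<close> \<open>\<zeta> \<in> W2\<close> \<open>\<zeta> \<in> W1\<close>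
        \<open>c \<in> K2\<close> \<open>c \<in> K3\<close> \<open>c \<in> K4\<close> \<open>c \<in> base_coords\<close> by simp
  qed
  have right: "\<phi> (\<psi> \<zeta>) = \<zeta>" if "\<zeta> \<in> W4" for \<zeta>
  proof (rule jet_right_inverse[OF map \<psi> _ _ that])
    show "\<phi> (\<psi> \<zeta>) Jet_time = \<zeta> Jet_time" if "\<zeta> \<in> W4" for \<zeta>
      using \<psi>_K1[OF that, of Time] by (simp add: \<phi>_time \<psi>0_time K1_def)
    show "\<phi> (\<psi> \<zeta>) (Zeta i 0) = \<zeta> (Zeta i 0)" if "\<zeta> \<in> W4" for \<zeta> i
      using \<psi>_K1[OF that, of "output_coord j i"] by (simp add: \<phi>_out \<psi>0_out K1_def)
  qed
  have "\<exists>U W. flat_chart ?D ?v P U W \<phi>"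
    unfolding flat_chart_def by (rule flat_chart_of_inverse[OF \<psi>]) (rule right)
  then obtain U W where "flat_chart ?D ?v P U W \<phi>" by (elim exE)
  then show ?thesis
    unfolding aircraft_regular_flat_output_def output_coord_vector
    by (intro exI[of _ U] exI[of _ W] exI[of _ \<phi>]) (simp add: \<phi>_out)
qed

theorem proposition85:
  fixes A :: aircraft and P :: point
  assumes "aircraft_model A" and "P \<in> aircraft_dom A"
  shows "(rank (Delta A P) = 3 \<longrightarrow> aircraft_flat_at A P) \<and>
         (\<forall>j. det (drop_column (Delta A P) j) \<noteq> 0 \<longrightarrow>
            aircraft_regular_flat_output A P
              (\<lambda>Q. vector [Q (State St_x), Q (State St_y), Q (State St_z), Q (Xi2 j)]))"
proof (intro conjI impI allI)
  show regular: "aircraft_regular_flat_output A P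
      (\<lambda>Q. vector [Q (State St_x), Q (State St_y), Q (State St_z), Q (Xi2 j)])"
    if "det (drop_column (Delta A P) j) \<noteq> 0" for j
    by (rule regular_flat_output_of_minor[OF assms that])
  assume "rank (Delta A P) = 3"
  then obtain j where "det (drop_column (Delta A P) j) \<noteq> 0" using rank_3_imp_minor by blast
  from regular[OF this] show "aircraft_flat_at A P"
    unfolding aircraft_regular_flat_output_def aircraft_flat_at_def by blast
qed

end
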